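(* Let $n\ge 2$, $\alpha\in(0,1)$, $\lambda>0$, and let $A:\mathbb{R}^n\times\mathbb{R}^n\to\mathbb{C}$ be measurable with $0<\lambda\le \operatorname{Re}A(x,y)\le |A(x,y)|\le\lambda^{-1}$ for a.e. $(x,y)$. Let $f\in L^2(\mathbb{R}^n)$ and let $u\in W^{\alpha,2}(\mathbb{R}^n)$ be a weak solution to $\mathcal{L}_{\alpha,A}u=f$. Then $$\Gamma u(x):=\bigg(\int_{\mathbb{R}^n}\frac{|u(x)-u(y)|^2}{|x-y|^{n+2\alpha}}\,dy\bigg)^{1/2}$$ satisfies, for some $p>2$ and a constant $c$ both depending only on $\lambda,n,\alpha$, $$\|\Gamma u\|_p\le c\,(\|u\|_2+\|f\|_2).$$
   Context: All function spaces consist of complex-valued functions; $\|\cdot\|_p$ is the norm of $L^p(\mathbb{R}^n)$. $W^{\alpha,2}(\mathbb{R}^n)$ is the space of $u\in L^2(\mathbb{R}^n)$ with $\iint_{\mathbb{R}^n\times\mathbb{R}^n}\frac{|u(x)-u(y)|^2}{|x-y|^{n+2\alpha}}\,dx\,dy<\infty$. The function $u\in W^{\alpha,2}(\mathbb{R}^n)$ is a weak solution to $\mathcal{L}_{\alpha,A}u=f$ if $$\iint_{\mathbb{R}^n\times\mathbb{R}^n}A(x,y)\frac{(u(x)-u(y))\,\overline{(\phi(x)-\phi(y))}}{|x-y|^{n+2\alpha}}\,dx\,dy=\int_{\mathbb{R}^n}f\,\overline{\phi}\,dx\qquad\text{for all }\phi\in C_0^\infty(\mathbb{R}^n).$$ 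*)

theory Defs
  imports "HOL-Analysis.Analysis"
begin

text \<open>Real powers of extended nonnegative reals; only used for exponents \<open>r > 0\<close>, so that
  \<open>\<infinity>\<close> is sent to \<open>\<infinity>\<close> and \<open>0\<close> to \<open>0\<close>.\<close>

definition ennpowr :: "ennreal \<Rightarrow> real \<Rightarrow> ennreal" where
  "ennpowr x r = (if x = \<infinity> then \<infinity> else ennreal (enn2real x powr r))"

text \<open>The \<open>L\<^sup>p\<close> norm of a nonnegative, possibly infinite-valued function, for \<open>0 < p < \<infinity>\<close>.\<close>

definition Lp_norm :: "real \<Rightarrow> (real ^ 'n \<Rightarrow> ennreal) \<Rightarrow> ennreal" where
  "Lp_norm p g = ennpowr (\<integral>\<^sup>+ x. ennpowr (g x) p \<partial>lebesgue) (1 / p)"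

abbreviation Lp_norm_complex :: "real \<Rightarrow> (real ^ 'n \<Rightarrow> complex) \<Rightarrow> ennreal" where
  "Lp_norm_complex p f \<equiv> Lp_norm p (\<lambda>x. ennreal (cmod (f x)))"

definition L2_functions :: "(real ^ 'n \<Rightarrow> complex) set" where
  "L2_functions = {f. f \<in> borel_measurable lebesgue \<and> Lp_norm_complex 2 f < \<infinity>}"

text \<open>On the diagonal,
  a null set, this denominator vanishes and the quotient is \<open>0\<close> by convention.\<close>

definition frac_denom :: "real \<Rightarrow> real ^ 'n \<Rightarrow> real ^ 'n \<Rightarrow> real" where
  "frac_denom \<alpha> x y = norm (x - y) powr (real CARD('n) + 2 * \<alpha>)"

definition frac_sobolev :: "real \<Rightarrow> (real ^ 'n \<Rightarrow> complex) set" where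
  "frac_sobolev \<alpha> = {u \<in> L2_functions.
     (\<integral>\<^sup>+ (x, y). ennreal ((cmod (u x - u y))\<^sup>2 / frac_denom \<alpha> x y) \<partial>lebesgue) < \<infinity>}"

primrec Ck_function :: "nat \<Rightarrow> (real ^ 'n \<Rightarrow> complex) \<Rightarrow> bool" where
  "Ck_function 0 \<phi> \<longleftrightarrow> continuous_on UNIV \<phi>"
| "Ck_function (Suc k) \<phi> \<longleftrightarrow> (\<forall>x. \<phi> differentiable at x) \<and>
     (\<forall>i. Ck_function k (\<lambda>x. frechet_derivative \<phi> (at x) (axis i 1)))"

definition test_functions :: "(real ^ 'n \<Rightarrow> complex) set" where
  "test_functions = {\<phi>. (\<forall>k. Ck_function k \<phi>) \<and> compact (closure {x. \<phi> x \<noteq> 0})}"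

text \<open>The Bochner integrals below are \<open>0\<close> for non-integrable integrands by convention. For
  essentially bounded measurable \<open>A\<close>, \<open>u \<in> frac_sobolev \<alpha>\<close> and \<open>f\<close> in \<open>L\<^sup>2\<close>, both integrands are
  integrable (Cauchy-Schwarz), so that the convention plays no role.\<close>

definition weak_solution ::
  "real \<Rightarrow> ((real ^ 'n) \<times> (real ^ 'n) \<Rightarrow> complex) \<Rightarrow> (real ^ 'n \<Rightarrow> complex)
     \<Rightarrow> (real ^ 'n \<Rightarrow> complex) \<Rightarrow> bool" where
  "weak_solution \<alpha> A f u \<longleftrightarrow> u \<in> frac_sobolev \<alpha> \<and>
     (\<forall>\<phi> \<in> test_functions.
        (LINT (x, y) | lebesgue.
           A (x, y) * ((u x - u y) * cnj (\<phi> x - \<phi> y)) / of_real (frac_denom \<alpha> x y))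
        = (LINT x | lebesgue. f x * cnj (\<phi> x)))"

definition Gamma_fun :: "real \<Rightarrow> (real ^ 'n \<Rightarrow> complex) \<Rightarrow> real ^ 'n \<Rightarrow> ennreal" where
  "Gamma_fun \<alpha> u x =
     ennpowr (\<integral>\<^sup>+ y. ennreal ((cmod (u x - u y))\<^sup>2 / frac_denom \<alpha> x y) \<partial>lebesgue) (1 / 2)"

end

theory Submission
  imports Defs
begin

text \<open>
  The argument works in physical space and avoids the Fourier transform. Put \<open>N = n + 2\<alpha>\<close> and let
  \<open>E(r)\<close> be the part of the Gagliardo energy of \<open>u\<close> coming from pairs with \<open>|x - y| < r\<close>. By density
  the equation may be tested with any \<open>\<phi>\<close> in the Sobolev space. The choice \<open>\<phi> = u\<close> bounds the whole
  energy. The choice \<open>\<phi> = u - P\<^sub>r u\<close>, where \<open>P\<^sub>r\<close> averages over an annulus of radius about \<open>r\<close>,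
  bounds \<open>E(r)\<close> by the energy of the pairs with \<open>|x - y| \<ge> r\<close>, damped by \<open>(|x - y| / r)\<^sup>-\<^sup>\<alpha>\<close>,
  plus \<open>r\<^sup>2\<^sup>\<alpha> \<parallel>f\<parallel>\<^sup>2\<close>. Integrating this hole-filling inequality
  against \<open>r\<^sup>-\<^sup>1\<^sup>-\<^sup>2\<^sup>\<epsilon> dr\<close> gains an extra factor \<open>|x - y|\<^sup>-\<^sup>2\<^sup>\<epsilon>\<close> in the energy.
  Finally \<open>(\<Gamma>u(x))\<^sup>2\<close> is controlled, at every scale \<open>r\<close>, by its part from \<open>|x - y| < r\<close> plus
  \<open>r\<^sup>-\<^sup>N \<parallel>u\<parallel>\<^sup>2\<close>; choosing \<open>r\<close> depending on \<open>x\<close> turns the gained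
  differentiability into integrability, with \<open>p = 2 + 4\<epsilon>/N\<close>.\<close>

section \<open>Radial integrals\<close>

text \<open>On pairs closer than \<open>r\<close> the differences of \<open>u\<close> and of the
  test function differ by a difference of averages, and an average at scale \<open>r\<close> is
  Lipschitz there with a constant read off from differences of \<open>u\<close> over distances
  comparable to \<open>r\<close>; these belong to the right-hand side. The gain comes from comparing
  two integrals in \<open>r\<close>: for a pair at distance \<open>t < 1\<close> the weight
  \<open>2 * \<epsilon> * r powr (-1 - 2 * \<epsilon>)\<close> yields about
  \<open>t powr (-2 * \<epsilon>)\<close> from \<open>r > t\<close>, but thanks to the damping only
  a multiple \<open>\<epsilon> / \<alpha>\<close> of this from \<open>r \<le> t\<close>. Hence
  \<open>\<epsilon>\<close> is chosen from the constant of the hole-filling inequality, which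
  depends on \<open>n\<close>, \<open>\<alpha>\<close> and \<open>lam\<close> alone, and so does
  \<open>p\<close>. The given functions are only Lebesgue measurable, while Tonelli is applied
  throughout; the estimates are proved for Borel representatives and transferred at the end.\<close>

lemma nn_integral_powr_tail:
  fixes a s :: real
  assumes "s < -1" "a > 0"
  shows "(\<integral>\<^sup>+t. ennreal (if a \<le> t then t powr s else 0) \<partial>lborel) = ennreal (a powr (s+1) / (-(s+1)))"
proof -
  have "(\<integral>\<^sup>+t. ennreal (t powr s) * indicator {a..} t \<partial>lborel) = ennreal (-(a powr (s+1)) / (s+1))"
    by (rule nn_integral_has_integral_lebesgue'[OF _ has_integral_powr_to_inf[OF assms]]) auto
  moreover have "ennreal (t powr s) * indicator {a..} t = ennreal (if a \<le> t then t powr s else 0)" for t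
    by (auto simp: indicator_def)
  moreover have "-(a powr (s+1)) / (s+1) = a powr (s+1) / (-(s+1))"
    using assms by (simp add: field_simps)
  ultimately show ?thesis by simp
qed

lemma nn_integral_powr_from_0:
  fixes c s :: real
  assumes "s > -1" "c \<ge> 0"
  shows "(\<integral>\<^sup>+t. ennreal (if 0 \<le> t \<and> t \<le> c then t powr s else 0) \<partial>lborel) = ennreal (c powr (s+1) / (s+1))"
proof -
  have "(\<integral>\<^sup>+t. ennreal (t powr s) * indicator {0..c} t \<partial>lborel) = ennreal (c powr (s+1) / (s+1))"
    by (rule nn_integral_has_integral_lebesgue'[OF _ has_integral_powr_from_0[OF assms]]) auto
  moreover have "ennreal (t powr s) * indicator {0..c} t = ennreal (if 0 \<le> t \<and> t \<le> c then t powr s else 0)" for t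
    by (auto simp: indicator_def)
  ultimately show ?thesis by simp
qed

lemma nn_integral_powr_between:
  fixes a b s :: real
  assumes "0 < a" "a \<le> b" "s \<noteq> -1"
  shows "(\<integral>\<^sup>+t. ennreal (if a \<le> t \<and> t \<le> b then t powr s else 0) \<partial>lborel)
    = ennreal ((b powr (s+1) - a powr (s+1)) / (s+1))"
proof -
  have "((\<lambda>t. t powr s) has_integral (b powr (s+1) / (s+1) - a powr (s+1) / (s+1))) {a..b}"
    by (rule fundamental_theorem_of_calculus)
      (use assms in \<open>auto intro!: derivative_eq_intros simp flip: has_real_derivative_iff_has_vector_derivative\<close>)
  then have "(\<integral>\<^sup>+t. ennreal (t powr s) * indicator {a..b} t \<partial>lborel) = ennreal (b powr (s+1) / (s+1) - a powr (s+1) / (s+1))"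
    by (intro nn_integral_has_integral_lebesgue') auto
  moreover have "ennreal (t powr s) * indicator {a..b} t = ennreal (if a \<le> t \<and> t \<le> b then t powr s else 0)" for t
    by (auto simp: indicator_def)
  ultimately show ?thesis by (simp add: diff_divide_distrib)
qed

lemma nn_integral_lborel_translate:
  fixes f :: "'a::euclidean_space \<Rightarrow> ennreal"
  assumes [measurable]: "f \<in> borel_measurable borel"
  shows "(\<integral>\<^sup>+y. f (c + y) \<partial>lborel) = (\<integral>\<^sup>+y. f y \<partial>lborel)"
proof -
  have "(\<integral>\<^sup>+y. f y \<partial>lborel) = (\<integral>\<^sup>+y. f y \<partial>distr lborel borel ((+) c))"
    by (simp add: lborel_distr_plus)
  also have "\<dots> = (\<integral>\<^sup>+y. f (c + y) \<partial>lborel)"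
    by (subst nn_integral_distr) auto
  finally show ?thesis by simp
qed

lemma nn_integral_lborel_dist:
  fixes x :: "'a::euclidean_space"
  assumes [measurable]: "f \<in> borel_measurable borel"
  shows "(\<integral>\<^sup>+y. f (dist x y) \<partial>lborel) = (\<integral>\<^sup>+(y::'a). f (norm y) \<partial>lborel)"
proof -
  have "(\<integral>\<^sup>+y. f (dist x y) \<partial>lborel) = (\<integral>\<^sup>+y. f (dist x (x + y)) \<partial>lborel)"
    by (rule nn_integral_lborel_translate[symmetric]) measurable
  then show ?thesis by (simp add: dist_norm)
qed

text \<open>Both radial estimates write \<open>|y|\<^sup>-\<^sup>s\<close> as the integral of \<open>s t\<^sup>-\<^sup>s\<^sup>-\<^sup>1\<close> over \<open>t \<ge> |y|\<close> and use
  Tonelli together with the volume of balls.\<close>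

lemma nn_integral_radial_tail:
  fixes s r :: real
  assumes s: "s > DIM('a::euclidean_space)" and r: "r > 0"
  shows "(\<integral>\<^sup>+(y::'a). ennreal (if r \<le> norm y then norm y powr (-s) else 0) \<partial>lborel)
     \<le> ennreal (s * unit_ball_vol (DIM('a)) / (s - DIM('a)) * r powr (DIM('a) - s))"
proof -
  let ?n = "real (DIM('a))" let ?w = "unit_ball_vol ?n"
  have n: "?n \<ge> 1" by (simp add: Suc_leI)
  have s0: "s > 0" using s n by linarith
  have eq: "ennreal (if r \<le> norm y then norm y powr (-s) else 0)
     = (\<integral>\<^sup>+t. ennreal (if r \<le> norm y \<and> norm y \<le> t then s * t powr (-s-1) else 0) \<partial>lborel)" for y :: 'a
  proof (cases "r \<le> norm y")
    case True
    then have y0: "norm y > 0" using r by linarith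
    have "(\<integral>\<^sup>+t. ennreal (if r \<le> norm y \<and> norm y \<le> t then s * t powr (-s-1) else 0) \<partial>lborel)
      = (\<integral>\<^sup>+t. ennreal s * ennreal (if norm y \<le> t then t powr (-s-1) else 0) \<partial>lborel)"
      using True s n by (intro nn_integral_cong) (auto simp: ennreal_mult[symmetric])
    also have "\<dots> = ennreal s * ennreal (norm y powr (-s) / s)"
      using y0 s0 by (subst nn_integral_cmult) (simp_all add: nn_integral_powr_tail)
    finally show ?thesis using True s n by (simp add: ennreal_mult[symmetric])
  qed auto
  have "(\<integral>\<^sup>+(y::'a). ennreal (if r \<le> norm y then norm y powr (-s) else 0) \<partial>lborel)
    = (\<integral>\<^sup>+(y::'a). \<integral>\<^sup>+t. ennreal (if r \<le> norm y \<and> norm y \<le> t then s * t powr (-s-1) else 0) \<partial>lborel \<partial>lborel)"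
    by (simp add: eq)
  also have "\<dots> = (\<integral>\<^sup>+t. \<integral>\<^sup>+(y::'a). ennreal (if r \<le> norm y \<and> norm y \<le> t then s * t powr (-s-1) else 0) \<partial>lborel \<partial>lborel)"
    by (rule lborel_pair.Fubini') measurable
  \<comment> \<open>Dropping \<open>r \<le> norm y\<close> from the inner integral leaves a full
    ball of radius \<open>t\<close>; the condition \<open>r \<le> t\<close> survives because for
    smaller \<open>t\<close> the set is empty.\<close>
  also have "\<dots> \<le> (\<integral>\<^sup>+t. ennreal (s * ?w) * ennreal (if r \<le> t then t powr (?n - s - 1) else 0) \<partial>lborel)"
  proof (intro nn_integral_mono)
    fix t :: real
    show "(\<integral>\<^sup>+(y::'a). ennreal (if r \<le> norm y \<and> norm y \<le> t then s * t powr (-s-1) else 0) \<partial>lborel)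
       \<le> ennreal (s * ?w) * ennreal (if r \<le> t then t powr (?n - s - 1) else 0)"
    proof (cases "r \<le> t")
      case True
      have "(\<integral>\<^sup>+(y::'a). ennreal (if r \<le> norm y \<and> norm y \<le> t then s * t powr (-s-1) else 0) \<partial>lborel)
        \<le> (\<integral>\<^sup>+(y::'a). ennreal (s * t powr (-s-1)) * indicator (cball 0 t) y \<partial>lborel)"
        by (intro nn_integral_mono) (auto simp: indicator_def)
      also have "\<dots> = ennreal (s * t powr (-s-1)) * ennreal (?w * t ^ DIM('a))"
        using True r by (subst nn_integral_cmult_indicator) (auto simp: emeasure_cball)
      also have "\<dots> = ennreal (s * ?w) * ennreal (t powr (-s-1) * t powr ?n)"
        using True r s n by (simp add: ennreal_mult[symmetric] powr_realpow mult_ac)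
      also have "t powr (-s-1) * t powr ?n = t powr (?n - s - 1)"
        by (simp add: powr_add[symmetric] algebra_simps)
      finally show ?thesis using True by simp
    next
      case False
      have "(\<lambda>y::'a. ennreal (if r \<le> norm y \<and> norm y \<le> t then s * t powr (-s-1) else 0)) = (\<lambda>y. 0)"
        using False by auto
      then show ?thesis using False by simp
    qed
  qed
  also have "\<dots> = ennreal (s * ?w) * ennreal (r powr (?n - s) / (s - ?n))"
    using r s by (subst nn_integral_cmult) (simp_all add: nn_integral_powr_tail)
  also have "\<dots> = ennreal (s * ?w / (s - ?n) * r powr (?n - s))"
    using r s n by (simp add: ennreal_mult[symmetric])
  finally show ?thesis by simp
qed

lemma nn_integral_radial_near:
  fixes s r :: real
  assumes s: "0 < s" "s < DIM('a::euclidean_space)" and r: "r > 0"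
  shows "(\<integral>\<^sup>+(y::'a). ennreal (if norm y < r then norm y powr (-s) else 0) \<partial>lborel)
     \<le> ennreal ((s * unit_ball_vol (DIM('a)) / (DIM('a) - s) + unit_ball_vol (DIM('a))) * r powr (DIM('a) - s))"
proof -
  let ?n = "real (DIM('a))" let ?w = "unit_ball_vol ?n"
  have n: "?n \<ge> 1" by (simp add: Suc_leI)
  \<comment> \<open>Only an inequality holds: at \<open>y = 0\<close> the convention
    \<open>0 powr (-s) = 0\<close> makes the left side vanish, while the integral on the right is
    infinite.\<close>
  have le: "ennreal (if norm y < r then norm y powr (-s) else 0)
     \<le> (\<integral>\<^sup>+t. ennreal (if norm y < r \<and> norm y \<le> t then s * t powr (-s-1) else 0) \<partial>lborel)" for y :: 'a
  proof (cases "norm y < r \<and> y \<noteq> 0")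
    case True
    have "(\<integral>\<^sup>+t. ennreal (if norm y < r \<and> norm y \<le> t then s * t powr (-s-1) else 0) \<partial>lborel)
      = (\<integral>\<^sup>+t. ennreal s * ennreal (if norm y \<le> t then t powr (-s-1) else 0) \<partial>lborel)"
      using True s n by (intro nn_integral_cong) (auto simp: ennreal_mult[symmetric])
    also have "\<dots> = ennreal s * ennreal (norm y powr (-s) / s)"
      using True r s n by (subst nn_integral_cmult) (simp_all add: nn_integral_powr_tail)
    finally show ?thesis using True s n by (simp add: ennreal_mult[symmetric])
  qed auto
  have "(\<integral>\<^sup>+(y::'a). ennreal (if norm y < r then norm y powr (-s) else 0) \<partial>lborel)
    \<le> (\<integral>\<^sup>+(y::'a). \<integral>\<^sup>+t. ennreal (if norm y < r \<and> norm y \<le> t then s * t powr (-s-1) else 0) \<partial>lborel \<partial>lborel)"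
    by (intro nn_integral_mono le)
  also have "\<dots> = (\<integral>\<^sup>+t. \<integral>\<^sup>+(y::'a). ennreal (if norm y < r \<and> norm y \<le> t then s * t powr (-s-1) else 0) \<partial>lborel \<partial>lborel)"
    by (rule lborel_pair.Fubini') measurable
  \<comment> \<open>For \<open>t \<le> r\<close> the relevant ball has radius \<open>t\<close>, for
    \<open>t > r\<close> it has radius \<open>r\<close>. The second range produces the extra summand
    \<open>unit_ball_vol\<close> in the constant.\<close>
  also have "\<dots> \<le> (\<integral>\<^sup>+t. ennreal (s * ?w) * ennreal (if 0 \<le> t \<and> t \<le> r then t powr (?n - s - 1) else 0)
       + ennreal (s * ?w * r ^ DIM('a)) * ennreal (if r \<le> t then t powr (-s-1) else 0) \<partial>lborel)"
  proof (intro nn_integral_mono)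
    fix t :: real
    let ?I = "(\<integral>\<^sup>+(y::'a). ennreal (if norm y < r \<and> norm y \<le> t then s * t powr (-s-1) else 0) \<partial>lborel)"
    let ?A = "ennreal (s * ?w) * ennreal (if 0 \<le> t \<and> t \<le> r then t powr (?n - s - 1) else 0)"
    let ?B = "ennreal (s * ?w * r ^ DIM('a)) * ennreal (if r \<le> t then t powr (-s-1) else 0)"
    have *: "?I \<le> ennreal (s * t powr (-s-1)) * ennreal (?w * q ^ DIM('a))" if "q = t \<or> q = r" "0 \<le> q" for q
    proof -
      have "?I \<le> (\<integral>\<^sup>+(y::'a). ennreal (s * t powr (-s-1)) * indicator (cball 0 q) y \<partial>lborel)"
        using that by (intro nn_integral_mono) (auto simp: indicator_def)
      also have "\<dots> = ennreal (s * t powr (-s-1)) * ennreal (?w * q ^ DIM('a))"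
        using that r by (subst nn_integral_cmult_indicator) (auto simp: emeasure_cball)
      finally show ?thesis .
    qed
    consider "t < 0" | "t = 0" | "0 < t" "t \<le> r" | "r < t" by linarith
    then show "?I \<le> ?A + ?B"
    proof cases
      case 1
      then have "\<not> (norm y < r \<and> norm y \<le> t)" for y :: 'a
        using norm_ge_zero[of y] by linarith
      then have "?I = (\<integral>\<^sup>+(y::'a). 0 \<partial>lborel)" by (intro nn_integral_cong) (simp only: if_False ennreal_0)
      then have "?I = 0" by simp
      then show ?thesis by simp
    next
      case 2
      then have "?I \<le> 0" using *[of t] by simp
      then show ?thesis by simp
    next
      case 3
      have "?I \<le> ennreal (s * t powr (-s-1)) * ennreal (?w * t ^ DIM('a))" using 3 by (intro *) auto
      also have "\<dots> = ennreal (s * ?w) * ennreal (t powr (-s-1) * t powr ?n)"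
        using 3 s n by (simp add: ennreal_mult[symmetric] powr_realpow mult_ac)
      also have "t powr (-s-1) * t powr ?n = t powr (?n - s - 1)"
        by (simp add: powr_add[symmetric] algebra_simps)
      finally have "?I \<le> ?A" using 3 by simp
      then show ?thesis by (simp add: add_increasing2)
    next
      case 4
      have "?I \<le> ennreal (s * t powr (-s-1)) * ennreal (?w * r ^ DIM('a))" using r by (intro *) auto
      also have "\<dots> = ?B" using 4 s r n by (simp add: ennreal_mult[symmetric] mult_ac)
      finally show ?thesis by (simp add: add_increasing)
    qed
  qed
  also have "\<dots> = ennreal (s * ?w) * ennreal (r powr (?n - s) / (?n - s)) + ennreal (s * ?w * r ^ DIM('a)) * ennreal (r powr (-s) / s)"
    using r s by (subst nn_integral_add) (simp_all add: nn_integral_cmult nn_integral_powr_tail nn_integral_powr_from_0)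
  also have "\<dots> = ennreal (s * ?w * (r powr (?n - s) / (?n - s)) + s * ?w * r ^ DIM('a) * (r powr (-s) / s))"
    using r s by (simp add: ennreal_mult[symmetric] ennreal_plus[symmetric] del: ennreal_plus)
  also have "s * ?w * r ^ DIM('a) * (r powr (-s) / s) = ?w * r powr (?n - s)"
    using r s by (simp add: powr_realpow[symmetric] powr_diff powr_minus field_simps)
  also have "s * ?w * (r powr (?n - s) / (?n - s)) + ?w * r powr (?n - s) = (s * ?w / (?n - s) + ?w) * r powr (?n - s)"
    by (simp add: algebra_simps)
  finally show ?thesis .
qed

section \<open>Energies and averages\<close>

text \<open>The radial weight is a parameter, so that the parts of the Gagliardo energy at different
  scales, with or without extra powers of the distance, are all values of one functional.\<close>

definition energy :: "(real \<Rightarrow> real) \<Rightarrow> ('a::euclidean_space \<Rightarrow> complex) \<Rightarrow> ennreal" where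
  "energy \<kappa> u = (\<integral>\<^sup>+x. \<integral>\<^sup>+y. ennreal (\<kappa> (dist x y) * (cmod (u x - u y))\<^sup>2) \<partial>lborel \<partial>lborel)"

abbreviation gagliardo :: "real \<Rightarrow> ('a::euclidean_space \<Rightarrow> complex) \<Rightarrow> ennreal" where
  "gagliardo N \<equiv> energy (\<lambda>t. t powr (-N))"

abbreviation gamma_sq :: "real \<Rightarrow> ('a::euclidean_space \<Rightarrow> complex) \<Rightarrow> 'a \<Rightarrow> ennreal" where
  "gamma_sq N u x \<equiv> (\<integral>\<^sup>+y. ennreal (dist x y powr (-N) * (cmod (u x - u y))\<^sup>2) \<partial>lborel)"

abbreviation near :: "real \<Rightarrow> real \<Rightarrow> real \<Rightarrow> real" where
  "near N r t \<equiv> (if t < r then t powr (-N) else 0)"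

abbreviation far :: "real \<Rightarrow> real \<Rightarrow> real \<Rightarrow> real" where
  "far N r t \<equiv> (if r \<le> t then t powr (-N) else 0)"

text \<open>\<open>damped\<close> and \<open>amplified\<close> are conjugate: for
  \<open>t \<ge> r\<close> their product is the square of \<open>t powr (-N)\<close>. Young's
  inequality splits the far interaction of \<open>u\<close> with a test function so that
  \<open>u\<close> is charged with the damped weight. The test function can bear the amplified one
  because \<open>N - \<alpha>\<close> still exceeds the dimension.\<close>

abbreviation damped :: "real \<Rightarrow> real \<Rightarrow> real \<Rightarrow> real \<Rightarrow> real" where
  "damped \<alpha> N r t \<equiv> (if r \<le> t then (t / r) powr (-\<alpha>) * t powr (-N) else 0)"

abbreviation amplified :: "real \<Rightarrow> real \<Rightarrow> real \<Rightarrow> real \<Rightarrow> real" where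
  "amplified \<alpha> N r t \<equiv> (if r \<le> t then (t / r) powr \<alpha> * t powr (-N) else 0)"

definition l2sq :: "('a::euclidean_space \<Rightarrow> complex) \<Rightarrow> ennreal" where
  "l2sq u = (\<integral>\<^sup>+x. ennreal ((cmod (u x))\<^sup>2) \<partial>lborel)"

definition avg :: "('a::euclidean_space \<Rightarrow> real) \<Rightarrow> ('a \<Rightarrow> complex) \<Rightarrow> 'a \<Rightarrow> complex" where
  "avg \<psi> u x = (\<integral>z. of_real (\<psi> (z - x)) * u z \<partial>lborel)"

section \<open>Elementary inequalities for energies\<close>

lemma norm_diff_sq_le: "(norm (a - b))\<^sup>2 \<le> 2 * (norm a)\<^sup>2 + 2 * (norm (b::'a::real_normed_vector))\<^sup>2"
proof -
  have "(norm (a - b))\<^sup>2 \<le> (norm a + norm b)\<^sup>2"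
    by (intro power_mono norm_triangle_ineq4) auto
  also have "\<dots> \<le> 2 * (norm a)\<^sup>2 + 2 * (norm b)\<^sup>2"
    using zero_le_power2[of "norm a - norm b"] unfolding power2_sum power2_diff by linarith
  finally show ?thesis .
qed

lemma energy_mono:
  assumes "\<And>t. 0 \<le> t \<Longrightarrow> \<kappa> t \<le> \<kappa>' t"
  shows "energy \<kappa> u \<le> energy \<kappa>' u"
  unfolding energy_def by (intro nn_integral_mono ennreal_leI mult_right_mono assms) auto

lemma energy_add:
  assumes [measurable]: "\<kappa> \<in> borel_measurable borel" "\<kappa>' \<in> borel_measurable borel" "u \<in> borel_measurable borel"
    and nn: "\<And>t. 0 \<le> \<kappa> t" "\<And>t. 0 \<le> \<kappa>' t"
  shows "energy (\<lambda>t. \<kappa> t + \<kappa>' t) u = energy \<kappa> u + energy \<kappa>' u"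
  unfolding energy_def using nn
  by (simp add: distrib_right nn_integral_add)

lemma energy_cmult:
  assumes [measurable]: "\<kappa> \<in> borel_measurable borel" "u \<in> borel_measurable borel" and "0 \<le> c"
  shows "energy (\<lambda>t. c * \<kappa> t) u = ennreal c * energy \<kappa> u"
  unfolding energy_def using assms(3)
  by (simp add: mult.assoc ennreal_mult' nn_integral_cmult)

lemma energy_diff_le:
  assumes [measurable]: "\<kappa> \<in> borel_measurable borel" "u \<in> borel_measurable borel" "v \<in> borel_measurable borel"
    and nn: "\<And>t. 0 \<le> \<kappa> t"
  shows "energy \<kappa> (\<lambda>x. u x - v x) \<le> 2 * energy \<kappa> u + 2 * energy \<kappa> v"
proof -
  have "energy \<kappa> (\<lambda>x. u x - v x) \<le> (\<integral>\<^sup>+x. \<integral>\<^sup>+y. 2 * ennreal (\<kappa> (dist x y) * (cmod (u x - u y))\<^sup>2)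
      + 2 * ennreal (\<kappa> (dist x y) * (cmod (v x - v y))\<^sup>2) \<partial>lborel \<partial>lborel)"
    unfolding energy_def
  proof (intro nn_integral_mono)
    fix x y
    have "(u x - v x) - (u y - v y) = (u x - u y) - (v x - v y)" by simp
    then have "(cmod ((u x - v x) - (u y - v y)))\<^sup>2 \<le> 2 * (cmod (u x - u y))\<^sup>2 + 2 * (cmod (v x - v y))\<^sup>2"
      using norm_diff_sq_le[of "u x - u y" "v x - v y"] by (simp only:)
    then have "\<kappa> (dist x y) * (cmod ((u x - v x) - (u y - v y)))\<^sup>2
      \<le> \<kappa> (dist x y) * (2 * (cmod (u x - u y))\<^sup>2 + 2 * (cmod (v x - v y))\<^sup>2)"
      by (intro mult_left_mono nn)
    then have "ennreal (\<kappa> (dist x y) * (cmod ((u x - v x) - (u y - v y)))\<^sup>2)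
       \<le> ennreal (2 * (\<kappa> (dist x y) * (cmod (u x - u y))\<^sup>2) + 2 * (\<kappa> (dist x y) * (cmod (v x - v y))\<^sup>2))"
      by (intro ennreal_leI) (simp add: algebra_simps)
    then show "ennreal (\<kappa> (dist x y) * (cmod ((u x - v x) - (u y - v y)))\<^sup>2)
      \<le> 2 * ennreal (\<kappa> (dist x y) * (cmod (u x - u y))\<^sup>2) + 2 * ennreal (\<kappa> (dist x y) * (cmod (v x - v y))\<^sup>2)"
      using nn by (simp add: ennreal_mult' )
  qed
  also have "\<dots> = 2 * energy \<kappa> u + 2 * energy \<kappa> v"
    unfolding energy_def by (simp add: nn_integral_add nn_integral_cmult)
  finally show ?thesis .
qed

text \<open>No cancellation in \<open>u x - u y\<close> is used. This is good enough for weights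
  integrable over the whole space, that is for the tails \<open>t \<ge> r\<close>.\<close>

lemma energy_le_l2sq:
  fixes u :: "'a::euclidean_space \<Rightarrow> complex"
  assumes [measurable]: "\<kappa> \<in> borel_measurable borel" "u \<in> borel_measurable borel"
    and nn: "\<And>t. 0 \<le> \<kappa> t"
  shows "energy \<kappa> u \<le> 4 * (\<integral>\<^sup>+h. ennreal (\<kappa> (norm (h::'a))) \<partial>lborel) * l2sq u"
proof -
  let ?K = "\<integral>\<^sup>+h. ennreal (\<kappa> (norm (h::'a))) \<partial>lborel"
  have K: "(\<integral>\<^sup>+y. ennreal (\<kappa> (dist x y)) \<partial>lborel) = ?K" for x :: 'a
    using nn_integral_lborel_dist[of "\<lambda>t. ennreal (\<kappa> t)" x] by simp
  have "energy \<kappa> u \<le> (\<integral>\<^sup>+x. \<integral>\<^sup>+y. 2 * (ennreal ((cmod (u x))\<^sup>2) * ennreal (\<kappa> (dist x y)))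
      + 2 * (ennreal ((cmod (u y))\<^sup>2) * ennreal (\<kappa> (dist x y))) \<partial>lborel \<partial>lborel)"
    unfolding energy_def
  proof (intro nn_integral_mono)
    fix x y :: 'a
    have "ennreal (\<kappa> (dist x y) * (cmod (u x - u y))\<^sup>2)
       \<le> ennreal (\<kappa> (dist x y) * (2 * (cmod (u x))\<^sup>2 + 2 * (cmod (u y))\<^sup>2))"
      by (intro ennreal_leI mult_left_mono norm_diff_sq_le nn)
    also have "\<dots> = 2 * (ennreal ((cmod (u x))\<^sup>2) * ennreal (\<kappa> (dist x y)))
      + 2 * (ennreal ((cmod (u y))\<^sup>2) * ennreal (\<kappa> (dist x y)))"
      using nn by (simp add: ennreal_mult' distrib_left mult_ac)
    finally show "ennreal (\<kappa> (dist x y) * (cmod (u x - u y))\<^sup>2) \<le> \<dots>" .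
  qed
  also have "\<dots> = 2 * (\<integral>\<^sup>+x. \<integral>\<^sup>+y. ennreal ((cmod (u x))\<^sup>2) * ennreal (\<kappa> (dist x y)) \<partial>lborel \<partial>lborel)
      + 2 * (\<integral>\<^sup>+x. \<integral>\<^sup>+y. ennreal ((cmod (u y))\<^sup>2) * ennreal (\<kappa> (dist x y)) \<partial>lborel \<partial>lborel)"
    by (simp add: nn_integral_add nn_integral_cmult)
  also have "(\<integral>\<^sup>+x. \<integral>\<^sup>+y. ennreal ((cmod (u y))\<^sup>2) * ennreal (\<kappa> (dist x y)) \<partial>lborel \<partial>lborel)
     = (\<integral>\<^sup>+y. \<integral>\<^sup>+x. ennreal ((cmod (u y))\<^sup>2) * ennreal (\<kappa> (dist y x)) \<partial>lborel \<partial>lborel)"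
    by (subst lborel_pair.Fubini') (simp_all add: dist_commute)
  also have "(\<integral>\<^sup>+x. \<integral>\<^sup>+y. ennreal ((cmod (u x))\<^sup>2) * ennreal (\<kappa> (dist x y)) \<partial>lborel \<partial>lborel) = l2sq u * ?K"
    unfolding l2sq_def by (simp add: nn_integral_cmult K nn_integral_multc)
  also have "2 * (l2sq u * ?K) + 2 * (l2sq u * ?K) = (2 + 2) * (l2sq u * ?K)"
    by (simp only: distrib_right)
  finally show ?thesis by (simp add: mult_ac)
qed

text \<open>The sesquilinear form is a single integral over the product space, whereas the estimates
  of averages use iterated integrals; this identity connects the two.\<close>

lemma energy_eq_prod:
  fixes u :: "'a::euclidean_space \<Rightarrow> complex"
  assumes [measurable]: "\<kappa> \<in> borel_measurable borel" "u \<in> borel_measurable borel"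
  shows "energy \<kappa> u = (\<integral>\<^sup>+z. ennreal (\<kappa> (dist (fst z) (snd z)) * (cmod (u (fst z) - u (snd z)))\<^sup>2) \<partial>lborel)"
  unfolding energy_def
  by (subst lborel_prod[symmetric], subst lborel.nn_integral_fst[symmetric]) simp_all

text \<open>No integrability is needed: the integral of a non-integrable function is \<open>0\<close>.\<close>

lemma norm_lebesgue_integral_sq_le:
  fixes g :: "'a \<Rightarrow> complex" and q :: "'a \<Rightarrow> real"
  assumes [measurable]: "\<psi> \<in> borel_measurable M" "g \<in> borel_measurable M" "q \<in> borel_measurable M"
    and q: "\<And>x. \<bar>q x\<bar> \<le> \<psi> x"
  shows "ennreal ((cmod (\<integral>x. of_real (q x) * g x \<partial>M))\<^sup>2)
    \<le> (\<integral>\<^sup>+x. ennreal (\<psi> x) \<partial>M) * (\<integral>\<^sup>+x. ennreal (\<psi> x * (cmod (g x))\<^sup>2) \<partial>M)"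
proof -
  have nn: "0 \<le> \<psi> x" for x using q[of x] by linarith
  have "ennreal (cmod (\<integral>x. of_real (q x) * g x \<partial>M)) \<le> (\<integral>\<^sup>+x. ennreal (cmod (of_real (q x) * g x)) \<partial>M)"
    by (cases "integrable M (\<lambda>x. of_real (q x) * g x)")
      (simp_all add: integral_norm_bound_ennreal not_integrable_integral_eq)
  \<comment> \<open>Cauchy-Schwarz with \<open>\<psi> = sqrt \<psi> * sqrt \<psi>\<close>. The
    integrated factor \<open>q\<close> is kept apart from its majorant \<open>\<psi>\<close> because
    it may change sign when it is a difference of two kernels.\<close>
  also have "\<dots> \<le> (\<integral>\<^sup>+x. ennreal (sqrt (\<psi> x)) * ennreal (sqrt (\<psi> x) * cmod (g x)) \<partial>M)"
    using q nn by (intro nn_integral_mono) (auto simp: norm_mult ennreal_mult'[symmetric] mult.assoc[symmetric] intro!: ennreal_leI mult_right_mono)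
  finally have "ennreal (cmod (\<integral>x. of_real (q x) * g x \<partial>M)) ^ 2 \<le> \<dots> ^ 2"
    by (rule power_mono) simp
  also have "\<dots> \<le> (\<integral>\<^sup>+x. ennreal (sqrt (\<psi> x)) ^ 2 \<partial>M) * (\<integral>\<^sup>+x. ennreal (sqrt (\<psi> x) * cmod (g x)) ^ 2 \<partial>M)"
    by (rule Cauchy_Schwarz_nn_integral) measurable
  finally show ?thesis
    using nn by (simp add: ennreal_power power_mult_distrib)
qed


section \<open>Averages of square-integrable functions\<close>

lemma integrable_mult_l2:
  fixes u :: "'a::euclidean_space \<Rightarrow> complex" and q :: "'a \<Rightarrow> real"
  assumes [measurable]: "u \<in> borel_measurable borel" "q \<in> borel_measurable borel"
    and q: "\<And>z. \<bar>q z\<bar> \<le> B" "\<And>z. norm (z - x) > R \<Longrightarrow> q z = 0" and u: "l2sq u < \<infinity>"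
  shows "integrable lborel (\<lambda>z. of_real (q z) * u z)"
proof (rule integrableI_bounded)
  have B: "0 \<le> B" using q(1)[of 0] by linarith
  have "(\<integral>\<^sup>+z. ennreal (norm (of_real (q z) * u z)) \<partial>lborel)
    \<le> (\<integral>\<^sup>+z. ennreal (B^2) * indicator (cball x R) z + ennreal ((cmod (u z))\<^sup>2) \<partial>lborel)"
  proof (intro nn_integral_mono)
    fix z
    show "ennreal (norm (of_real (q z) * u z)) \<le> ennreal (B^2) * indicator (cball x R) z + ennreal ((cmod (u z))\<^sup>2)"
    proof (cases "norm (z - x) > R")
      case True
      then show ?thesis using q(2) by simp
    next
      case False
      \<comment> \<open>Inside the ball \<open>B * cmod (u z)\<close> is split into
        \<open>B\<^sup>2\<close>, integrable over the ball, and \<open>(cmod (u z))\<^sup>2\<close>,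
        integrable by hypothesis.\<close>
      have "\<bar>q z\<bar> * cmod (u z) \<le> B * cmod (u z)" by (intro mult_right_mono q) auto
      also have "\<dots> \<le> B\<^sup>2 + (cmod (u z))\<^sup>2"
        using zero_le_power2[of "B - cmod (u z)"] B mult_nonneg_nonneg[OF B norm_ge_zero[of "u z"]] unfolding power2_diff by linarith
      finally have "ennreal (norm (of_real (q z) * u z)) \<le> ennreal (B\<^sup>2 + (cmod (u z))\<^sup>2)"
        by (intro ennreal_leI) (simp add: norm_mult)
      then show ?thesis using False by (simp add: dist_norm norm_minus_commute)
    qed
  qed
  also have "\<dots> = ennreal (B^2) * emeasure lborel (cball x R) + l2sq u"
  proof -
    have [measurable]: "cball x R \<in> sets borel" by (intro borel_closed closed_cball)
    have "(\<lambda>z. ennreal (B^2) * indicator (cball x R) z) \<in> borel_measurable lborel" by measurable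
    then show ?thesis unfolding l2sq_def by (simp add: nn_integral_add nn_integral_cmult_indicator)
  qed
  also have "\<dots> < \<infinity>"
    using u emeasure_bounded_finite[OF bounded_cball[of x R]] by (simp add: ennreal_mult_less_top)
  finally show "(\<integral>\<^sup>+z. ennreal (norm (of_real (q z) * u z)) \<partial>lborel) < \<infinity>" .
qed measurable

text \<open>A probability density. The bound \<open>B\<close> and the radius \<open>R\<close> make
  averages of square-integrable functions well defined; total mass one makes averages reproduce
  constants, so that \<open>u - avg \<psi> u\<close> is itself an average of differences of
  \<open>u\<close>.\<close>

locale avg_kernel =
  fixes \<psi> :: "'a::euclidean_space \<Rightarrow> real" and B R :: real
  assumes meas[measurable]: "\<psi> \<in> borel_measurable borel"
    and nonneg: "\<And>z. 0 \<le> \<psi> z"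
    and bound: "\<And>z. \<psi> z \<le> B"
    and supp: "\<And>z. norm z > R \<Longrightarrow> \<psi> z = 0"
    and total: "(\<integral>\<^sup>+z. ennreal (\<psi> z) \<partial>lborel) = 1"
begin

lemma total_shift: "(\<integral>\<^sup>+z. ennreal (\<psi> (z - x)) \<partial>lborel) = 1"
  using nn_integral_lborel_translate[of "\<lambda>z. ennreal (\<psi> z)" "-x"] total
  by (simp add: uminus_add_conv_diff)

lemma integral_shift: "(\<integral>z. \<psi> (z - x) \<partial>lborel) = 1" "integrable lborel (\<lambda>z. \<psi> (z - x))"
proof -
  have "has_bochner_integral lborel (\<lambda>z. \<psi> (z - x)) 1"
    by (rule has_bochner_integral_nn_integral) (simp_all add: nonneg total_shift)
  then show "(\<integral>z. \<psi> (z - x) \<partial>lborel) = 1" "integrable lborel (\<lambda>z. \<psi> (z - x))"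
    by (auto simp: has_bochner_integral_iff)
qed

lemma avg_integrable:
  assumes [measurable]: "u \<in> borel_measurable borel" and u: "l2sq u < \<infinity>"
  shows "integrable lborel (\<lambda>z. of_real (\<psi> (z - x)) * u z)"
  by (rule integrable_mult_l2[where B = B and R = R and x = x]) (use u in \<open>auto simp: nonneg bound supp\<close>)

lemma avg_measurable[measurable]:
  assumes [measurable]: "u \<in> borel_measurable borel"
  shows "avg \<psi> u \<in> borel_measurable borel"
  unfolding avg_def[abs_def] by measurable

lemma avg_minus:
  assumes [measurable]: "u \<in> borel_measurable borel" and u: "l2sq u < \<infinity>"
  shows "u x - avg \<psi> u x = (\<integral>z. of_real (\<psi> (z - x)) * (u x - u z) \<partial>lborel)"
proof -
  have i: "integrable lborel (\<lambda>z. of_real (\<psi> (z - x)) :: complex)"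
    using integral_shift(2)[of x] by (rule integrable_of_real)
  have "(\<integral>z. of_real (\<psi> (z - x)) * (u x - u z) \<partial>lborel)
     = (\<integral>z. of_real (\<psi> (z - x)) * u x - of_real (\<psi> (z - x)) * u z \<partial>lborel)"
    by (simp add: algebra_simps)
  also have "\<dots> = (\<integral>z. of_real (\<psi> (z - x)) * u x \<partial>lborel) - avg \<psi> u x"
    unfolding avg_def by (intro Bochner_Integration.integral_diff avg_integrable u integrable_mult_left i) auto
  also have "(\<integral>z. of_real (\<psi> (z - x)) * u x \<partial>lborel) = u x"
    using integral_shift(1)[of x] by simp
  finally show ?thesis by simp
qed

text \<open>Jensen's inequality for the density \<open>\<psi>\<close>, applied for each
  \<open>x\<close> to the differences \<open>u x - u z\<close>.\<close>

lemma l2sq_minus_avg: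
  assumes [measurable]: "u \<in> borel_measurable borel" and u: "l2sq u < \<infinity>"
  shows "l2sq (\<lambda>x. u x - avg \<psi> u x) \<le> (\<integral>\<^sup>+x. \<integral>\<^sup>+z. ennreal (\<psi> (z - x) * (cmod (u x - u z))\<^sup>2) \<partial>lborel \<partial>lborel)"
  unfolding l2sq_def
proof (intro nn_integral_mono)
  fix x
  show "ennreal ((cmod (u x - avg \<psi> u x))\<^sup>2) \<le> (\<integral>\<^sup>+z. ennreal (\<psi> (z - x) * (cmod (u x - u z))\<^sup>2) \<partial>lborel)"
    using norm_lebesgue_integral_sq_le[of "\<lambda>z. \<psi> (z - x)" lborel "\<lambda>z. u x - u z" "\<lambda>z. \<psi> (z - x)"]
    by (simp add: avg_minus[OF _ u] nonneg total_shift)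
qed

lemma avg_translate:
  assumes [measurable]: "u \<in> borel_measurable borel"
  shows "avg \<psi> u x = (\<integral>k. of_real (\<psi> k) * u (x + k) \<partial>lborel)"
proof -
  have "avg \<psi> u x = (\<integral>z. of_real (\<psi> (z - x)) * u z \<partial>distr lborel borel ((+) x))"
    unfolding avg_def by (simp add: lborel_distr_plus)
  also have "\<dots> = (\<integral>k. of_real (\<psi> k) * u (x + k) \<partial>lborel)"
    by (subst integral_distr) auto
  finally show ?thesis .
qed

lemma avg_translate_integrable:
  assumes [measurable]: "u \<in> borel_measurable borel" and u: "l2sq u < \<infinity>"
  shows "integrable lborel (\<lambda>k. of_real (\<psi> k) * u (x + k))"
proof -
  have "integrable (distr lborel borel ((+) x)) (\<lambda>z. of_real (\<psi> (z - x)) * u z)"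
    using avg_integrable[OF _ u, of x] by (simp add: lborel_distr_plus)
  then show ?thesis by (subst (asm) integrable_distr_eq) auto
qed

text \<open>An average is a convex combination of translates of \<open>u\<close>, while the energy
  is convex and, since the weight sees only the distance, translation invariant.\<close>

lemma energy_avg_le:
  assumes [measurable]: "u \<in> borel_measurable borel" "\<kappa> \<in> borel_measurable borel"
    and u: "l2sq u < \<infinity>" and nn: "\<And>t. 0 \<le> \<kappa> t"
  shows "energy \<kappa> (avg \<psi> u) \<le> energy \<kappa> u"
proof -
  have "energy \<kappa> (avg \<psi> u) \<le> (\<integral>\<^sup>+x. \<integral>\<^sup>+y. \<integral>\<^sup>+k. ennreal (\<psi> k) * ennreal (\<kappa> (dist x y) * (cmod (u (x + k) - u (y + k)))\<^sup>2) \<partial>lborel \<partial>lborel \<partial>lborel)"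
    unfolding energy_def
  proof (intro nn_integral_mono)
    fix x y
    have "avg \<psi> u x - avg \<psi> u y = (\<integral>k. of_real (\<psi> k) * (u (x + k) - u (y + k)) \<partial>lborel)"
      using Bochner_Integration.integral_diff[OF avg_translate_integrable[OF assms(1) u, of x] avg_translate_integrable[OF assms(1) u, of y]]
      by (simp add: avg_translate right_diff_distrib)
    then have "ennreal ((cmod (avg \<psi> u x - avg \<psi> u y))\<^sup>2) \<le> (\<integral>\<^sup>+k. ennreal (\<psi> k * (cmod (u (x + k) - u (y + k)))\<^sup>2) \<partial>lborel)"
      using norm_lebesgue_integral_sq_le[of \<psi> lborel "\<lambda>k. u (x + k) - u (y + k)" \<psi>]
      by (simp add: nonneg total)
    then have "ennreal (\<kappa> (dist x y)) * ennreal ((cmod (avg \<psi> u x - avg \<psi> u y))\<^sup>2)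
      \<le> ennreal (\<kappa> (dist x y)) * (\<integral>\<^sup>+k. ennreal (\<psi> k * (cmod (u (x + k) - u (y + k)))\<^sup>2) \<partial>lborel)"
      by (rule mult_left_mono) simp
    then show "ennreal (\<kappa> (dist x y) * (cmod (avg \<psi> u x - avg \<psi> u y))\<^sup>2)
      \<le> (\<integral>\<^sup>+k. ennreal (\<psi> k) * ennreal (\<kappa> (dist x y) * (cmod (u (x + k) - u (y + k)))\<^sup>2) \<partial>lborel)"
      using nn nonneg by (simp add: ennreal_mult' nn_integral_cmult[symmetric] mult_ac)
  qed
  also have "\<dots> = (\<integral>\<^sup>+x. \<integral>\<^sup>+k. \<integral>\<^sup>+y. ennreal (\<psi> k) * ennreal (\<kappa> (dist x y) * (cmod (u (x + k) - u (y + k)))\<^sup>2) \<partial>lborel \<partial>lborel \<partial>lborel)"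
    by (intro nn_integral_cong lborel_pair.Fubini') measurable
  also have "\<dots> = (\<integral>\<^sup>+k. \<integral>\<^sup>+x. \<integral>\<^sup>+y. ennreal (\<psi> k) * ennreal (\<kappa> (dist x y) * (cmod (u (x + k) - u (y + k)))\<^sup>2) \<partial>lborel \<partial>lborel \<partial>lborel)"
    by (intro lborel_pair.Fubini') measurable
  also have "\<dots> = (\<integral>\<^sup>+k. ennreal (\<psi> k) * energy \<kappa> u \<partial>lborel)"
  proof (intro nn_integral_cong)
    fix k
    have "(\<integral>\<^sup>+x. \<integral>\<^sup>+y. ennreal (\<psi> k) * ennreal (\<kappa> (dist x y) * (cmod (u (x + k) - u (y + k)))\<^sup>2) \<partial>lborel \<partial>lborel)
      = ennreal (\<psi> k) * (\<integral>\<^sup>+x. \<integral>\<^sup>+y. ennreal (\<kappa> (dist (k + x) (k + y)) * (cmod (u (k + x) - u (k + y)))\<^sup>2) \<partial>lborel \<partial>lborel)"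
      by (simp add: nn_integral_cmult add.commute)
    also have "(\<integral>\<^sup>+x. \<integral>\<^sup>+y. ennreal (\<kappa> (dist (k + x) (k + y)) * (cmod (u (k + x) - u (k + y)))\<^sup>2) \<partial>lborel \<partial>lborel)
      = (\<integral>\<^sup>+x. \<integral>\<^sup>+y. ennreal (\<kappa> (dist (k + x) y) * (cmod (u (k + x) - u y))\<^sup>2) \<partial>lborel \<partial>lborel)"
      by (intro nn_integral_cong nn_integral_lborel_translate) measurable
    also have "\<dots> = energy \<kappa> u"
      unfolding energy_def by (rule nn_integral_lborel_translate) measurable
    finally show "(\<integral>\<^sup>+x. \<integral>\<^sup>+y. ennreal (\<psi> k) * ennreal (\<kappa> (dist x y) * (cmod (u (x + k) - u (y + k)))\<^sup>2) \<partial>lborel \<partial>lborel)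
      = ennreal (\<psi> k) * energy \<kappa> u" .
  qed
  also have "\<dots> = energy \<kappa> u" by (simp add: nn_integral_multc total)
  finally show ?thesis .
qed

text \<open>Both kernels have mass one, so the constant \<open>u x\<close> may be subtracted under
  the integral: the difference of the averages is the integral of \<open>u z - u x\<close> against
  \<open>\<psi> (z - x) - \<psi> (z - y)\<close>. If this kernel lives on an annulus around
  \<open>x\<close>, only differences of \<open>u\<close> over distances between \<open>r\<close> and
  \<open>r'\<close> are seen.\<close>

lemma avg_lipschitz_sq:
  assumes [measurable]: "u \<in> borel_measurable borel" and u: "l2sq u < \<infinity>"
    and L: "0 \<le> L" "\<And>z. \<bar>\<psi> (z - x) - \<psi> (z - y)\<bar> \<le> (if r \<le> dist x z \<and> dist x z \<le> r' then L else 0)"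
  shows "ennreal ((cmod (avg \<psi> u x - avg \<psi> u y))\<^sup>2)
    \<le> ennreal (L\<^sup>2) * emeasure lborel (cball x r') * (\<integral>\<^sup>+z. ennreal (if r \<le> dist x z \<and> dist x z \<le> r' then (cmod (u x - u z))\<^sup>2 else 0) \<partial>lborel)"
proof -
  have i: "integrable lborel (\<lambda>z. of_real (\<psi> (z - x)) * u z)" for x by (rule avg_integrable[OF _ u]) auto
  have ic: "integrable lborel (\<lambda>z. of_real (\<psi> (z - x)) * u y)" for x y
    using integral_shift(2)[of x] by (intro integrable_mult_left integrable_of_real)
  have z: "(\<integral>z. of_real (\<psi> (z - x')) * u x \<partial>lborel) = u x" for x'
    using integral_shift(1)[of x'] by simp
  have "(\<integral>z. of_real (\<psi> (z - x) - \<psi> (z - y)) * (u z - u x) \<partial>lborel)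
    = (\<integral>z. (of_real (\<psi> (z - x)) * u z - of_real (\<psi> (z - y)) * u z) - (of_real (\<psi> (z - x)) * u x - of_real (\<psi> (z - y)) * u x) \<partial>lborel)"
    by (simp add: algebra_simps)
  also have "\<dots> = avg \<psi> u x - avg \<psi> u y"
    unfolding avg_def by (simp add: Bochner_Integration.integral_diff i ic z del: of_real_diff integral_mult_left_zero)
  finally have eq: "avg \<psi> u x - avg \<psi> u y = (\<integral>z. of_real (\<psi> (z - x) - \<psi> (z - y)) * (u z - u x) \<partial>lborel)" by simp
  let ?q = "\<lambda>z. if r \<le> dist x z \<and> dist x z \<le> r' then L else 0"
  have "ennreal ((cmod (avg \<psi> u x - avg \<psi> u y))\<^sup>2) \<le> (\<integral>\<^sup>+z. ennreal (?q z) \<partial>lborel) * (\<integral>\<^sup>+z. ennreal (?q z * (cmod (u z - u x))\<^sup>2) \<partial>lborel)"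
    unfolding eq by (rule norm_lebesgue_integral_sq_le) (use L in measurable)
  also have "\<dots> \<le> (\<integral>\<^sup>+z. ennreal L * indicator (cball x r') z \<partial>lborel) * (\<integral>\<^sup>+z. ennreal L * ennreal (if r \<le> dist x z \<and> dist x z \<le> r' then (cmod (u x - u z))\<^sup>2 else 0) \<partial>lborel)"
    using L(1) by (intro mult_mono nn_integral_mono) (auto simp: indicator_def norm_minus_commute ennreal_mult')
  also have "\<dots> = ennreal L * ennreal L * emeasure lborel (cball x r') * (\<integral>\<^sup>+z. ennreal (if r \<le> dist x z \<and> dist x z \<le> r' then (cmod (u x - u z))\<^sup>2 else 0) \<partial>lborel)"
    by (simp add: nn_integral_cmult nn_integral_cmult_indicator mult_ac)
  finally show ?thesis using L(1) by (simp add: ennreal_mult' power2_eq_square)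
qed

end

section \<open>Construction of averaging kernels\<close>

lemma normalized_kernel:
  fixes h :: "'a::euclidean_space \<Rightarrow> real"
  assumes [measurable]: "h \<in> borel_measurable borel" and h: "\<And>z. 0 \<le> h z" "\<And>z. h z \<le> b"
    and supp: "\<And>z. R < norm z \<Longrightarrow> h z = 0" and m: "0 < m" "ennreal m \<le> (\<integral>\<^sup>+z. ennreal (h z) \<partial>lborel)"
  obtains c where "m \<le> c" "avg_kernel (\<lambda>z. h z / c) (b / m) R"
proof -
  let ?I = "\<integral>\<^sup>+z. ennreal (h z) \<partial>lborel"
  have "?I \<le> (\<integral>\<^sup>+z. ennreal b * indicator (cball (0::'a) R) z \<partial>lborel)"
  proof (intro nn_integral_mono)
    fix z
    show "ennreal (h z) \<le> ennreal b * indicator (cball 0 R) z"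
      using h(2)[of z] supp[of z] by (cases "norm z > R") (simp_all add: ennreal_leI)
  qed
  also have "\<dots> < \<infinity>"
    using emeasure_bounded_finite[OF bounded_cball[of "0::'a" R]]
    by (subst nn_integral_cmult_indicator) (auto simp: ennreal_mult_less_top)
  \<comment> \<open>The exact mass \<open>c\<close> is finite by boundedness and bounded support,
    and it is never evaluated: explicit constants come from its lower bound
    \<open>m\<close>.\<close>
  finally obtain c where c: "?I = ennreal c" "0 \<le> c" by (cases ?I) auto
  then have mc: "m \<le> c" "0 < c" using m by auto
  have "avg_kernel (\<lambda>z. h z / c) (b / m) R"
  proof
    show "h z / c \<le> b / m" for z using h[of z] m(1) mc by (intro frac_le) auto
    have "(\<integral>\<^sup>+z. ennreal (h z / c) \<partial>lborel) = (\<integral>\<^sup>+z. ennreal (1 / c) * ennreal (h z) \<partial>lborel)"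
      using mc h by (intro nn_integral_cong) (simp add: ennreal_mult[symmetric])
    also have "\<dots> = 1" using mc by (simp add: nn_integral_cmult c ennreal_mult[symmetric])
    finally show "(\<integral>\<^sup>+z. ennreal (h z / c) \<partial>lborel) = 1" .
  qed (use h mc supp in auto)
  then show thesis using that mc by blast
qed

text \<open>A tent function of \<open>norm z\<close> with slope one, peaking at
  \<open>5 * r / 2\<close> and vanishing outside \<open>2 * r \<le> norm z \<le> 3 * r\<close>, is
  divided by its mass. The mass is at least a multiple of \<open>r ^ (n + 1)\<close> with
  \<open>n\<close> the dimension, which produces the height of order \<open>r powr (-n)\<close> and
  the slope of order \<open>r powr (-n - 1)\<close>.\<close>

lemma ex_annulus_kernel:
  "\<exists>C>0. \<forall>r>0. \<exists>\<psi>::'a::euclidean_space \<Rightarrow> real. avg_kernel \<psi> (C * r powr (- real DIM('a))) (3 * r)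
     \<and> (\<forall>z. norm z < 2 * r \<longrightarrow> \<psi> z = 0)
     \<and> (\<forall>z w. \<bar>\<psi> z - \<psi> w\<bar> \<le> C * r powr (- real DIM('a) - 1) * norm (z - w))"
proof -
  let ?n = "DIM('a)"
  let ?w = "unit_ball_vol ?n"
  have w: "?w > 0" by simp
  define C where "C = 4 ^ (?n + 1) / ?w"
  have C: "C > 0" using w by (simp add: C_def)
  have "\<exists>\<psi>::'a \<Rightarrow> real. avg_kernel \<psi> (C * r powr (- real ?n)) (3 * r)
     \<and> (\<forall>z. norm z < 2 * r \<longrightarrow> \<psi> z = 0)
     \<and> (\<forall>z w. \<bar>\<psi> z - \<psi> w\<bar> \<le> C * r powr (- real ?n - 1) * norm (z - w))" if r: "r > 0" for r :: real
  proof -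
    define h :: "'a \<Rightarrow> real" where "h z = max 0 (r / 2 - \<bar>norm z - 5 * r / 2\<bar>)" for z
    have hm[measurable]: "h \<in> borel_measurable borel" unfolding h_def by measurable
    have h0: "0 \<le> h z" "h z \<le> r / 2" for z using r unfolding h_def by linarith+
    have hs: "h z = 0" if "norm z < 2 * r \<or> norm z > 3 * r" for z
      using that r by (auto simp: h_def)
    have hl: "\<bar>h z - h w\<bar> \<le> norm (z - w)" for z w
      using norm_triangle_ineq3[of z w] unfolding h_def by linarith
    let ?I = "\<integral>\<^sup>+z. ennreal (h z) \<partial>lborel"
    define m where "m = ?w / 4 ^ (?n + 1) * r ^ (?n + 1)"
    have m: "m > 0" using w r by (simp add: m_def)
    obtain b :: 'a where b: "b \<in> Basis" using nonempty_Basis by blast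
    \<comment> \<open>Around a point of norm \<open>5 * r / 2\<close> the tent is at least
      \<open>r / 4\<close> on a ball of radius \<open>r / 4\<close>; this value times the volume of
      the ball is \<open>m\<close>.\<close>
    let ?p = "(5 * r / 2) *\<^sub>R b"
    have np: "norm ?p = 5 * r / 2" using b r by simp
    have "ennreal (r / 4) * emeasure lborel (ball ?p (r / 4)) = (\<integral>\<^sup>+z. ennreal (r / 4) * indicator (ball ?p (r / 4)) z \<partial>lborel)"
      by (subst nn_integral_cmult_indicator) auto
    also have "\<dots> \<le> ?I"
    proof (intro nn_integral_mono)
      fix z
      have "r / 4 \<le> h z" if "dist ?p z < r / 4"
      proof -
        have "\<bar>norm z - 5 * r / 2\<bar> \<le> r / 4"
          using norm_triangle_ineq3[of z ?p] that unfolding np dist_norm norm_minus_commute[of ?p z] by linarith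
        then show ?thesis unfolding h_def by linarith
      qed
      then show "ennreal (r / 4) * indicator (ball ?p (r / 4)) z \<le> ennreal (h z)"
        by (auto simp: indicator_def intro!: ennreal_leI)
    qed
    finally have "ennreal (r / 4 * (?w * (r / 4) ^ ?n)) \<le> ?I"
      using r by (simp add: emeasure_ball ennreal_mult[symmetric])
    moreover have "r / 4 * (?w * (r / 4) ^ ?n) = m" by (simp add: m_def power_divide)
    ultimately have mI: "ennreal m \<le> ?I" by simp
    have Cm: "1 / m = C * r powr (- real ?n - 1)"
      using r w unfolding m_def C_def by (simp add: powr_diff powr_minus powr_realpow field_simps)
    have Cm': "r / m = C * r powr (- real ?n)"
      using r w unfolding m_def C_def by (simp add: powr_minus powr_realpow field_simps)
    \<comment> \<open>The crude bound \<open>r\<close> in place of \<open>r / 2\<close> lets height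
      and slope share the constant \<open>C\<close>.\<close>
    have "h z \<le> r" for z using h0(2)[of z] r by linarith
    then obtain c where mc: "m \<le> c" and k: "avg_kernel (\<lambda>z. h z / c) (r / m) (3 * r)"
      using normalized_kernel[OF hm h0(1) _ _ m mI, of r "3 * r"] hs by blast
    have cp: "c > 0" using m mc by linarith
    define \<psi> where "\<psi> z = h z / c" for z
    have "avg_kernel \<psi> (C * r powr (- real ?n)) (3 * r)" using k unfolding Cm' \<psi>_def[abs_def] .
    moreover have "\<forall>z. norm z < 2 * r \<longrightarrow> \<psi> z = 0" by (simp add: \<psi>_def hs)
    moreover have "\<bar>\<psi> z - \<psi> w\<bar> \<le> C * r powr (- real ?n - 1) * norm (z - w)" for z w
    proof -
      have "\<bar>\<psi> z - \<psi> w\<bar> = \<bar>h z - h w\<bar> / c"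
        using cp by (simp add: \<psi>_def diff_divide_distrib[symmetric] abs_divide)
      also have "\<dots> \<le> norm (z - w) / m" using hl m mc by (intro frac_le) auto
      also have "\<dots> = C * r powr (- real ?n - 1) * norm (z - w)" by (simp flip: Cm)
      finally show ?thesis .
    qed
    ultimately show ?thesis by blast
  qed
  then show ?thesis using C by blast
qed

text \<open>The kernel is supported in the annulus \<open>2r \<le> |z| \<le> 3r\<close>, so that all three quantities only see
  differences of \<open>u\<close> over distances at least \<open>r\<close>. This is what makes hole filling possible. The
  hypothesis \<open>\<alpha> < 1\<close> enters through the Lipschitz bound of the average at distances below \<open>r\<close>.\<close>

lemma hole_filling_estimates:
  fixes \<alpha> N :: real
  assumes n: "DIM('a::euclidean_space) \<ge> 2" and \<alpha>: "0 < \<alpha>" "\<alpha> < 1" and N: "N = DIM('a) + 2 * \<alpha>"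
  shows "\<exists>C>0. \<forall>r>0. \<exists>(\<psi>::'a \<Rightarrow> real) B R. avg_kernel \<psi> B R \<and>
    (\<forall>u T. u \<in> borel_measurable borel \<longrightarrow> l2sq u < \<infinity> \<longrightarrow>
       T = energy (damped \<alpha> N r) u \<longrightarrow>
       l2sq (\<lambda>x. u x - avg \<psi> u x) \<le> ennreal (C * r powr (2 * \<alpha>)) * T \<and>
       energy (near N r) (avg \<psi> u) \<le> ennreal C * T \<and>
       energy (amplified \<alpha> N r) (\<lambda>x. u x - avg \<psi> u x) \<le> ennreal C * T)"
proof -
  let ?n = "real DIM('a)" let ?w = "unit_ball_vol ?n"
  have n2: "?n \<ge> 2" using n by simp
  obtain C0 where C0: "C0 > 0" and ker: "\<And>r. r > 0 \<Longrightarrow> \<exists>\<psi>::'a \<Rightarrow> real. avg_kernel \<psi> (C0 * r powr (- ?n)) (3 * r)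
     \<and> (\<forall>z. norm z < 2 * r \<longrightarrow> \<psi> z = 0)
     \<and> (\<forall>z w. \<bar>\<psi> z - \<psi> w\<bar> \<le> C0 * r powr (- ?n - 1) * norm (z - w))"
    using ex_annulus_kernel[where 'a='a] by metis
  \<comment> \<open>On \<open>r \<le> t \<le> 4 * r\<close> the damped weight is at least
    \<open>4 powr (-\<alpha>) * (4 * r) powr (-N)\<close>, so \<open>A * r powr N\<close> times it
    is at least one. Differences of \<open>u\<close> over these distances are thereby paid for by
    the damped energy.\<close>
  define A where "A = 4 powr (\<alpha> + N)"
  have A: "A > 0" by (simp add: A_def)
  \<comment> \<open>What remains of \<open>t powr (-N)\<close> after the factor
    \<open>t\<^sup>2\<close> of a Lipschitz bound is \<open>t powr (-s)\<close>. Dimension at least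
    two gives \<open>s > 0\<close>; \<open>s\<close> below the dimension means integrability at the
    origin.\<close>
  define s where "s = N - 2"
  have s: "0 < s" "s < ?n" using \<alpha> n2 by (auto simp: s_def N)
  define C1 where "C1 = C0 * A"
  define C2 where "C2 = C0\<^sup>2 * ?w * 4 ^ DIM('a) * A * (s * ?w / (?n - s) + ?w)"
  \<comment> \<open>For \<open>t \<ge> r\<close> the amplified weight equals
    \<open>r powr (-\<alpha>) * t powr (-s')\<close>, and \<open>s'\<close> above the dimension
    means integrability at infinity.\<close>
  define s' where "s' = N - \<alpha>"
  have s': "s' > ?n" using \<alpha> by (auto simp: s'_def N)
  define C3 where "C3 = 4 * (s' * ?w / (s' - ?n)) * C1"
  have C1: "C1 > 0" using C0 A by (simp add: C1_def)
  have C2: "C2 \<ge> 0" using C0 A s by (simp add: C2_def)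
  have C3: "C3 \<ge> 0" using C1 s' by (simp add: C3_def)
  define C where "C = C1 + C2 + C3"
  have C: "C > 0" "C1 \<le> C" "C2 \<le> C" "C3 \<le> C" using C1 C2 C3 by (auto simp: C_def)
  have "\<exists>(\<psi>::'a \<Rightarrow> real) B R. avg_kernel \<psi> B R \<and>
    (\<forall>u T. u \<in> borel_measurable borel \<longrightarrow> l2sq u < \<infinity> \<longrightarrow>
       T = energy (damped \<alpha> N r) u \<longrightarrow>
       l2sq (\<lambda>x. u x - avg \<psi> u x) \<le> ennreal (C * r powr (2 * \<alpha>)) * T \<and>
       energy (near N r) (avg \<psi> u) \<le> ennreal C * T \<and>
       energy (amplified \<alpha> N r) (\<lambda>x. u x - avg \<psi> u x) \<le> ennreal C * T)"
    if r: "r > 0" for r :: real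
  proof -
    obtain \<psi> :: "'a \<Rightarrow> real" where k: "avg_kernel \<psi> (C0 * r powr (- ?n)) (3 * r)"
      and k0: "\<And>z. norm z < 2 * r \<Longrightarrow> \<psi> z = 0"
      and kl: "\<And>z w. \<bar>\<psi> z - \<psi> w\<bar> \<le> C0 * r powr (- ?n - 1) * norm (z - w)"
      using ker[OF r] by blast
    interpret avg_kernel \<psi> "C0 * r powr (- ?n)" "3 * r" by (rule k)
    define \<kappa> where "\<kappa> t = (if r \<le> t then (t / r) powr (-\<alpha>) * t powr (-N) else 0)" for t
    have \<kappa>m[measurable]: "\<kappa> \<in> borel_measurable borel" unfolding \<kappa>_def by measurable
    have \<kappa>0: "0 \<le> \<kappa> t" for t by (simp add: \<kappa>_def)
    have \<kappa>l: "1 \<le> A * r powr N * \<kappa> t" if "r \<le> t" "t \<le> 4 * r" for t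
    proof -
      have t: "t > 0" using that r by linarith
      have "4 powr (-\<alpha>) \<le> (t / r) powr (-\<alpha>)"
        using that r t \<alpha> by (intro powr_mono2') (auto simp: field_simps)
      moreover have "(4 * r) powr (-N) \<le> t powr (-N)"
        using that r t \<alpha> n2 by (intro powr_mono2') (auto simp: N)
      ultimately have "4 powr (-\<alpha>) * (4 * r) powr (-N) \<le> \<kappa> t"
        using that mult_mono[of "4 powr (-\<alpha>)" "(t / r) powr (-\<alpha>)" "(4 * r) powr (-N)" "t powr (-N)"] by (simp add: \<kappa>_def)
      then have "A * r powr N * (4 powr (-\<alpha>) * (4 * r) powr (-N)) \<le> A * r powr N * \<kappa> t"
        using A by (intro mult_left_mono) auto
      moreover have "A * r powr N * (4 powr (-\<alpha>) * (4 * r) powr (-N)) = 1"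
      proof -
        have "A * r powr N * (4 powr (-\<alpha>) * (4 * r) powr (-N)) = (4 powr (\<alpha> + N) * (4 powr (-\<alpha>) * 4 powr (-N))) * (r powr N * r powr (-N))"
          using r powr_mult[of 4 r "-N"] by (simp add: A_def)
        then show ?thesis using r by (simp only: powr_add[symmetric]) simp
      qed
      ultimately show ?thesis by simp
    qed
    have main: "l2sq (\<lambda>x. u x - avg \<psi> u x) \<le> ennreal (C * r powr (2 * \<alpha>)) * T"
       "energy (near N r) (avg \<psi> u) \<le> ennreal C * T"
       "energy (amplified \<alpha> N r) (\<lambda>x. u x - avg \<psi> u x) \<le> ennreal C * T"
      if um[measurable]: "u \<in> borel_measurable borel" and u: "l2sq u < \<infinity>" and T: "T = energy \<kappa> u" for u T
    proof -
      have "l2sq (\<lambda>x. u x - avg \<psi> u x) \<le> (\<integral>\<^sup>+x. \<integral>\<^sup>+z. ennreal (\<psi> (z - x) * (cmod (u x - u z))\<^sup>2) \<partial>lborel \<partial>lborel)"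
        by (rule l2sq_minus_avg) (use u in auto)
      also have "\<dots> \<le> energy (\<lambda>t. (C1 * r powr (2 * \<alpha>)) * \<kappa> t) u"
        unfolding energy_def
      proof (intro nn_integral_mono ennreal_leI mult_right_mono)
        fix x z :: 'a
        show "\<psi> (z - x) \<le> C1 * r powr (2 * \<alpha>) * \<kappa> (dist x z)"
        proof (cases "r \<le> dist x z \<and> dist x z \<le> 4 * r")
          case True
          have "\<psi> (z - x) \<le> C0 * r powr (- ?n) * 1" using bound[of "z - x"] by simp
          also have "\<dots> \<le> C0 * r powr (- ?n) * (A * r powr N * \<kappa> (dist x z))"
            using True C0 by (intro mult_left_mono \<kappa>l) auto
          also have "\<dots> = C1 * (r powr (- ?n) * r powr N) * \<kappa> (dist x z)" by (simp add: C1_def mult_ac)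
          also have "r powr (- ?n) * r powr N = r powr (2 * \<alpha>)" by (simp add: powr_add[symmetric] N)
          finally show ?thesis .
        next
          case False
          then have "norm (z - x) < 2 * r \<or> norm (z - x) > 3 * r" using r by (auto simp: dist_norm norm_minus_commute)
          then have "\<psi> (z - x) = 0" using k0 supp by blast
          then show ?thesis using C1 \<kappa>0 by simp
        qed
      qed auto
      also have "\<dots> = ennreal (C1 * r powr (2 * \<alpha>)) * T"
        using C1 unfolding T by (intro energy_cmult) auto
      finally have 1: "l2sq (\<lambda>x. u x - avg \<psi> u x) \<le> ennreal (C1 * r powr (2 * \<alpha>)) * T" .
      also have "\<dots> \<le> ennreal (C * r powr (2 * \<alpha>)) * T"
        using C by (intro mult_right_mono ennreal_leI) auto
      finally show "l2sq (\<lambda>x. u x - avg \<psi> u x) \<le> ennreal (C * r powr (2 * \<alpha>)) * T" .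
      define G where "G x = (\<integral>\<^sup>+z. ennreal (\<kappa> (dist x z) * (cmod (u x - u z))\<^sup>2) \<partial>lborel)" for x
      have Gm[measurable]: "G \<in> borel_measurable borel" unfolding G_def by measurable
      define D where "D = C0\<^sup>2 * ?w * 4 ^ DIM('a) * A"
      have D: "D \<ge> 0" using C0 A by (simp add: D_def)
      \<comment> \<open>The kernels centred at \<open>x\<close> and \<open>y\<close> live at
        distances between \<open>2 * r\<close> and \<open>3 * r\<close> from their centres. As the
        centres are less than \<open>r\<close> apart, both live on
        \<open>r \<le> dist x z \<le> 4 * r\<close>, the range on which \<open>A\<close> was
        chosen.\<close>
      have pt: "ennreal ((cmod (avg \<psi> u x - avg \<psi> u y))\<^sup>2) \<le> ennreal (D * r powr (2 * \<alpha> - 2) * (dist x y)\<^sup>2) * G x"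
        if xy: "dist x y < r" for x y
      proof -
        let ?L = "C0 * r powr (- ?n - 1) * dist x y"
        have "ennreal ((cmod (avg \<psi> u x - avg \<psi> u y))\<^sup>2)
          \<le> ennreal (?L\<^sup>2) * emeasure lborel (cball x (4 * r)) * (\<integral>\<^sup>+z. ennreal (if r \<le> dist x z \<and> dist x z \<le> 4 * r then (cmod (u x - u z))\<^sup>2 else 0) \<partial>lborel)"
        proof (rule avg_lipschitz_sq[OF um u])
          show "0 \<le> ?L" using C0 by simp
          fix z
          show "\<bar>\<psi> (z - x) - \<psi> (z - y)\<bar> \<le> (if r \<le> dist x z \<and> dist x z \<le> 4 * r then ?L else 0)"
          proof (cases "r \<le> dist x z \<and> dist x z \<le> 4 * r")
            case True
            then show ?thesis using kl[of "z - x" "z - y"] by (simp add: dist_norm norm_minus_commute)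
          next
            case False
            have t1: "dist z y \<le> dist x z + dist x y" "dist x z \<le> dist z y + dist x y"
              by (metis dist_triangle dist_commute add.commute)+
            have "(norm (z - x) < 2 * r \<and> norm (z - y) < 2 * r) \<or> (norm (z - x) > 3 * r \<and> norm (z - y) > 3 * r)"
              using False xy r t1 unfolding dist_norm[symmetric] dist_commute[of z x] by linarith
            then have "\<psi> (z - x) = 0 \<and> \<psi> (z - y) = 0" using k0 supp by blast
            then show ?thesis using False by auto
          qed
        qed
        also have "\<dots> \<le> ennreal (?L\<^sup>2) * ennreal (?w * (4 * r) ^ DIM('a)) * (\<integral>\<^sup>+z. ennreal (A * r powr N) * ennreal (\<kappa> (dist x z) * (cmod (u x - u z))\<^sup>2) \<partial>lborel)"
        proof (intro mult_mono nn_integral_mono)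
          show "emeasure lborel (cball x (4 * r)) \<le> ennreal (?w * (4 * r) ^ DIM('a))"
            using r by (simp add: emeasure_cball)
          fix z
          have "(cmod (u x - u z))\<^sup>2 \<le> A * r powr N * \<kappa> (dist x z) * (cmod (u x - u z))\<^sup>2"
            if "r \<le> dist x z \<and> dist x z \<le> 4 * r"
            using mult_right_mono[OF \<kappa>l[of "dist x z"], of "(cmod (u x - u z))\<^sup>2"] that by simp
          then have "(if r \<le> dist x z \<and> dist x z \<le> 4 * r then (cmod (u x - u z))\<^sup>2 else 0) \<le> A * r powr N * (\<kappa> (dist x z) * (cmod (u x - u z))\<^sup>2)"
            using A \<kappa>0 by (auto simp: mult.assoc)
          then show "ennreal (if r \<le> dist x z \<and> dist x z \<le> 4 * r then (cmod (u x - u z))\<^sup>2 else 0) \<le> ennreal (A * r powr N) * ennreal (\<kappa> (dist x z) * (cmod (u x - u z))\<^sup>2)"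
            using A \<kappa>0 by (simp add: ennreal_mult[symmetric] ennreal_leI)
        qed auto
        also have "\<dots> = ennreal (?L\<^sup>2) * ennreal (?w * (4 * r) ^ DIM('a)) * (ennreal (A * r powr N) * G x)"
          unfolding G_def by (simp add: nn_integral_cmult)
        also have "\<dots> = ennreal (?L\<^sup>2 * (?w * (4 * r) ^ DIM('a)) * (A * r powr N)) * G x"
          using r A by (simp add: ennreal_mult mult.assoc)
        also have "?L\<^sup>2 * (?w * (4 * r) ^ DIM('a)) * (A * r powr N)
           = D * ((r powr (- ?n - 1))\<^sup>2 * r ^ DIM('a) * r powr N) * (dist x y)\<^sup>2"
          by (simp add: D_def power_mult_distrib mult_ac)
        also have "(r powr (- ?n - 1))\<^sup>2 * r ^ DIM('a) * r powr N = r powr (2 * \<alpha> - 2)"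
        proof -
          have "(r powr (- ?n - 1))\<^sup>2 * r ^ DIM('a) * r powr N = r powr (- ?n - 1) * r powr (- ?n - 1) * r powr ?n * r powr N"
            by (simp only: power2_eq_square powr_realpow[OF r])
          also have "\<dots> = r powr (- ?n - 1 + (- ?n - 1) + ?n + N)" by (simp only: powr_add)
          also have "- ?n - 1 + (- ?n - 1) + ?n + N = 2 * \<alpha> - 2" by (simp add: N)
          finally show ?thesis .
        qed
        finally show ?thesis .
      qed
      \<comment> \<open>With the pointwise bound the double integral factors into \<open>T\<close>
        and the radial integral of \<open>t powr (-s)\<close> over \<open>t < r\<close>. The powers
        of \<open>r\<close> then cancel.\<close>
      have "energy (near N r) (avg \<psi> u)
        \<le> (\<integral>\<^sup>+x. \<integral>\<^sup>+y. (ennreal (D * r powr (2 * \<alpha> - 2)) * G x) * ennreal (if dist x y < r then dist x y powr (-s) else 0) \<partial>lborel \<partial>lborel)"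
        unfolding energy_def
      proof (intro nn_integral_mono)
        fix x y :: 'a
        show "ennreal (near N r (dist x y) * (cmod (avg \<psi> u x - avg \<psi> u y))\<^sup>2)
          \<le> (ennreal (D * r powr (2 * \<alpha> - 2)) * G x) * ennreal (if dist x y < r then dist x y powr (-s) else 0)"
        proof (cases "dist x y < r \<and> x \<noteq> y")
          case True
          have "ennreal (dist x y powr (-N) * (cmod (avg \<psi> u x - avg \<psi> u y))\<^sup>2)
            \<le> ennreal (dist x y powr (-N)) * (ennreal (D * r powr (2 * \<alpha> - 2) * (dist x y)\<^sup>2) * G x)"
            using True by (subst ennreal_mult) (auto intro!: mult_left_mono pt)
          also have "\<dots> = ennreal (D * r powr (2 * \<alpha> - 2)) * G x * ennreal (dist x y powr (-N) * (dist x y)\<^sup>2)"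
            using D by (simp add: ennreal_mult mult_ac)
          also have "dist x y powr (-N) * (dist x y)\<^sup>2 = dist x y powr (-s)"
          proof -
            have "(dist x y)\<^sup>2 = dist x y powr 2" using True by simp
            then have "dist x y powr (-N) * (dist x y)\<^sup>2 = dist x y powr (-N + 2)" by (simp only: powr_add)
            then show ?thesis by (simp add: s_def)
          qed
          finally show ?thesis using True by simp
        qed auto
      qed
      also have "\<dots> = ennreal (D * r powr (2 * \<alpha> - 2)) * T * (\<integral>\<^sup>+(y::'a). ennreal (if norm y < r then norm y powr (-s) else 0) \<partial>lborel)"
      proof -
        have "(\<integral>\<^sup>+y. ennreal (if dist x y < r then dist x y powr (-s) else 0) \<partial>lborel) = (\<integral>\<^sup>+(y::'a). ennreal (if norm y < r then norm y powr (-s) else 0) \<partial>lborel)" for x :: 'a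
          by (rule nn_integral_lborel_dist[of "\<lambda>t. ennreal (if t < r then t powr (-s) else 0)"]) measurable
        moreover have "T = (\<integral>\<^sup>+x. G x \<partial>lborel)" by (simp add: T energy_def G_def)
        ultimately show ?thesis by (simp add: nn_integral_cmult nn_integral_multc)
      qed
      also have "\<dots> \<le> ennreal (D * r powr (2 * \<alpha> - 2)) * T * ennreal ((s * ?w / (?n - s) + ?w) * r powr (?n - s))"
        by (intro mult_left_mono nn_integral_radial_near s r) auto
      also have "\<dots> = ennreal (D * r powr (2 * \<alpha> - 2) * ((s * ?w / (?n - s) + ?w) * r powr (?n - s))) * T"
        using D s by (subst (3) ennreal_mult) (auto simp: mult_ac)
      also have "D * r powr (2 * \<alpha> - 2) * ((s * ?w / (?n - s) + ?w) * r powr (?n - s)) = C2 * (r powr (2 * \<alpha> - 2) * r powr (?n - s))"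
        by (simp add: C2_def D_def mult_ac)
      also have "r powr (2 * \<alpha> - 2) * r powr (?n - s) = 1"
        using r by (simp add: powr_add[symmetric] s_def N)
      also have "ennreal (C2 * 1) * T \<le> ennreal C * T"
        using C by (intro mult_right_mono ennreal_leI) auto
      finally show "energy (near N r) (avg \<psi> u) \<le> ennreal C * T" .
      \<comment> \<open>The weight is an integrable tail, so the bound \<open>1\<close> for the
        squared norm of \<open>u - avg \<psi> u\<close> suffices. One factor
        \<open>r powr (-\<alpha>)\<close> comes from the weight and one from the tail integral;
        together they cancel the \<open>r powr (2 * \<alpha>)\<close> of \<open>1\<close>.\<close>
      have "energy (amplified \<alpha> N r) (\<lambda>x. u x - avg \<psi> u x)
        \<le> energy (\<lambda>t. r powr (-\<alpha>) * (if r \<le> t then t powr (-s') else 0)) (\<lambda>x. u x - avg \<psi> u x)"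
      proof (intro energy_mono)
        fix t :: real assume "0 \<le> t"
        then have "(t / r) powr \<alpha> * t powr (-N) = r powr (-\<alpha>) * (t powr \<alpha> * t powr (-N))"
          using r by (simp add: powr_divide powr_minus divide_inverse[of _ "r powr \<alpha>"])
        then have "(t / r) powr \<alpha> * t powr (-N) = r powr (-\<alpha>) * t powr (-s')"
          by (simp only: powr_add[symmetric] s'_def) simp
        then show "(if r \<le> t then (t / r) powr \<alpha> * t powr (-N) else 0) \<le> r powr (-\<alpha>) * (if r \<le> t then t powr (-s') else 0)" by simp
      qed
      also have "\<dots> = ennreal (r powr (-\<alpha>)) * energy (\<lambda>t. if r \<le> t then t powr (-s') else 0) (\<lambda>x. u x - avg \<psi> u x)"
        by (intro energy_cmult) auto
      also have "\<dots> \<le> ennreal (r powr (-\<alpha>)) * (4 * (\<integral>\<^sup>+(h::'a). ennreal (if r \<le> norm h then norm h powr (-s') else 0) \<partial>lborel) * l2sq (\<lambda>x. u x - avg \<psi> u x))"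
        by (intro mult_left_mono energy_le_l2sq) auto
      also have "\<dots> \<le> ennreal (r powr (-\<alpha>)) * (4 * ennreal (s' * ?w / (s' - ?n) * r powr (?n - s')) * (ennreal (C1 * r powr (2 * \<alpha>)) * T))"
        using 1 by (intro mult_left_mono mult_mono nn_integral_radial_tail s' r) auto
      also have "\<dots> = ennreal (r powr (-\<alpha>) * (4 * (s' * ?w / (s' - ?n) * r powr (?n - s')) * (C1 * r powr (2 * \<alpha>)))) * T"
      proof -
        have "0 \<le> s' * ?w / (s' - ?n) * r powr (?n - s')" "0 \<le> C1 * r powr (2 * \<alpha>)" using s' C1 by auto
        moreover have "ennreal a * (4 * ennreal b * (ennreal c * T)) = ennreal (a * (4 * b * c)) * T"
          if "0 \<le> a" "0 \<le> b" "0 \<le> c" for a b c using that by (simp add: ennreal_mult mult.assoc)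
        ultimately show ?thesis by simp
      qed
      also have "r powr (-\<alpha>) * (4 * (s' * ?w / (s' - ?n) * r powr (?n - s')) * (C1 * r powr (2 * \<alpha>)))
         = C3 * (r powr (-\<alpha>) * r powr (?n - s') * r powr (2 * \<alpha>))"
        by (simp add: C3_def)
      also have "r powr (-\<alpha>) * r powr (?n - s') * r powr (2 * \<alpha>) = 1"
        using r by (simp add: powr_add[symmetric] s'_def N)
      also have "ennreal (C3 * 1) * T \<le> ennreal C * T"
        using C by (intro mult_right_mono ennreal_leI) auto
      finally show "energy (amplified \<alpha> N r) (\<lambda>x. u x - avg \<psi> u x) \<le> ennreal C * T" .
    qed
    then show ?thesis using k unfolding \<kappa>_def by blast
  qed
  then show ?thesis using C(1) by blast
qed

section \<open>Self-improvement by hole filling\<close>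

text \<open>Integrating the hypothesis against \<open>2\<epsilon> r\<^sup>-\<^sup>1\<^sup>-\<^sup>2\<^sup>\<epsilon> dr\<close> over \<open>[\<rho>, 1]\<close>, both sides involve the
  integral of \<open>max \<tau> \<rho> powr (-2\<epsilon>)\<close>, on the right with the factor \<open>4\<epsilon>C/\<alpha> \<le> 1/2\<close>; absorb it and
  let \<open>\<rho>\<close> tend to \<open>0\<close>.\<close>

lemma hole_filling_gain:
  fixes M :: "'z measure" and \<tau> :: "'z \<Rightarrow> real" and \<alpha> C \<epsilon> :: real and F :: ennreal
  assumes M: "finite_measure M" and \<tau>[measurable]: "\<tau> \<in> borel_measurable M"
    and \<tau>0: "\<And>z. 0 \<le> \<tau> z" and \<alpha>: "0 < \<alpha>" and C: "0 < C"
    and \<epsilon>: "0 < \<epsilon>" "\<epsilon> \<le> \<alpha> / 4" "\<epsilon> \<le> \<alpha> / (8 * C)"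
    and H: "\<And>r. 0 < r \<Longrightarrow> (\<integral>\<^sup>+z. ennreal (if \<tau> z < r then 1 else 0) \<partial>M)
       \<le> ennreal C * ((\<integral>\<^sup>+z. ennreal (if r \<le> \<tau> z then (\<tau> z / r) powr (-\<alpha>) else 0) \<partial>M) + ennreal (r powr (2 * \<alpha>)) * F)"
  shows "(\<integral>\<^sup>+z. ennreal (if 0 < \<tau> z \<and> \<tau> z < 1 then \<tau> z powr (-2 * \<epsilon>) else 0) \<partial>M)
     \<le> 3 * emeasure M (space M) + F"
proof -
  interpret finite_measure M by (rule M)
  interpret P: pair_sigma_finite lborel M ..
  let ?E = "emeasure M (space M)"
  have bnd: "(\<integral>\<^sup>+z. ennreal (if \<tau> z < 1 then max (\<tau> z) \<rho> powr (-2 * \<epsilon>) else 0) \<partial>M) \<le> 3 * ?E + F"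
    if \<rho>: "0 < \<rho>" "\<rho> < 1" for \<rho>
  proof (cases "F = top")
    case False
    define w where "w z = (if \<tau> z < 1 then max (\<tau> z) \<rho> powr (-2 * \<epsilon>) else 0)" for z
    have w0: "0 \<le> w z" for z by (simp add: w_def)
    have [measurable]: "w \<in> borel_measurable M" unfolding w_def by measurable
    define k where "k r = (if \<rho> \<le> r \<and> r \<le> 1 then 2 * \<epsilon> * r powr (-1 - 2 * \<epsilon>) else 0)" for r
    have k0: "0 \<le> k r" for r using \<epsilon> by (simp add: k_def)
    have [measurable]: "k \<in> borel_measurable borel" unfolding k_def by measurable
    define W where "W = (\<integral>\<^sup>+z. ennreal (w z) \<partial>M)"
    \<comment> \<open>Finiteness of \<open>W\<close>, due to the truncation at \<open>\<rho>\<close>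
      and the finite measure, is what makes the later absorption legitimate.\<close>
    have "W \<le> (\<integral>\<^sup>+z. ennreal (\<rho> powr (-2 * \<epsilon>)) \<partial>M)"
      unfolding W_def w_def using \<rho> \<epsilon> by (intro nn_integral_mono ennreal_leI) (auto intro!: powr_mono2')
    also have "\<dots> < \<infinity>" by (simp add: less_top[symmetric] ennreal_mult_eq_top_iff emeasure_finite)
    finally have Wfin: "W < \<infinity>" .
    have lower: "ennreal (w z) \<le> 1 + (\<integral>\<^sup>+r. ennreal (k r) * ennreal (if \<tau> z < r then 1 else 0) \<partial>lborel)" for z
    proof (cases "\<tau> z < 1")
      case True
      define m where "m = max (\<tau> z) \<rho>"
      have m: "0 < m" "m \<le> 1" using \<rho> True by (auto simp: m_def)
      \<comment> \<open>The strict condition \<open>\<tau> z < r\<close> and the closed interval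
        from \<open>m\<close> to 1 can disagree only at the point \<open>r = \<tau> z\<close>, hence
        the equality almost everywhere.\<close>
      have "(\<integral>\<^sup>+r. ennreal (k r) * ennreal (if \<tau> z < r then 1 else 0) \<partial>lborel)
         = (\<integral>\<^sup>+r. ennreal (2 * \<epsilon>) * ennreal (if m \<le> r \<and> r \<le> 1 then r powr (-1 - 2 * \<epsilon>) else 0) \<partial>lborel)"
      proof (rule nn_integral_cong_AE)
        show "AE r in lborel. ennreal (k r) * ennreal (if \<tau> z < r then 1 else 0)
          = ennreal (2 * \<epsilon>) * ennreal (if m \<le> r \<and> r \<le> 1 then r powr (-1 - 2 * \<epsilon>) else 0)"
          using AE_lborel_singleton[of "\<tau> z"]
          by eventually_elim (use \<epsilon> in \<open>auto simp: k_def m_def ennreal_mult\<close>)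
      qed
      also have "\<dots> = ennreal (2 * \<epsilon>) * ennreal ((1 - m powr (-2 * \<epsilon>)) / (-2 * \<epsilon>))"
        using m \<epsilon> nn_integral_powr_between[of m 1 "-1 - 2 * \<epsilon>"] by (subst nn_integral_cmult) simp_all
      also have "\<dots> = ennreal (m powr (-2 * \<epsilon>) - 1)"
      proof -
        have "(1 - m powr (-2 * \<epsilon>)) / (-2 * \<epsilon>) = (m powr (-2 * \<epsilon>) - 1) / (2 * \<epsilon>)"
          by (metis minus_diff_eq minus_divide_divide mult_minus_left)
        then show ?thesis using \<epsilon> by (subst ennreal_mult'[symmetric]) simp_all
      qed
      finally have eq: "(\<integral>\<^sup>+r. ennreal (k r) * ennreal (if \<tau> z < r then 1 else 0) \<partial>lborel) = ennreal (m powr (-2 * \<epsilon>) - 1)" .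
      have "1 \<le> m powr (-2 * \<epsilon>)"
        using powr_mono2'[of "-2 * \<epsilon>" m 1] m \<epsilon> by simp
      then have "1 + ennreal (m powr (-2 * \<epsilon>) - 1) = ennreal (m powr (-2 * \<epsilon>))"
        by (simp add: ennreal_plus[symmetric] ennreal_1[symmetric] del: ennreal_plus ennreal_1)
      then show ?thesis using True by (simp add: eq w_def m_def)
    qed (simp add: w_def)
    \<comment> \<open>The integrand is a multiple of
      \<open>r powr (\<alpha> - 1 - 2 * \<epsilon>)\<close>, and
      \<open>\<alpha> - 2 * \<epsilon> \<ge> \<alpha> / 2\<close> keeps the denominator away from
      zero. With \<open>m = min (\<tau> z) 1\<close> the result is at most
      \<open>4 * \<epsilon> / \<alpha>\<close> times \<open>\<tau> z powr (-\<alpha>) * m powr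
      (\<alpha> - 2 * \<epsilon>)\<close>, which is \<open>w z\<close> if
      \<open>\<tau> z < 1\<close> and at most 1 otherwise.\<close>
    have upper: "(\<integral>\<^sup>+r. ennreal (k r) * ennreal (if r \<le> \<tau> z then (\<tau> z / r) powr (-\<alpha>) else 0) \<partial>lborel)
      \<le> ennreal (4 * \<epsilon> / \<alpha>) * ennreal (w z + 1)" for z
    proof (cases "\<rho> \<le> \<tau> z")
      case True
      define m where "m = min (\<tau> z) 1"
      have m: "\<rho> \<le> m" "0 < m" "m \<le> 1" "m \<le> \<tau> z" using True \<rho> by (auto simp: m_def)
      have "(\<integral>\<^sup>+r. ennreal (k r) * ennreal (if r \<le> \<tau> z then (\<tau> z / r) powr (-\<alpha>) else 0) \<partial>lborel)
        = (\<integral>\<^sup>+r. ennreal (2 * \<epsilon> * \<tau> z powr (-\<alpha>)) * ennreal (if \<rho> \<le> r \<and> r \<le> m then r powr (\<alpha> - 1 - 2 * \<epsilon>) else 0) \<partial>lborel)"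
      proof (intro nn_integral_cong)
        fix r
        have "2 * \<epsilon> * r powr (-1 - 2 * \<epsilon>) * (\<tau> z / r) powr (-\<alpha>) = 2 * \<epsilon> * \<tau> z powr (-\<alpha>) * r powr (\<alpha> - 1 - 2 * \<epsilon>)" if "\<rho> \<le> r"
        proof -
          have r: "r > 0" using that \<rho> by linarith
          have "r powr (\<alpha> - 1 - 2 * \<epsilon>) = r powr (-1 - 2 * \<epsilon>) * r powr \<alpha>"
            by (simp add: powr_add[symmetric] algebra_simps)
          moreover have "(\<tau> z / r) powr (-\<alpha>) = \<tau> z powr (-\<alpha>) * r powr \<alpha>"
            using r \<tau>0[of z] by (simp add: powr_divide powr_minus field_simps)
          ultimately show ?thesis by simp
        qed
        then show "ennreal (k r) * ennreal (if r \<le> \<tau> z then (\<tau> z / r) powr (-\<alpha>) else 0)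
          = ennreal (2 * \<epsilon> * \<tau> z powr (-\<alpha>)) * ennreal (if \<rho> \<le> r \<and> r \<le> m then r powr (\<alpha> - 1 - 2 * \<epsilon>) else 0)"
          using \<epsilon> by (auto simp: k_def m_def ennreal_mult[symmetric])
      qed
      also have "\<dots> = ennreal (2 * \<epsilon> * \<tau> z powr (-\<alpha>)) * ennreal ((m powr (\<alpha> - 2 * \<epsilon>) - \<rho> powr (\<alpha> - 2 * \<epsilon>)) / (\<alpha> - 2 * \<epsilon>))"
        using m \<rho> \<epsilon> \<alpha> nn_integral_powr_between[of \<rho> m "\<alpha> - 1 - 2 * \<epsilon>"] by (subst nn_integral_cmult) simp_all
      also have "\<dots> \<le> ennreal (2 * \<epsilon> * \<tau> z powr (-\<alpha>)) * ennreal (m powr (\<alpha> - 2 * \<epsilon>) * (2 / \<alpha>))"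
      proof (intro mult_left_mono ennreal_leI)
        have "(m powr (\<alpha> - 2 * \<epsilon>) - \<rho> powr (\<alpha> - 2 * \<epsilon>)) / (\<alpha> - 2 * \<epsilon>) \<le> m powr (\<alpha> - 2 * \<epsilon>) / (\<alpha> / 2)"
          using \<epsilon> \<alpha> by (intro frac_le) auto
        then show "(m powr (\<alpha> - 2 * \<epsilon>) - \<rho> powr (\<alpha> - 2 * \<epsilon>)) / (\<alpha> - 2 * \<epsilon>) \<le> m powr (\<alpha> - 2 * \<epsilon>) * (2 / \<alpha>)" by simp
      qed auto
      also have "\<dots> = ennreal (4 * \<epsilon> / \<alpha>) * ennreal (\<tau> z powr (-\<alpha>) * m powr (\<alpha> - 2 * \<epsilon>))"
        using \<epsilon> \<alpha> by (simp add: ennreal_mult[symmetric] mult_ac)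
      also have "\<dots> \<le> ennreal (4 * \<epsilon> / \<alpha>) * ennreal (w z + 1)"
      proof (intro mult_left_mono ennreal_leI)
        show "\<tau> z powr (-\<alpha>) * m powr (\<alpha> - 2 * \<epsilon>) \<le> w z + 1"
        proof (cases "\<tau> z < 1")
          case True
          then have "\<tau> z powr (-\<alpha>) * m powr (\<alpha> - 2 * \<epsilon>) = w z"
            using \<open>\<rho> \<le> \<tau> z\<close> by (simp add: m_def w_def powr_add[symmetric])
          then show ?thesis by simp
        next
          case False
          have "\<tau> z powr (-\<alpha>) \<le> 1" using False \<alpha> powr_mono2'[of "-\<alpha>" 1 "\<tau> z"] by simp
          then show ?thesis using False w0[of z] by (simp add: m_def)
        qed
      qed auto
      finally show ?thesis .
    next
      case False
      then have "ennreal (k r) * ennreal (if r \<le> \<tau> z then (\<tau> z / r) powr (-\<alpha>) else 0) = 0" for r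
        by (auto simp: k_def)
      then show ?thesis by (simp only: nn_integral_const mult_zero_left zero_le)
    qed
    have Fpart: "(\<integral>\<^sup>+r. ennreal (k r) * ennreal (r powr (2 * \<alpha>)) \<partial>lborel) \<le> ennreal (4 * \<epsilon> / \<alpha>)"
    proof -
      have "(\<integral>\<^sup>+r. ennreal (k r) * ennreal (r powr (2 * \<alpha>)) \<partial>lborel)
        = (\<integral>\<^sup>+r. ennreal (2 * \<epsilon>) * ennreal (if \<rho> \<le> r \<and> r \<le> 1 then r powr (2 * \<alpha> - 1 - 2 * \<epsilon>) else 0) \<partial>lborel)"
        using \<epsilon> by (intro nn_integral_cong) (auto simp: k_def ennreal_mult[symmetric] powr_add[symmetric] mult.assoc, simp add: algebra_simps)
      also have "\<dots> = ennreal (2 * \<epsilon>) * ennreal ((1 - \<rho> powr (2 * \<alpha> - 2 * \<epsilon>)) / (2 * \<alpha> - 2 * \<epsilon>))"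
        using \<rho> \<epsilon> \<alpha> nn_integral_powr_between[of \<rho> 1 "2 * \<alpha> - 1 - 2 * \<epsilon>"] by (subst nn_integral_cmult) simp_all
      also have "\<dots> \<le> ennreal (2 * \<epsilon>) * ennreal (1 / \<alpha>)"
        using \<epsilon> \<alpha> by (intro mult_left_mono ennreal_leI frac_le) auto
      also have "\<dots> \<le> ennreal (4 * \<epsilon> / \<alpha>)"
        using \<epsilon> \<alpha> by (subst ennreal_mult'[symmetric]) (auto intro!: ennreal_leI simp: field_simps)
      finally show ?thesis .
    qed
    have "W \<le> (\<integral>\<^sup>+z. 1 + (\<integral>\<^sup>+r. ennreal (k r) * ennreal (if \<tau> z < r then 1 else 0) \<partial>lborel) \<partial>M)"
      unfolding W_def by (intro nn_integral_mono lower)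
    also have "\<dots> = ?E + (\<integral>\<^sup>+z. \<integral>\<^sup>+r. ennreal (k r) * ennreal (if \<tau> z < r then 1 else 0) \<partial>lborel \<partial>M)"
      by (subst nn_integral_add) auto
    finally have split: "W \<le> ?E + (\<integral>\<^sup>+z. \<integral>\<^sup>+r. ennreal (k r) * ennreal (if \<tau> z < r then 1 else 0) \<partial>lborel \<partial>M)" .
    have "(\<integral>\<^sup>+z. \<integral>\<^sup>+r. ennreal (k r) * ennreal (if \<tau> z < r then 1 else 0) \<partial>lborel \<partial>M)
      = (\<integral>\<^sup>+r. ennreal (k r) * (\<integral>\<^sup>+z. ennreal (if \<tau> z < r then 1 else 0) \<partial>M) \<partial>lborel)"
      by (subst P.Fubini') (simp_all add: nn_integral_cmult)
    also have "\<dots> \<le> (\<integral>\<^sup>+r. ennreal (k r) * (ennreal C * ((\<integral>\<^sup>+z. ennreal (if r \<le> \<tau> z then (\<tau> z / r) powr (-\<alpha>) else 0) \<partial>M) + ennreal (r powr (2 * \<alpha>)) * F)) \<partial>lborel)"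
    proof (intro nn_integral_mono)
      fix r
      show "ennreal (k r) * (\<integral>\<^sup>+z. ennreal (if \<tau> z < r then 1 else 0) \<partial>M)
        \<le> ennreal (k r) * (ennreal C * ((\<integral>\<^sup>+z. ennreal (if r \<le> \<tau> z then (\<tau> z / r) powr (-\<alpha>) else 0) \<partial>M) + ennreal (r powr (2 * \<alpha>)) * F))"
      proof (cases "\<rho> \<le> r")
        case True
        then show ?thesis using \<rho> by (intro mult_left_mono H) auto
      qed (simp add: k_def)
    qed
    also have "\<dots> = ennreal C * ((\<integral>\<^sup>+r. \<integral>\<^sup>+z. ennreal (k r) * ennreal (if r \<le> \<tau> z then (\<tau> z / r) powr (-\<alpha>) else 0) \<partial>M \<partial>lborel)
        + (\<integral>\<^sup>+r. ennreal (k r) * ennreal (r powr (2 * \<alpha>)) \<partial>lborel) * F)"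
    proof -
      have "ennreal (k r) * (ennreal C * ((\<integral>\<^sup>+z. ennreal (if r \<le> \<tau> z then (\<tau> z / r) powr (-\<alpha>) else 0) \<partial>M) + ennreal (r powr (2 * \<alpha>)) * F))
        = ennreal C * ((\<integral>\<^sup>+z. ennreal (k r) * ennreal (if r \<le> \<tau> z then (\<tau> z / r) powr (-\<alpha>) else 0) \<partial>M) + ennreal (k r) * ennreal (r powr (2 * \<alpha>)) * F)" for r
        by (subst nn_integral_cmult) (auto simp: distrib_left mult_ac)
      then show ?thesis by (simp add: nn_integral_cmult nn_integral_add nn_integral_multc)
    qed
    also have "(\<integral>\<^sup>+r. \<integral>\<^sup>+z. ennreal (k r) * ennreal (if r \<le> \<tau> z then (\<tau> z / r) powr (-\<alpha>) else 0) \<partial>M \<partial>lborel)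
       = (\<integral>\<^sup>+z. \<integral>\<^sup>+r. ennreal (k r) * ennreal (if r \<le> \<tau> z then (\<tau> z / r) powr (-\<alpha>) else 0) \<partial>lborel \<partial>M)"
      by (rule P.Fubini'[symmetric]) measurable
    finally have "(\<integral>\<^sup>+z. \<integral>\<^sup>+r. ennreal (k r) * ennreal (if \<tau> z < r then 1 else 0) \<partial>lborel \<partial>M)
      \<le> ennreal C * ((\<integral>\<^sup>+z. \<integral>\<^sup>+r. ennreal (k r) * ennreal (if r \<le> \<tau> z then (\<tau> z / r) powr (-\<alpha>) else 0) \<partial>lborel \<partial>M)
        + (\<integral>\<^sup>+r. ennreal (k r) * ennreal (r powr (2 * \<alpha>)) \<partial>lborel) * F)" .
    with split have "W \<le> ?E + ennreal C * ((\<integral>\<^sup>+z. \<integral>\<^sup>+r. ennreal (k r) * ennreal (if r \<le> \<tau> z then (\<tau> z / r) powr (-\<alpha>) else 0) \<partial>lborel \<partial>M)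
        + (\<integral>\<^sup>+r. ennreal (k r) * ennreal (r powr (2 * \<alpha>)) \<partial>lborel) * F)"
      by (meson add_left_mono order_trans)
    also have "?E + ennreal C * ((\<integral>\<^sup>+z. \<integral>\<^sup>+r. ennreal (k r) * ennreal (if r \<le> \<tau> z then (\<tau> z / r) powr (-\<alpha>) else 0) \<partial>lborel \<partial>M)
        + (\<integral>\<^sup>+r. ennreal (k r) * ennreal (r powr (2 * \<alpha>)) \<partial>lborel) * F)
      \<le> ?E + ennreal C * ((\<integral>\<^sup>+z. ennreal (4 * \<epsilon> / \<alpha>) * ennreal (w z + 1) \<partial>M) + ennreal (4 * \<epsilon> / \<alpha>) * F)"
      by (intro add_mono mult_left_mono mult_right_mono nn_integral_mono upper Fpart order_refl) auto
    also have "(\<integral>\<^sup>+z. ennreal (4 * \<epsilon> / \<alpha>) * ennreal (w z + 1) \<partial>M) = ennreal (4 * \<epsilon> / \<alpha>) * (W + ?E)"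
      unfolding W_def using w0 by (simp add: nn_integral_cmult nn_integral_add)
    also have "?E + ennreal C * (ennreal (4 * \<epsilon> / \<alpha>) * (W + ?E) + ennreal (4 * \<epsilon> / \<alpha>) * F)
       = ?E + ennreal (C * (4 * \<epsilon> / \<alpha>)) * (W + ?E + F)"
    proof -
      have "0 \<le> 4 * \<epsilon> / \<alpha>" using \<epsilon> \<alpha> by simp
      from ennreal_mult[OF less_imp_le[OF C] this] show ?thesis by (simp only: distrib_left mult.assoc add.assoc)
    qed
    also have "\<dots> \<le> ?E + ennreal (1 / 2) * (W + ?E + F)"
      using \<epsilon> C \<alpha> by (intro add_left_mono mult_right_mono ennreal_leI) (auto simp: field_simps)
    finally have main: "W \<le> ?E + ennreal (1 / 2) * (W + ?E + F)" .
    obtain e where e: "?E = ennreal e" "0 \<le> e" by (cases ?E) (auto simp: emeasure_finite)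
    obtain f where f: "F = ennreal f" "0 \<le> f" using False by (cases F) auto
    obtain v where v: "W = ennreal v" "0 \<le> v" using Wfin by (cases W) auto
    have "v \<le> e + h * (v + e + f)" if "W \<le> ?E + ennreal h * (W + ?E + F)" "0 \<le> h" for h
      using that e f v by (simp add: ennreal_plus[symmetric] ennreal_mult[symmetric] del: ennreal_plus)
    \<comment> \<open>Absorbing half of the finite \<open>v\<close> gives the coefficients 3 and 1
      of the conclusion.\<close>
    from this[OF main] have "v \<le> e + 1 / 2 * (v + e + f)" by simp
    then have "v \<le> 3 * e + f" by (simp add: field_simps)
    then have "ennreal v \<le> ennreal (3 * e + f)" by (rule ennreal_leI)
    also have "\<dots> = 3 * ?E + F" using e f by (simp add: ennreal_mult)
    finally show ?thesis using v by (simp add: W_def w_def)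
  qed simp
  \<comment> \<open>Fatou's lemma along \<open>\<rho> = 1 / (i + 2)\<close>; the shift by two keeps
    \<open>\<rho> < 1\<close> from \<open>i = 0\<close> on, as \<open>bnd\<close> requires.\<close>
  let ?f = "\<lambda>i z. ennreal (if \<tau> z < 1 then max (\<tau> z) (1 / (real i + 2)) powr (-2 * \<epsilon>) else 0)"
  let ?g = "\<lambda>z. ennreal (if 0 < \<tau> z \<and> \<tau> z < 1 then \<tau> z powr (-2 * \<epsilon>) else 0)"
  have "(\<integral>\<^sup>+z. ?g z \<partial>M) \<le> (\<integral>\<^sup>+z. liminf (\<lambda>i. ?f i z) \<partial>M)"
  proof (intro nn_integral_mono)
    fix z
    show "?g z \<le> liminf (\<lambda>i. ?f i z)"
    proof (cases "0 < \<tau> z \<and> \<tau> z < 1")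
      case True
      have "(\<lambda>i. 1 / (real i + 2)) \<longlonglongrightarrow> 0"
        using LIMSEQ_ignore_initial_segment[OF lim_1_over_n[where 'a=real], of 2] by (simp add: add.commute)
      then have "eventually (\<lambda>i. 1 / (real i + 2) < \<tau> z) sequentially"
        by (rule order_tendstoD) (use True in simp)
      then have "eventually (\<lambda>i. ?f i z = ?g z) sequentially"
        by eventually_elim (use True in auto)
      then have "(\<lambda>i. ?f i z) \<longlonglongrightarrow> ?g z" by (rule tendsto_eventually)
      then have "liminf (\<lambda>i. ?f i z) = ?g z" by (intro lim_imp_Liminf) auto
      then show ?thesis by simp
    qed (simp only: if_False ennreal_0 zero_le)
  qed
  also have "\<dots> \<le> liminf (\<lambda>i. \<integral>\<^sup>+z. ?f i z \<partial>M)" by (rule nn_integral_liminf) measurable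
  also have "\<dots> \<le> liminf (\<lambda>i::nat. 3 * ?E + F)"
    by (intro Liminf_mono always_eventually allI bnd) auto
  also have "\<dots> = 3 * ?E + F" by (intro Liminf_const) auto
  finally show ?thesis .
qed

text \<open>If \<open>g > 2CK\<^sup>2\<close>, take the scale \<open>r < 1\<close> at which \<open>C r\<^sup>-\<^sup>N K\<^sup>2 = g/2\<close>.\<close>

lemma ennpowr_bound_of_scales:
  fixes g H :: ennreal and h :: "real \<Rightarrow> ennreal" and C K N \<epsilon> :: real
  assumes pos: "0 < C" "0 < K" "0 < N" "0 < \<epsilon>"
    and g: "\<And>r. 0 < r \<Longrightarrow> r \<le> 1 \<Longrightarrow> g \<le> ennreal C * (h r + ennreal (r powr (-N) * K\<^sup>2))"
    and h: "\<And>r. 0 < r \<Longrightarrow> r \<le> 1 \<Longrightarrow> h r \<le> ennreal (r powr (2 * \<epsilon>)) * H"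
  shows "ennpowr g (1 + 2 * \<epsilon> / N) \<le> ennreal ((2 * C) powr (2 * \<epsilon> / N) * (1 + 2 * C) * K powr (4 * \<epsilon> / N)) * (H + g)"
proof -
  let ?d = "2 * \<epsilon> / N"
  let ?c = "(2 * C) powr ?d * (1 + 2 * C) * K powr (4 * \<epsilon> / N)"
  have d: "?d > 0" using pos by simp
  have c: "?c > 0" using pos by simp
  show ?thesis
  proof (cases "g = top \<or> H = top")
    case True
    have t: "H + g = top"
    proof (cases "H = top")
      case False
      then have "g = top" using True by simp
      then show ?thesis by simp
    qed simp
    \<comment> \<open>Positivity of the constant matters in the infinite case, because
      \<open>0 * top = 0\<close> in the extended reals.\<close>
    have "ennreal a * top = top" if "a > 0" for a
      using that by (simp add: ennreal_mult_eq_top_iff)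
    from this[OF c] show ?thesis unfolding t by simp
  next
    case False
    then obtain g' h' where g': "g = ennreal g'" "0 \<le> g'" and h': "H = ennreal h'" "0 \<le> h'"
      by (cases g; cases H) auto
    have K2: "(K\<^sup>2) powr ?d = K powr (4 * \<epsilon> / N)"
    proof -
      have "K\<^sup>2 = K powr 2" using pos by simp
      then show ?thesis by (simp only: powr_powr) simp
    qed
    have "g' powr (1 + ?d) \<le> ?c * (h' + g')"
    \<comment> \<open>Up to the threshold the intended scale would not be below 1; there the surplus
      power of \<open>g'\<close> is bounded by the same power of the threshold. Above it, the tail
      term at the chosen scale is half of \<open>g'\<close> and is absorbed.\<close>
    proof (cases "g' \<le> 2 * C * K\<^sup>2")
      case True
      have "g' powr (1 + ?d) = g' powr ?d * g'"
        using g' by (cases "g' = 0") (auto simp: powr_add)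
      also have "\<dots> \<le> (2 * C * K\<^sup>2) powr ?d * g'"
        using g' True d by (intro mult_right_mono powr_mono2) auto
      also have "\<dots> = (2 * C) powr ?d * 1 * K powr (4 * \<epsilon> / N) * g'"
        using pos by (simp add: powr_mult K2)
      also have "\<dots> \<le> (2 * C) powr ?d * (1 + 2 * C) * K powr (4 * \<epsilon> / N) * (h' + g')"
        using pos g' h' by (intro mult_mono) auto
      finally show ?thesis .
    next
      case False
      then have gp: "0 < g'" using pos by (smt (verit) mult_pos_pos zero_less_power)
      define r where "r = (2 * C * K\<^sup>2 / g') powr (1 / N)"
      have q: "0 < 2 * C * K\<^sup>2 / g'" "2 * C * K\<^sup>2 / g' < 1" using False gp pos by auto
      have r: "0 < r" "r \<le> 1" using q pos powr_mono2[of "1 / N" "2 * C * K\<^sup>2 / g'" 1] by (auto simp: r_def)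
      have rN: "r powr (-N) = g' / (2 * C * K\<^sup>2)"
        using q pos gp by (simp add: r_def powr_powr powr_minus_divide)
      have r2: "r powr (2 * \<epsilon>) = (2 * C * K\<^sup>2 / g') powr ?d"
        by (simp add: r_def powr_powr)
      have "ennreal g' \<le> ennreal C * (ennreal (r powr (2 * \<epsilon>)) * H + ennreal (r powr (-N) * K\<^sup>2))"
        using g[OF r] h[OF r] g' by (meson add_right_mono mult_left_mono order_trans zero_le)
      also have "\<dots> = ennreal (C * (r powr (2 * \<epsilon>) * h' + r powr (-N) * K\<^sup>2))"
        using pos h' by (simp add: ennreal_mult[symmetric] ennreal_plus[symmetric] del: ennreal_plus)
      finally have "g' \<le> C * (r powr (2 * \<epsilon>) * h' + r powr (-N) * K\<^sup>2)"
        using pos h' by (subst (asm) ennreal_le_iff) auto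
      also have "\<dots> = C * (r powr (2 * \<epsilon>) * h') + g' / 2"
        using pos by (simp add: rN field_simps)
      finally have "g' \<le> 2 * C * ((2 * C * K\<^sup>2 / g') powr ?d * h')"
        unfolding r2 by (simp add: field_simps)
      also have "(2 * C * K\<^sup>2 / g') powr ?d = (2 * C) powr ?d * K powr (4 * \<epsilon> / N) / g' powr ?d"
        using pos gp by (simp add: powr_divide powr_mult K2)
      finally have "g' powr ?d * g' \<le> g' powr ?d * (2 * C * ((2 * C) powr ?d * K powr (4 * \<epsilon> / N) / g' powr ?d * h'))"
        by (intro mult_left_mono) auto
      also have "\<dots> = (2 * C) powr ?d * (2 * C) * K powr (4 * \<epsilon> / N) * h'"
        using gp by simp
      also have "\<dots> \<le> ?c * (h' + g')"
        using pos g' h' by (intro mult_mono) auto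
      also have "g' powr ?d * g' = g' powr (1 + ?d)" using gp by (simp add: powr_add)
      finally show ?thesis .
    qed
    then have "ennreal (g' powr (1 + ?d)) \<le> ennreal (?c * (h' + g'))" by (rule ennreal_leI)
    also have "\<dots> = ennreal ?c * (H + g)"
      using c g' h' by (subst ennreal_mult) auto
    finally show ?thesis using g' by (simp add: ennpowr_def)
  qed
qed

section \<open>The sesquilinear form\<close>

text \<open>Transfers a pointwise inequality between energies, which are extended nonnegative
  integrals, and the signed density of the form, which has a Bochner integral. Should the integral
  of \<open>G\<close> be negative, \<open>ennreal\<close> sends it to 0 and the bound only becomes
  weaker.\<close>

lemma nn_integral_le_integral_plus:
  fixes G p q :: "'z \<Rightarrow> real"
  assumes G: "integrable M G" and [measurable]: "q \<in> borel_measurable M"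
    and q: "\<And>z. 0 \<le> q z" and p: "\<And>z. 0 \<le> p z"
    and le: "AE z in M. p z \<le> G z + q z"
  shows "(\<integral>\<^sup>+z. ennreal (p z) \<partial>M) \<le> ennreal (\<integral>z. G z \<partial>M) + (\<integral>\<^sup>+z. ennreal (q z) \<partial>M)"
proof (cases "(\<integral>\<^sup>+z. ennreal (q z) \<partial>M) < \<infinity>")
  case True
  have qi: "integrable M q"
    using True q by (intro integrableI_bounded) auto
  have "(\<integral>\<^sup>+z. ennreal (p z) \<partial>M) \<le> (\<integral>\<^sup>+z. ennreal (G z + q z) \<partial>M)"
    by (rule nn_integral_mono_AE) (use le in eventually_elim, rule ennreal_leI)
  also have "\<dots> = ennreal (\<integral>z. G z + q z \<partial>M)"
  proof (rule nn_integral_eq_integral)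
    show "integrable M (\<lambda>z. G z + q z)" using G qi by simp
    show "AE z in M. 0 \<le> G z + q z" using le by eventually_elim (use p order_trans in blast)
  qed
  also have "\<dots> = ennreal ((\<integral>z. G z \<partial>M) + (\<integral>z. q z \<partial>M))" using G qi by simp
  also have "\<dots> \<le> ennreal (\<integral>z. G z \<partial>M) + ennreal (\<integral>z. q z \<partial>M)"
    using q by (cases "0 \<le> (\<integral>z. G z \<partial>M)") (auto simp: ennreal_plus ennreal_neg intro!: ennreal_leI)
  also have "ennreal (\<integral>z. q z \<partial>M) = (\<integral>\<^sup>+z. ennreal (q z) \<partial>M)"
    using qi q by (intro nn_integral_eq_integral[symmetric]) auto
  finally show ?thesis .
qed (simp add: not_less top_unique)

lemma borel_measurable_cnj[measurable (raw)]:
  assumes [measurable]: "f \<in> borel_measurable M"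
  shows "(\<lambda>x. cnj (f x)) \<in> borel_measurable M"
proof -
  have [measurable]: "cnj \<in> borel_measurable borel"
    by (intro borel_measurable_continuous_onI continuous_intros)
  show ?thesis by measurable
qed

definition form_density :: "real \<Rightarrow> ('a::euclidean_space \<times> 'a \<Rightarrow> complex) \<Rightarrow> ('a \<Rightarrow> complex) \<Rightarrow> ('a \<Rightarrow> complex) \<Rightarrow> 'a \<times> 'a \<Rightarrow> complex" where
  "form_density N A u \<phi> z = of_real (dist (fst z) (snd z) powr (-N)) * (A z * ((u (fst z) - u (snd z)) * cnj (\<phi> (fst z) - \<phi> (snd z))))"

lemma form_density_measurable[measurable]:
  assumes [measurable]: "A \<in> borel_measurable borel" "u \<in> borel_measurable borel" "\<phi> \<in> borel_measurable borel"
  shows "form_density N A u \<phi> \<in> borel_measurable borel"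
proof -
  have [measurable]: "(\<lambda>z. A z) \<in> borel_measurable (borel \<Otimes>\<^sub>M borel)" by (simp add: borel_prod)
  have "form_density N A u \<phi> \<in> borel_measurable (borel \<Otimes>\<^sub>M borel)"
    unfolding form_density_def[abs_def] by measurable
  then show ?thesis by (simp add: borel_prod)
qed

lemma two_mult_le_sum_squares: "2 * (a * b) \<le> a\<^sup>2 + (b::real)\<^sup>2"
  using sum_squares_bound[of a b] by (simp add: mult.assoc)

lemma mult_le_weighted_sq:
  fixes a b t :: real assumes "t > 0" "0 \<le> a" "0 \<le> b"
  shows "a * b \<le> t * a\<^sup>2 + b\<^sup>2 / t"
proof -
  have "2 * (sqrt t * a * (b / sqrt t)) \<le> (sqrt t * a)\<^sup>2 + (b / sqrt t)\<^sup>2" by (rule two_mult_le_sum_squares)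
  also have "\<dots> = t * a\<^sup>2 + b\<^sup>2 / t" using assms by (simp add: power_mult_distrib power_divide)
  also have "2 * (sqrt t * a * (b / sqrt t)) = 2 * (a * b)" using assms by simp
  finally show ?thesis using mult_nonneg_nonneg[OF assms(2,3)] by linarith
qed

lemma energy_density_measurable[measurable]:
  fixes u :: "'a::euclidean_space \<Rightarrow> complex"
  assumes [measurable]: "\<kappa> \<in> borel_measurable borel" "u \<in> borel_measurable borel"
  shows "(\<lambda>z. \<kappa> (dist (fst z) (snd z)) * (cmod (u (fst z) - u (snd z)))\<^sup>2) \<in> borel_measurable borel"
proof -
  have "(\<lambda>z::'a\<times>'a. \<kappa> (dist (fst z) (snd z)) * (cmod (u (fst z) - u (snd z)))\<^sup>2) \<in> borel_measurable (borel \<Otimes>\<^sub>M borel)"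
    by measurable
  then show ?thesis by (simp add: borel_prod)
qed

text \<open>Young's inequality with a free parameter takes the place of Cauchy-Schwarz and avoids
  square roots of extended reals. The parameter 1 gives integrability; small parameters give
  continuity in the test function.\<close>

lemma nn_integral_form_density_le:
  fixes u v :: "'a::euclidean_space \<Rightarrow> complex"
  assumes [measurable]: "A \<in> borel_measurable borel" "u \<in> borel_measurable borel" "v \<in> borel_measurable borel"
    and A: "AE z in lborel. cmod (A z) \<le> \<Lambda>" and t: "t > 0"
  shows "(\<integral>\<^sup>+z. ennreal (cmod (form_density N A u v z)) \<partial>lborel)
     \<le> ennreal \<bar>\<Lambda>\<bar> * (ennreal t * gagliardo N u + ennreal (1 / t) * gagliardo N v)"
proof -
  let ?e = "\<lambda>u z. dist (fst z) (snd z) powr (-N) * (cmod (u (fst z) - u (snd z)))\<^sup>2"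
  have m: "(\<lambda>z. ?e v z) \<in> borel_measurable borel" if "v \<in> borel_measurable borel" for v :: "'a \<Rightarrow> complex"
    by (rule energy_density_measurable[OF _ that]) measurable
  have "(\<integral>\<^sup>+z. ennreal (cmod (form_density N A u v z)) \<partial>lborel) \<le> (\<integral>\<^sup>+z. ennreal \<bar>\<Lambda>\<bar> * (ennreal t * ennreal (?e u z) + ennreal (1 / t) * ennreal (?e v z)) \<partial>lborel)"
  proof (rule nn_integral_mono_AE, use A in eventually_elim)
    fix z assume A: "cmod (A z) \<le> \<Lambda>"
    let ?k = "dist (fst z) (snd z) powr (-N)"
    let ?a = "cmod (u (fst z) - u (snd z))" let ?b = "cmod (v (fst z) - v (snd z))"
    have "norm (form_density N A u v z) = cmod (A z) * (?k * (?a * ?b))"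
      by (simp add: form_density_def norm_mult flip: complex_cnj_diff)
    also have "\<dots> \<le> \<bar>\<Lambda>\<bar> * (?k * (t * ?a\<^sup>2 + ?b\<^sup>2 / t))"
      using A t by (intro mult_mono mult_le_weighted_sq) auto
    also have "\<dots> = \<bar>\<Lambda>\<bar> * (t * ?e u z + 1 / t * ?e v z)" by (simp add: algebra_simps)
    finally have "ennreal (norm (form_density N A u v z)) \<le> ennreal (\<bar>\<Lambda>\<bar> * (t * ?e u z + 1 / t * ?e v z))" by (rule ennreal_leI)
    also have "\<dots> = ennreal \<bar>\<Lambda>\<bar> * (ennreal t * ennreal (?e u z) + ennreal (1 / t) * ennreal (?e v z))"
    proof -
      have gen: "ennreal (l * (t * a + s * b)) = ennreal l * (ennreal t * ennreal a + ennreal s * ennreal b)"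
        if "0 \<le> l" "0 \<le> s" "0 \<le> a" "0 \<le> b" for l a s b
        using that t by (simp add: ennreal_mult)
      show ?thesis by (rule gen) (use t in auto)
    qed
    finally show "ennreal (cmod (form_density N A u v z)) \<le> \<dots>" .
  qed
  also have "\<dots> = ennreal \<bar>\<Lambda>\<bar> * (ennreal t * gagliardo N u + ennreal (1 / t) * gagliardo N v)"
    using energy_eq_prod[of "\<lambda>t. t powr (-N)" u] energy_eq_prod[of "\<lambda>t. t powr (-N)" v] m
    by (simp add: nn_integral_cmult nn_integral_add)
  finally show ?thesis .
qed

lemma form_density_integrable:
  fixes u \<phi> :: "'a::euclidean_space \<Rightarrow> complex"
  assumes [measurable]: "A \<in> borel_measurable borel" "u \<in> borel_measurable borel" "\<phi> \<in> borel_measurable borel"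
    and A: "AE z in lborel. cmod (A z) \<le> \<Lambda>"
    and e: "gagliardo N u < \<infinity>" "gagliardo N \<phi> < \<infinity>"
  shows "integrable lborel (form_density N A u \<phi>)"
proof (rule integrableI_bounded)
  show "(\<integral>\<^sup>+z. ennreal (norm (form_density N A u \<phi> z)) \<partial>lborel) < \<infinity>"
    by (rule le_less_trans[OF nn_integral_form_density_le[OF _ _ _ A zero_less_one]])
      (use e in \<open>auto simp: ennreal_mult_less_top\<close>)
qed simp

lemma form_bound:
  fixes u v :: "'a::euclidean_space \<Rightarrow> complex"
  assumes [measurable]: "A \<in> borel_measurable borel" "u \<in> borel_measurable borel" "v \<in> borel_measurable borel"
    and A: "AE z in lborel. cmod (A z) \<le> \<Lambda>" and t: "t > 0"
  shows "ennreal (cmod (\<integral>z. form_density N A u v z \<partial>lborel))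
     \<le> ennreal \<bar>\<Lambda>\<bar> * (ennreal t * gagliardo N u + ennreal (1 / t) * gagliardo N v)"
  using integral_norm_bound_ennreal[of lborel "form_density N A u v"] nn_integral_form_density_le[OF assms, of N]
  by (cases "integrable lborel (form_density N A u v)") (auto simp: not_integrable_integral_eq intro: order_trans)

lemma nn_integral_l2_pairing_le:
  fixes f \<phi> :: "'a::euclidean_space \<Rightarrow> complex"
  assumes [measurable]: "f \<in> borel_measurable borel" "\<phi> \<in> borel_measurable borel" and t: "t > 0"
  shows "(\<integral>\<^sup>+x. ennreal (cmod (f x * cnj (\<phi> x))) \<partial>lborel) \<le> ennreal t * l2sq f + ennreal (1 / t) * l2sq \<phi>"
proof -
  have "(\<integral>\<^sup>+x. ennreal (cmod (f x * cnj (\<phi> x))) \<partial>lborel) \<le> (\<integral>\<^sup>+x. ennreal t * ennreal ((cmod (f x))\<^sup>2) + ennreal (1 / t) * ennreal ((cmod (\<phi> x))\<^sup>2) \<partial>lborel)"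
  proof (intro nn_integral_mono)
    fix x
    have "cmod (f x * cnj (\<phi> x)) \<le> t * (cmod (f x))\<^sup>2 + 1 / t * (cmod (\<phi> x))\<^sup>2"
      using mult_le_weighted_sq[OF t, of "cmod (f x)" "cmod (\<phi> x)"] by (simp add: norm_mult)
    then have "ennreal (cmod (f x * cnj (\<phi> x))) \<le> ennreal (t * (cmod (f x))\<^sup>2 + 1 / t * (cmod (\<phi> x))\<^sup>2)"
      by (rule ennreal_leI)
    also have "\<dots> = ennreal t * ennreal ((cmod (f x))\<^sup>2) + ennreal (1 / t) * ennreal ((cmod (\<phi> x))\<^sup>2)"
      using t by (subst ennreal_plus) (auto simp: ennreal_mult[symmetric])
    finally show "ennreal (cmod (f x * cnj (\<phi> x))) \<le> \<dots>" .
  qed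
  also have "\<dots> = ennreal t * l2sq f + ennreal (1 / t) * l2sq \<phi>"
    unfolding l2sq_def by (simp add: nn_integral_add nn_integral_cmult)
  finally show ?thesis .
qed

lemma integrable_l2_pairing:
  fixes f \<phi> :: "'a::euclidean_space \<Rightarrow> complex"
  assumes [measurable]: "f \<in> borel_measurable borel" "\<phi> \<in> borel_measurable borel"
    and fin: "l2sq f < \<infinity>" "l2sq \<phi> < \<infinity>"
  shows "integrable lborel (\<lambda>x. f x * cnj (\<phi> x))"
proof (rule integrableI_bounded)
  show "(\<integral>\<^sup>+x. ennreal (norm (f x * cnj (\<phi> x))) \<partial>lborel) < \<infinity>"
    by (rule le_less_trans[OF nn_integral_l2_pairing_le[OF _ _ zero_less_one]])
      (use fin in \<open>auto simp: ennreal_mult_less_top\<close>)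
qed measurable

lemma l2_pairing_bound:
  fixes f \<phi> :: "'a::euclidean_space \<Rightarrow> complex"
  assumes [measurable]: "f \<in> borel_measurable borel" "\<phi> \<in> borel_measurable borel" and t: "t > 0"
  shows "ennreal (cmod (\<integral>x. f x * cnj (\<phi> x) \<partial>lborel)) \<le> ennreal t * l2sq f + ennreal (1 / t) * l2sq \<phi>"
  using integral_norm_bound_ennreal[of lborel "\<lambda>x. f x * cnj (\<phi> x)"] nn_integral_l2_pairing_le[OF assms]
  by (cases "integrable lborel (\<lambda>x. f x * cnj (\<phi> x))") (auto simp: not_integrable_integral_eq intro: order_trans)

text \<open>The equation tested with the whole Sobolev space: the functions actually used for
  testing, \<open>u\<close> and \<open>u - avg \<psi> u\<close>, are neither smooth nor compactly
  supported in general.\<close>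

definition weak_on_sobolev :: "real \<Rightarrow> ('a::euclidean_space \<times> 'a \<Rightarrow> complex) \<Rightarrow> ('a \<Rightarrow> complex) \<Rightarrow> ('a \<Rightarrow> complex) \<Rightarrow> bool" where
  "weak_on_sobolev N A f u \<longleftrightarrow> (\<forall>\<phi>. \<phi> \<in> borel_measurable borel \<longrightarrow> l2sq \<phi> < \<infinity> \<longrightarrow> gagliardo N \<phi> < \<infinity> \<longrightarrow>
     (\<integral>z. form_density N A u \<phi> z \<partial>lborel) = (\<integral>x. f x * cnj (\<phi> x) \<partial>lborel))"

section \<open>Energy estimates for weak solutions\<close>

lemma energy_bound:
  fixes u f :: "'a::euclidean_space \<Rightarrow> complex"
  assumes [measurable]: "A \<in> borel_measurable borel" "u \<in> borel_measurable borel" "f \<in> borel_measurable borel"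
    and A: "AE z in lborel. lam \<le> Re (A z) \<and> cmod (A z) \<le> 1 / lam" and lam: "lam > 0"
    and fin: "l2sq u < \<infinity>" "gagliardo N u < \<infinity>"
    and w: "weak_on_sobolev N A f u"
  shows "ennreal lam * gagliardo N u \<le> l2sq f + l2sq u"
proof -
  let ?e = "\<lambda>z. dist (fst z) (snd z) powr (-N) * (cmod (u (fst z) - u (snd z)))\<^sup>2"
  have A2: "AE z in lborel. cmod (A z) \<le> 1 / lam" using A by eventually_elim auto
  have i: "integrable lborel (form_density N A u u)" by (rule form_density_integrable[OF _ _ _ A2 fin(2) fin(2)]) measurable
  have [measurable]: "?e \<in> borel_measurable borel" by (rule energy_density_measurable) auto
  have "ennreal lam * gagliardo N u = (\<integral>\<^sup>+z. ennreal (lam * ?e z) \<partial>lborel)"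
  proof -
    have "(\<integral>\<^sup>+z. ennreal (lam * ?e z) \<partial>lborel) = (\<integral>\<^sup>+z. ennreal lam * ennreal (?e z) \<partial>lborel)"
      using lam by (simp add: ennreal_mult')
    then show ?thesis by (subst energy_eq_prod) (simp_all add: nn_integral_cmult)
  qed
  also have "\<dots> \<le> ennreal (\<integral>z. Re (form_density N A u u z) \<partial>lborel) + (\<integral>\<^sup>+(z::'a\<times>'a). ennreal 0 \<partial>lborel)"
  proof (rule nn_integral_le_integral_plus)
    show "integrable lborel (\<lambda>z. Re (form_density N A u u z))" using i by simp
    show "AE z in lborel. lam * ?e z \<le> Re (form_density N A u u z) + 0"
      using A
    proof eventually_elim
      fix z assume a: "lam \<le> Re (A z) \<and> cmod (A z) \<le> 1 / lam"
      have "form_density N A u u z = A z * of_real (?e z)"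
        unfolding form_density_def using complex_norm_square[of "u (fst z) - u (snd z)"] by (simp add: mult_ac)
      then have "Re (form_density N A u u z) = Re (A z) * ?e z" by simp
      then show "lam * ?e z \<le> Re (form_density N A u u z) + 0" using a by (simp add: mult_right_mono)
    qed
  qed (use lam in auto)
  also have "(\<integral>z. Re (form_density N A u u z) \<partial>lborel) = Re (\<integral>z. form_density N A u u z \<partial>lborel)"
    using i by simp
  also have "(\<integral>z. form_density N A u u z \<partial>lborel) = (\<integral>x. f x * cnj (u x) \<partial>lborel)"
    using w fin unfolding weak_on_sobolev_def by simp
  also have "ennreal (Re (\<integral>x. f x * cnj (u x) \<partial>lborel)) + (\<integral>\<^sup>+(z::'a\<times>'a). ennreal 0 \<partial>lborel) \<le> ennreal (cmod (\<integral>x. f x * cnj (u x) \<partial>lborel))"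
    by (simp add: complex_Re_le_cmod ennreal_leI)
  also have "\<dots> \<le> ennreal 1 * l2sq f + ennreal (1 / 1) * l2sq u"
    by (rule l2_pairing_bound) auto
  finally show ?thesis by simp
qed

text \<open>Coercivity survives a perturbation of the test difference. With
  \<open>\<Phi> = U\<close> the real part is at least \<open>lam * (cmod U)\<^sup>2\<close>; the
  error involves \<open>U - \<Phi>\<close> and, by Young's inequality for
  \<open>lam * cmod U\<close> and \<open>cmod (U - \<Phi>) / lam\<close>, costs half of this. The
  same choice produces the cube of \<open>lam\<close>.\<close>

lemma form_pointwise:
  fixes a U \<Phi> :: complex and lam :: real
  assumes lam: "lam > 0" and a: "lam \<le> Re a" "cmod a \<le> 1 / lam"
  shows "lam / 2 * (cmod U)\<^sup>2 \<le> Re (a * (U * cnj \<Phi>)) + 1 / (2 * lam ^ 3) * (cmod (U - \<Phi>))\<^sup>2"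
proof -
  let ?\<Psi> = "U - \<Phi>"
  have "Re (a * (U * cnj U)) = Re a * (cmod U)\<^sup>2"
  proof -
    have "a * (U * cnj U) = a * of_real ((cmod U)\<^sup>2)" by (simp only: complex_norm_square)
    then have "Re (a * (U * cnj U)) = Re (a * of_real ((cmod U)\<^sup>2))" by (rule arg_cong)
    also have "\<dots> = Re a * (cmod U)\<^sup>2" by simp
    finally show ?thesis .
  qed
  then have 1: "lam * (cmod U)\<^sup>2 \<le> Re (a * (U * cnj U))" using a by (simp only: mult_right_mono zero_le_power2)
  have "Re (a * (U * cnj ?\<Psi>)) \<le> cmod (a * (U * cnj ?\<Psi>))" by (rule complex_Re_le_cmod)
  also have "\<dots> = cmod a * (cmod U * cmod ?\<Psi>)" by (simp only: norm_mult complex_mod_cnj)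
  also have "\<dots> \<le> 1 / lam * (cmod U * cmod ?\<Psi>)" using a by (intro mult_right_mono) auto
  also have "\<dots> \<le> lam / 2 * (cmod U)\<^sup>2 + 1 / (2 * lam ^ 3) * (cmod ?\<Psi>)\<^sup>2"
  proof -
    have "2 * ((lam * cmod U) * (cmod ?\<Psi> / lam)) \<le> (lam * cmod U)\<^sup>2 + (cmod ?\<Psi> / lam)\<^sup>2" by (rule two_mult_le_sum_squares)
    then have "2 * (cmod U * cmod ?\<Psi>) / (2 * lam) \<le> ((lam * cmod U)\<^sup>2 + (cmod ?\<Psi> / lam)\<^sup>2) / (2 * lam)"
      using lam by (intro divide_right_mono) auto
    also have "\<dots> = lam / 2 * (cmod U)\<^sup>2 + 1 / (2 * lam ^ 3) * (cmod ?\<Psi>)\<^sup>2"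
      using lam by (simp add: power_mult_distrib power_divide field_simps power2_eq_square power3_eq_cube)
    finally show ?thesis using lam by simp
  qed
  finally have 2: "Re (a * (U * cnj ?\<Psi>)) \<le> lam / 2 * (cmod U)\<^sup>2 + 1 / (2 * lam ^ 3) * (cmod ?\<Psi>)\<^sup>2" .
  have "a * (U * cnj U) = a * (U * cnj \<Phi>) + a * (U * cnj ?\<Psi>)" by (simp add: algebra_simps)
  then have "Re (a * (U * cnj U)) = Re (a * (U * cnj \<Phi>)) + Re (a * (U * cnj ?\<Psi>))" by simp
  then show ?thesis using 1 2 by linarith
qed

text \<open>On far pairs only the size of the coefficient is used and no sign. The parameter
  \<open>s\<close> decides how the product is shared between \<open>U\<close> and
  \<open>\<Phi>\<close>.\<close>

lemma form_pointwise_far: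
  fixes a U \<Phi> :: complex and lam s :: real
  assumes lam: "lam > 0" and a: "cmod a \<le> 1 / lam" and s: "s > 0"
  shows "0 \<le> Re (a * (U * cnj \<Phi>)) + 1 / lam * ((cmod U)\<^sup>2 / s + s * (cmod \<Phi>)\<^sup>2)"
proof -
  have "- Re (a * (U * cnj \<Phi>)) \<le> cmod (a * (U * cnj \<Phi>))" by (metis abs_Re_le_cmod abs_le_iff)
  also have "\<dots> = cmod a * (cmod \<Phi> * cmod U)" by (simp add: norm_mult)
  also have "\<dots> \<le> 1 / lam * (s * (cmod \<Phi>)\<^sup>2 + (cmod U)\<^sup>2 / s)"
    using a lam s by (intro mult_mono mult_le_weighted_sq) auto
  finally show ?thesis by (simp add: add.commute)
qed


text \<open>Coercivity is exploited on near pairs only, where \<open>U - \<Phi>\<close> is the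
  difference of two averages. All remaining terms are bounded by the damped energy through the three
  hole-filling estimates, with a constant chosen before the coefficient, the solution and the
  scale.\<close>

lemma caccioppoli_scale:
  fixes \<alpha> N lam :: real
  assumes n: "DIM('a::euclidean_space) \<ge> 2" and \<alpha>: "0 < \<alpha>" "\<alpha> < 1" and N: "N = DIM('a) + 2 * \<alpha>" and lam: "lam > 0"
  shows "\<exists>C>0. \<forall>A (u::'a \<Rightarrow> complex) f r. A \<in> borel_measurable borel \<longrightarrow> u \<in> borel_measurable borel \<longrightarrow> f \<in> borel_measurable borel \<longrightarrow>
    (AE z in lborel. lam \<le> Re (A z) \<and> cmod (A z) \<le> 1 / lam) \<longrightarrow>
    l2sq u < \<infinity> \<longrightarrow> gagliardo N u < \<infinity> \<longrightarrow> weak_on_sobolev N A f u \<longrightarrow> 0 < r \<longrightarrow>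
    energy (near N r) u
      \<le> ennreal C * (energy (damped \<alpha> N r) u + ennreal (r powr (2 * \<alpha>)) * l2sq f)"
proof -
  obtain C where C: "C > 0" and est: "\<And>r. r > 0 \<Longrightarrow> \<exists>(\<psi>::'a \<Rightarrow> real) B R. avg_kernel \<psi> B R \<and>
    (\<forall>u T. u \<in> borel_measurable borel \<longrightarrow> l2sq u < \<infinity> \<longrightarrow>
       T = energy (damped \<alpha> N r) u \<longrightarrow>
       l2sq (\<lambda>x. u x - avg \<psi> u x) \<le> ennreal (C * r powr (2 * \<alpha>)) * T \<and>
       energy (near N r) (avg \<psi> u) \<le> ennreal C * T \<and>
       energy (amplified \<alpha> N r) (\<lambda>x. u x - avg \<psi> u x) \<le> ennreal C * T)"
    using hole_filling_estimates[OF n \<alpha> N] by blast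
  \<comment> \<open>\<open>b\<close> and \<open>d\<close> are the constants of the near and the far
    pointwise bound. In \<open>D\<close> the summand 1 serves the term with \<open>f\<close>,
    \<open>C\<close> its pairing with \<open>\<phi>\<close>, \<open>b * C\<close> the averages on
    near pairs, \<open>d\<close> and \<open>d * C\<close> the functions \<open>u\<close> and
    \<open>\<phi>\<close> on far pairs; the coercivity constant \<open>lam / 2\<close> is divided
    out.\<close>
  define b where "b = 1 / (2 * lam ^ 3)"
  define d where "d = 1 / lam"
  have bd: "b > 0" "d > 0" using lam by (auto simp: b_def d_def)
  define D where "D = (1 + C + b * C + d + d * C) / (lam / 2)"
  have D: "D > 0" using C bd lam by (simp add: D_def add_pos_nonneg)
  have "energy (near N r) u
      \<le> ennreal D * (energy (damped \<alpha> N r) u + ennreal (r powr (2 * \<alpha>)) * l2sq f)"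
    if Am[measurable]: "A \<in> borel_measurable borel" and um[measurable]: "u \<in> borel_measurable borel" and fm[measurable]: "f \<in> borel_measurable borel"
      and A: "AE z in lborel. lam \<le> Re (A z) \<and> cmod (A z) \<le> 1 / lam"
      and fin: "l2sq u < \<infinity>" "gagliardo N u < \<infinity>" and w: "weak_on_sobolev N A f u" and r: "0 < r"
    for A and u f :: "'a \<Rightarrow> complex" and r
  proof -
    define T where "T = energy (damped \<alpha> N r) u"
    define \<kappa>1 where "\<kappa>1 t = (if t < r then t powr (-N) else 0)" for t
    define \<kappa>2 where "\<kappa>2 t = (if r \<le> t then (t / r) powr \<alpha> * t powr (-N) else 0)" for t
    define \<kappa>3 where "\<kappa>3 t = (if r \<le> t then (t / r) powr (-\<alpha>) * t powr (-N) else 0)" for t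
    have \<kappa>m[measurable]: "\<kappa>1 \<in> borel_measurable borel" "\<kappa>2 \<in> borel_measurable borel" "\<kappa>3 \<in> borel_measurable borel"
      unfolding \<kappa>1_def \<kappa>2_def \<kappa>3_def by measurable
    have \<kappa>0: "0 \<le> \<kappa>1 t" "0 \<le> \<kappa>2 t" "0 \<le> \<kappa>3 t" for t by (auto simp: \<kappa>1_def \<kappa>2_def \<kappa>3_def)
    obtain \<psi> :: "'a \<Rightarrow> real" and B R where k: "avg_kernel \<psi> B R"
      and e1: "l2sq (\<lambda>x. u x - avg \<psi> u x) \<le> ennreal (C * r powr (2 * \<alpha>)) * T"
      and e2: "energy \<kappa>1 (avg \<psi> u) \<le> ennreal C * T"
      and e3: "energy \<kappa>2 (\<lambda>x. u x - avg \<psi> u x) \<le> ennreal C * T"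
      using est[OF r] um fin T_def unfolding \<kappa>1_def \<kappa>2_def by blast
    interpret avg_kernel \<psi> B R by (rule k)
    define \<phi> where "\<phi> x = u x - avg \<psi> u x" for x
    have \<phi>m[measurable]: "\<phi> \<in> borel_measurable borel" unfolding \<phi>_def by measurable
    have "T \<le> gagliardo N u"
      unfolding T_def
    proof (intro energy_mono)
      fix t :: real
      have "(t / r) powr (-\<alpha>) \<le> 1" if "r \<le> t"
        using powr_mono2'[of "-\<alpha>" 1 "t / r"] that r \<alpha> by simp
      then show "(if r \<le> t then (t / r) powr (-\<alpha>) * t powr (-N) else 0) \<le> t powr (-N)"
        by (auto intro!: mult_left_le_one_le)
    qed
    then have Tfin: "T < \<infinity>" using fin(2) by (rule le_less_trans)
    have "ennreal c * T < \<infinity>" for c using Tfin by (simp add: ennreal_mult_less_top)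
    then have \<phi>2: "l2sq \<phi> < \<infinity>" and \<phi>3: "energy \<kappa>2 \<phi> < \<infinity>"
      using e1 e3 le_less_trans unfolding \<phi>_def[abs_def] by blast+
    \<comment> \<open>Before \<open>\<phi>\<close> may be inserted into the equation its Gagliardo
      energy has to be finite. On near pairs this follows from \<open>u\<close> and its average, on
      far pairs from the amplified energy, since the factor \<open>(t / r) powr \<alpha>\<close> is
      at least one there.\<close>
    have "energy \<kappa>1 \<phi> \<le> 2 * energy \<kappa>1 u + 2 * energy \<kappa>1 (avg \<psi> u)"
      unfolding \<phi>_def by (intro energy_diff_le \<kappa>0) measurable
    also have "\<dots> \<le> 2 * gagliardo N u + 2 * (ennreal C * T)"
      by (intro add_mono mult_left_mono energy_mono e2) (auto simp: \<kappa>1_def)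
    also have "\<dots> < \<infinity>" using fin Tfin by (simp add: ennreal_mult_less_top)
    finally have \<phi>1: "energy \<kappa>1 \<phi> < \<infinity>" .
    have "gagliardo N \<phi> \<le> energy (\<lambda>t. \<kappa>1 t + \<kappa>2 t) \<phi>"
    proof (intro energy_mono)
      fix t :: real
      have "1 \<le> (t / r) powr \<alpha>" if "r \<le> t"
        using that r \<alpha> by (intro ge_one_powr_ge_zero) auto
      then show "t powr (-N) \<le> \<kappa>1 t + \<kappa>2 t"
        using mult_right_mono[of 1 "(t / r) powr \<alpha>" "t powr (-N)"] by (auto simp: \<kappa>1_def \<kappa>2_def)
    qed
    also have "\<dots> = energy \<kappa>1 \<phi> + energy \<kappa>2 \<phi>" by (intro energy_add \<kappa>0) measurable
    also have "\<dots> < \<infinity>"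
      using \<phi>1 \<phi>3 by simp
    finally have \<phi>e: "gagliardo N \<phi> < \<infinity>" .
    have A2: "AE z in lborel. cmod (A z) \<le> 1 / lam" using A by eventually_elim auto
    have i: "integrable lborel (form_density N A u \<phi>)"
      by (rule form_density_integrable[OF _ _ _ A2 fin(2) \<phi>e]) measurable
    let ?s = "\<lambda>v z. (cmod (v (fst z) - v (snd z)))\<^sup>2"
    let ?D = "\<lambda>z::'a\<times>'a. dist (fst z) (snd z)"
    let ?p = "\<lambda>z. \<kappa>1 (?D z) * ?s u z"
    let ?q1 = "\<lambda>z. \<kappa>1 (?D z) * ?s (avg \<psi> u) z"
    let ?q2 = "\<lambda>z. \<kappa>3 (?D z) * ?s u z"
    let ?q3 = "\<lambda>z. \<kappa>2 (?D z) * ?s \<phi> z"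
    have [measurable]: "?p \<in> borel_measurable borel" "?q1 \<in> borel_measurable borel" "?q2 \<in> borel_measurable borel" "?q3 \<in> borel_measurable borel"
      by (rule energy_density_measurable; measurable)+
    have "ennreal (lam / 2) * energy \<kappa>1 u = (\<integral>\<^sup>+z. ennreal (lam / 2 * ?p z) \<partial>lborel)"
    proof -
      have "(\<integral>\<^sup>+z. ennreal (lam / 2 * ?p z) \<partial>lborel) = (\<integral>\<^sup>+z. ennreal (lam / 2) * ennreal (?p z) \<partial>lborel)"
        using lam by (intro nn_integral_cong ennreal_mult') auto
      then show ?thesis by (simp add: energy_eq_prod nn_integral_cmult)
    qed
    also have "\<dots> \<le> ennreal (\<integral>z. Re (form_density N A u \<phi> z) \<partial>lborel) + (\<integral>\<^sup>+z. ennreal (b * ?q1 z + (d * ?q2 z + d * ?q3 z)) \<partial>lborel)"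
    proof (rule nn_integral_le_integral_plus)
      show "integrable lborel (\<lambda>z. Re (form_density N A u \<phi> z))" using i by simp
      show "AE z in lborel. lam / 2 * ?p z \<le> Re (form_density N A u \<phi> z) + (b * ?q1 z + (d * ?q2 z + d * ?q3 z))"
        using A
      proof eventually_elim
        fix z assume a: "lam \<le> Re (A z) \<and> cmod (A z) \<le> 1 / lam"
        define U where "U = u (fst z) - u (snd z)"
        define \<Phi> where "\<Phi> = \<phi> (fst z) - \<phi> (snd z)"
        define k where "k = ?D z powr (-N)"
        have k0: "0 \<le> k" by (simp add: k_def)
        have UP: "avg \<psi> u (fst z) - avg \<psi> u (snd z) = U - \<Phi>" by (simp add: U_def \<Phi>_def \<phi>_def)
        have Ref: "Re (form_density N A u \<phi> z) = k * Re (A z * (U * cnj \<Phi>))"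
          unfolding form_density_def by (simp add: U_def \<Phi>_def k_def)
        show "lam / 2 * ?p z \<le> Re (form_density N A u \<phi> z) + (b * ?q1 z + (d * ?q2 z + d * ?q3 z))"
        proof (cases "?D z < r")
          case True
          have "k * (lam / 2 * (cmod U)\<^sup>2) \<le> k * (Re (A z * (U * cnj \<Phi>)) + b * (cmod (U - \<Phi>))\<^sup>2)"
            unfolding b_def using a by (intro mult_left_mono form_pointwise lam k0) auto
          then show ?thesis using True r unfolding Ref UP U_def[symmetric] \<Phi>_def[symmetric]
            by (simp add: \<kappa>1_def \<kappa>2_def \<kappa>3_def k_def[symmetric] algebra_simps)
        next
          case False
          \<comment> \<open>With this parameter Young's inequality gives \<open>U\<close> the
            damping factor \<open>1 / s\<close> and \<open>\<Phi>\<close> the amplifying factor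
            \<open>s\<close>.\<close>
          define s where "s = (?D z / r) powr \<alpha>"
          have s: "s > 0" using False r by (auto simp: s_def)
          have "0 \<le> k * (Re (A z * (U * cnj \<Phi>)) + 1 / lam * ((cmod U)\<^sup>2 / s + s * (cmod \<Phi>)\<^sup>2))"
            using a by (intro mult_nonneg_nonneg k0 form_pointwise_far lam s) auto
          then have "0 \<le> k * Re (A z * (U * cnj \<Phi>)) + (d * (1 / s * k * (cmod U)\<^sup>2) + d * (s * k * (cmod \<Phi>)\<^sup>2))"
            by (simp add: d_def algebra_simps)
          moreover have "(?D z / r) powr (-\<alpha>) = 1 / s" by (simp add: s_def powr_minus_divide)
          ultimately show ?thesis using False unfolding Ref UP U_def[symmetric] \<Phi>_def[symmetric]
            by (simp add: \<kappa>1_def \<kappa>2_def \<kappa>3_def k_def[symmetric] s_def[symmetric])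
        qed
      qed
    qed (use lam \<kappa>0 bd in auto)
    also have "(\<integral>\<^sup>+z. ennreal (b * ?q1 z + (d * ?q2 z + d * ?q3 z)) \<partial>lborel)
      = ennreal b * energy \<kappa>1 (avg \<psi> u) + (ennreal d * energy \<kappa>3 u + ennreal d * energy \<kappa>2 \<phi>)"
    proof -
      have "(\<integral>\<^sup>+z. ennreal (b * ?q1 z + (d * ?q2 z + d * ?q3 z)) \<partial>lborel)
        = (\<integral>\<^sup>+z. ennreal b * ennreal (?q1 z) + (ennreal d * ennreal (?q2 z) + ennreal d * ennreal (?q3 z)) \<partial>lborel)"
        using bd \<kappa>0 by (intro nn_integral_cong) (simp only: ennreal_plus ennreal_mult mult_nonneg_nonneg less_imp_le zero_le_power2 add_nonneg_nonneg)
      then show ?thesis by (simp add: energy_eq_prod nn_integral_add nn_integral_cmult)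
    qed
    also have "(\<integral>z. Re (form_density N A u \<phi> z) \<partial>lborel) = Re (\<integral>z. form_density N A u \<phi> z \<partial>lborel)"
      using i by simp
    also have "(\<integral>z. form_density N A u \<phi> z \<partial>lborel) = (\<integral>x. f x * cnj (\<phi> x) \<partial>lborel)"
      using w \<phi>2 \<phi>e unfolding weak_on_sobolev_def by simp
    \<comment> \<open>The parameter \<open>r powr (2 * \<alpha>)\<close> in the pairing with
      \<open>f\<close> is matched to the bound \<open>e1\<close>: its inverse cancels the factor
      there and leaves \<open>C * T\<close>.\<close>
    also have "ennreal (Re (\<integral>x. f x * cnj (\<phi> x) \<partial>lborel)) + (ennreal b * energy \<kappa>1 (avg \<psi> u) + (ennreal d * energy \<kappa>3 u + ennreal d * energy \<kappa>2 \<phi>))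
       \<le> (ennreal (r powr (2 * \<alpha>)) * l2sq f + ennreal (1 / r powr (2 * \<alpha>)) * (ennreal (C * r powr (2 * \<alpha>)) * T))
         + (ennreal b * (ennreal C * T) + (ennreal d * T + ennreal d * (ennreal C * T)))"
    proof (intro add_mono mult_left_mono)
      have "ennreal (Re (\<integral>x. f x * cnj (\<phi> x) \<partial>lborel)) \<le> ennreal (cmod (\<integral>x. f x * cnj (\<phi> x) \<partial>lborel))"
        by (intro ennreal_leI complex_Re_le_cmod)
      also have "\<dots> \<le> ennreal (r powr (2 * \<alpha>)) * l2sq f + ennreal (1 / r powr (2 * \<alpha>)) * l2sq \<phi>"
        using r by (intro l2_pairing_bound) auto
      also have "\<dots> \<le> ennreal (r powr (2 * \<alpha>)) * l2sq f + ennreal (1 / r powr (2 * \<alpha>)) * (ennreal (C * r powr (2 * \<alpha>)) * T)"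
        using e1 unfolding \<phi>_def[abs_def] by (intro add_left_mono mult_left_mono) auto
      finally show "ennreal (Re (\<integral>x. f x * cnj (\<phi> x) \<partial>lborel)) \<le> \<dots>" .
      show "energy \<kappa>1 (avg \<psi> u) \<le> ennreal C * T" by (rule e2)
      show "energy \<kappa>2 \<phi> \<le> ennreal C * T" using e3 unfolding \<phi>_def[abs_def] .
      show "energy \<kappa>3 u \<le> T" unfolding T_def \<kappa>3_def ..
    qed (use C in auto)
    also have "\<dots> = ennreal (r powr (2 * \<alpha>)) * l2sq f + ennreal (C + b * C + d + d * C) * T"
    proof -
      have "ennreal (1 / r powr (2 * \<alpha>)) * (ennreal (C * r powr (2 * \<alpha>)) * T) = ennreal C * T"
        using r C by (simp add: mult.assoc[symmetric] ennreal_mult[symmetric])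
      moreover have "ennreal (C + b * C + d + d * C) = ennreal C + (ennreal b * ennreal C + (ennreal d + ennreal d * ennreal C))"
        using C bd by (simp add: ennreal_mult add.assoc)
      ultimately show ?thesis by (simp add: distrib_right mult.assoc add.assoc)
    qed
    also have "\<dots> \<le> ennreal (1 + C + b * C + d + d * C) * (ennreal (r powr (2 * \<alpha>)) * l2sq f) + ennreal (1 + C + b * C + d + d * C) * T"
    proof (intro add_mono mult_right_mono ennreal_leI)
      have "ennreal 1 * (ennreal (r powr (2 * \<alpha>)) * l2sq f) \<le> ennreal (1 + C + b * C + d + d * C) * (ennreal (r powr (2 * \<alpha>)) * l2sq f)"
        using C bd by (intro mult_right_mono ennreal_leI) auto
      then show "ennreal (r powr (2 * \<alpha>)) * l2sq f \<le> \<dots>" by simp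
    qed (use C in auto)
    also have "\<dots> = ennreal (1 + C + b * C + d + d * C) * (T + ennreal (r powr (2 * \<alpha>)) * l2sq f)"
      by (simp add: distrib_left add.commute)
    finally have "ennreal (1 / (lam / 2)) * (ennreal (lam / 2) * energy \<kappa>1 u)
      \<le> ennreal (1 / (lam / 2)) * (ennreal (1 + C + b * C + d + d * C) * (T + ennreal (r powr (2 * \<alpha>)) * l2sq f))"
      by (rule mult_left_mono) simp
    moreover have "ennreal (1 / (lam / 2)) * (ennreal (lam / 2) * X) = X" for X
      using lam by (simp add: mult.assoc[symmetric] ennreal_mult[symmetric])
    moreover have "ennreal (1 / (lam / 2)) * (ennreal (1 + C + b * C + d + d * C) * X) = ennreal D * X" for X
    proof -
      have "ennreal (1 / (lam / 2)) * (ennreal e * X) = ennreal (e / (lam / 2)) * X" if "0 \<le> e" for e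
      proof -
        have "ennreal (1 / (lam / 2)) * ennreal e = ennreal (e / (lam / 2))"
          using lam that by (subst ennreal_mult[symmetric]) (auto simp: mult.commute)
        then show ?thesis by (simp only: mult.assoc[symmetric])
      qed
      from this[of "1 + C + b * C + d + d * C"] show ?thesis
        unfolding D_def using C bd by (simp del: ennreal_plus add: add_nonneg_nonneg)
    qed
    ultimately show ?thesis unfolding T_def \<kappa>1_def by simp
  qed
  then show ?thesis using D by blast
qed

section \<open>Integrability from differentiability\<close>

text \<open>For \<open>dist x y \<ge> r\<close> the square of \<open>u x - u y\<close> is split. The
  part with \<open>u y\<close> is bounded by \<open>r powr (-N) * K\<^sup>2\<close> at once. The
  part with \<open>u x\<close> needs a bound for a single value of \<open>u\<close>, which is
  obtained by comparison with the values on the ball of radius \<open>r\<close>.\<close>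

lemma gamma_scale_bound:
  fixes \<alpha> N :: real
  assumes \<alpha>: "0 < \<alpha>" and N: "N = DIM('a::euclidean_space) + 2 * \<alpha>"
  shows "\<exists>C>0. \<forall>(u::'a \<Rightarrow> complex) K r x. u \<in> borel_measurable borel \<longrightarrow> l2sq u \<le> ennreal (K\<^sup>2) \<longrightarrow> 0 < r \<longrightarrow>
    (gamma_sq N u x)
    \<le> ennreal C * ((\<integral>\<^sup>+y. ennreal (near N r (dist x y) * (cmod (u x - u y))\<^sup>2) \<partial>lborel) + ennreal (r powr (-N) * K\<^sup>2))"
proof -
  let ?n = "real DIM('a)" let ?w = "unit_ball_vol ?n"
  have w: "?w > 0" by simp
  have Nn: "N > ?n" "N > 0" using \<alpha> by (auto simp: N add_nonneg_pos)
  define c where "c = N * ?w / (N - ?n)"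
  have c: "c > 0" using Nn w by (simp add: c_def)
  \<comment> \<open>\<open>4 * c / ?w\<close> arises from inserting the bound for \<open>u x\<close>
    into the tail, whose constant is \<open>c\<close>. The 3 covers the near integral together with
    twice \<open>r powr (-N) * K\<^sup>2\<close>.\<close>
  define C where "C = 4 * c / ?w + 3"
  have C: "C > 0" using c w by (simp add: C_def add_pos_pos)
  have "(gamma_sq N u x)
    \<le> ennreal C * ((\<integral>\<^sup>+y. ennreal (near N r (dist x y) * (cmod (u x - u y))\<^sup>2) \<partial>lborel) + ennreal (r powr (-N) * K\<^sup>2))"
    (is "?g \<le> ennreal C * (?h + ennreal ?k)")
    if um[measurable]: "u \<in> borel_measurable borel" and u: "l2sq u \<le> ennreal (K\<^sup>2)" and r: "0 < r" for u :: "'a \<Rightarrow> complex" and K r x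
  proof -
    define a where "a = (cmod (u x))\<^sup>2"
    define V where "V = ?w * r ^ DIM('a)"
    have V: "V > 0" using w r by (simp add: V_def)
    \<comment> \<open>Integrate \<open>a \<le> 2 * (cmod (u x - u y))\<^sup>2 + 2 * (cmod (u
      y))\<^sup>2\<close> over the ball. There \<open>r powr N * dist x y powr (-N)\<close> is at
      least one off the centre, so the first summand is bounded by the near integral.\<close>
    have "ennreal V * ennreal a = (\<integral>\<^sup>+y. ennreal a * indicator (ball x r) y \<partial>lborel)"
      using r w by (subst nn_integral_cmult_indicator) (auto simp: emeasure_ball V_def mult.commute)
    also have "\<dots> \<le> (\<integral>\<^sup>+y. ennreal (2 * r powr N) * ennreal (near N r (dist x y) * (cmod (u x - u y))\<^sup>2)
        + 2 * ennreal ((cmod (u y))\<^sup>2) \<partial>lborel)"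
    proof (intro nn_integral_mono)
      fix y
      show "ennreal a * indicator (ball x r) y \<le> ennreal (2 * r powr N) * ennreal (near N r (dist x y) * (cmod (u x - u y))\<^sup>2)
        + 2 * ennreal ((cmod (u y))\<^sup>2)"
      proof (cases "dist x y < r")
        case True
        let ?s = "(cmod (u x - u y))\<^sup>2"
        have "?s \<le> r powr N * (dist x y powr (-N) * ?s)"
        proof (cases "x = y")
          case False
          have "r powr (-N) \<le> dist x y powr (-N)" using True False Nn by (intro powr_mono2') auto
          then have "r powr N * r powr (-N) * ?s \<le> r powr N * dist x y powr (-N) * ?s"
            by (intro mult_right_mono mult_left_mono) auto
          then show ?thesis using r by (simp add: powr_add[symmetric] mult.assoc)
        qed simp
        moreover have "a \<le> 2 * ?s + 2 * (cmod (u y))\<^sup>2"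
          using norm_diff_sq_le[of "u x - u y" "- u y"] by (simp add: a_def)
        ultimately have "a \<le> 2 * r powr N * (dist x y powr (-N) * ?s) + 2 * (cmod (u y))\<^sup>2" by linarith
        then have "ennreal a \<le> ennreal (2 * r powr N * (dist x y powr (-N) * ?s) + 2 * (cmod (u y))\<^sup>2)" by (rule ennreal_leI)
        also have "\<dots> = ennreal (2 * r powr N) * ennreal (dist x y powr (-N) * ?s) + 2 * ennreal ((cmod (u y))\<^sup>2)"
          by (simp add: ennreal_mult)
        finally show ?thesis using True by simp
      qed simp
    qed
    also have "\<dots> = ennreal (2 * r powr N) * ?h + 2 * l2sq u"
      unfolding l2sq_def by (simp add: nn_integral_add nn_integral_cmult)
    also have "\<dots> \<le> ennreal (2 * r powr N) * ?h + 2 * ennreal (K\<^sup>2)"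
      by (intro add_left_mono mult_left_mono u) auto
    finally have A: "ennreal V * ennreal a \<le> ennreal (2 * r powr N) * ?h + 2 * ennreal (K\<^sup>2)" .
    have "?g \<le> (\<integral>\<^sup>+y. ennreal (near N r (dist x y) * (cmod (u x - u y))\<^sup>2)
        + (ennreal (2 * a) * ennreal (if r \<le> dist x y then dist x y powr (-N) else 0) + ennreal (2 * r powr (-N)) * ennreal ((cmod (u y))\<^sup>2)) \<partial>lborel)"
    proof (intro nn_integral_mono)
      fix y
      show "ennreal (dist x y powr (-N) * (cmod (u x - u y))\<^sup>2) \<le> ennreal (near N r (dist x y) * (cmod (u x - u y))\<^sup>2)
        + (ennreal (2 * a) * ennreal (if r \<le> dist x y then dist x y powr (-N) else 0) + ennreal (2 * r powr (-N)) * ennreal ((cmod (u y))\<^sup>2))"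
      proof (cases "dist x y < r")
        case False
        have "dist x y powr (-N) \<le> r powr (-N)" using False r Nn by (intro powr_mono2') auto
        then have "dist x y powr (-N) * (2 * (cmod (u y))\<^sup>2) \<le> r powr (-N) * (2 * (cmod (u y))\<^sup>2)"
          by (intro mult_right_mono) auto
        moreover have "dist x y powr (-N) * (cmod (u x - u y))\<^sup>2 \<le> dist x y powr (-N) * (2 * a + 2 * (cmod (u y))\<^sup>2)"
          unfolding a_def by (intro mult_left_mono norm_diff_sq_le) auto
        ultimately have "dist x y powr (-N) * (cmod (u x - u y))\<^sup>2 \<le> 2 * a * dist x y powr (-N) + 2 * r powr (-N) * (cmod (u y))\<^sup>2"
          by (simp add: algebra_simps)
        then have "ennreal (dist x y powr (-N) * (cmod (u x - u y))\<^sup>2) \<le> ennreal (2 * a * dist x y powr (-N) + 2 * r powr (-N) * (cmod (u y))\<^sup>2)"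
          by (rule ennreal_leI)
        also have "\<dots> = ennreal (2 * a) * ennreal (dist x y powr (-N)) + ennreal (2 * r powr (-N)) * ennreal ((cmod (u y))\<^sup>2)"
          by (simp add: ennreal_mult a_def)
        finally show ?thesis using False by simp
      qed simp
    qed
    also have "\<dots> = ?h + (ennreal (2 * a) * (\<integral>\<^sup>+y. ennreal (if r \<le> dist x y then dist x y powr (-N) else 0) \<partial>lborel) + ennreal (2 * r powr (-N)) * l2sq u)"
      unfolding l2sq_def by (simp add: nn_integral_add nn_integral_cmult)
    also have "(\<integral>\<^sup>+y. ennreal (if r \<le> dist x y then dist x y powr (-N) else 0) \<partial>lborel) = (\<integral>\<^sup>+(y::'a). ennreal (if r \<le> norm y then norm y powr (-N) else 0) \<partial>lborel)"
      by (rule nn_integral_lborel_dist[of "\<lambda>t. ennreal (if r \<le> t then t powr (-N) else 0)"]) measurable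
    finally have "?g \<le> ?h + (ennreal (2 * a) * (\<integral>\<^sup>+(y::'a). ennreal (if r \<le> norm y then norm y powr (-N) else 0) \<partial>lborel) + ennreal (2 * r powr (-N)) * l2sq u)" .
    also have "\<dots> \<le> ?h + (ennreal (2 * a) * ennreal (c * r powr (?n - N)) + ennreal (2 * r powr (-N)) * ennreal (K\<^sup>2))"
      unfolding c_def by (intro add_left_mono add_mono mult_left_mono u nn_integral_radial_tail Nn r) auto
    also have "ennreal (2 * a) * ennreal (c * r powr (?n - N)) = ennreal (2 * c * r powr (?n - N) / V) * (ennreal V * ennreal a)"
    proof -
      have "2 * c * r powr (?n - N) / V * (V * a) = 2 * a * (c * r powr (?n - N))" using V by simp
      moreover have "0 \<le> a" by (simp add: a_def)
      ultimately show ?thesis using V c by (simp add: ennreal_mult[symmetric])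
    qed
    also have "?h + (ennreal (2 * c * r powr (?n - N) / V) * (ennreal V * ennreal a) + ennreal (2 * r powr (-N)) * ennreal (K\<^sup>2))
      \<le> ?h + (ennreal (2 * c * r powr (?n - N) / V) * (ennreal (2 * r powr N) * ?h + 2 * ennreal (K\<^sup>2)) + ennreal (2 * r powr (-N)) * ennreal (K\<^sup>2))"
      by (intro add_left_mono add_right_mono mult_left_mono A) auto
    also have "\<dots> = ?h + (ennreal (4 * c / ?w) * (?h + ennreal ?k) + ennreal 2 * ennreal ?k)"
    proof -
      define q where "q = 2 * c * r powr (?n - N) / V"
      have q0: "q \<ge> 0" using c V by (simp add: q_def)
      have pw: "r powr (?n - N) = r powr ?n * r powr (-N)" by (simp add: powr_add[symmetric])
      have q: "q = 2 * c / ?w * r powr (-N)"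
        using r w by (simp add: q_def V_def pw powr_realpow)
      have e1: "q * (2 * r powr N) = 4 * c / ?w"
        using r by (simp add: q powr_minus)
      have e2: "q * (2 * K\<^sup>2) = 4 * c / ?w * ?k" by (simp add: q)
      have "ennreal q * (ennreal (2 * r powr N) * ?h + 2 * ennreal (K\<^sup>2)) = ennreal (q * (2 * r powr N)) * ?h + ennreal (q * (2 * K\<^sup>2))"
        using q0 by (simp add: distrib_left mult.assoc[symmetric] ennreal_mult)
      also have "\<dots> = ennreal (4 * c / ?w) * (?h + ennreal ?k)"
      proof -
        have "ennreal z * X + ennreal (z * k) = ennreal z * (X + ennreal k)" if "0 \<le> z" for z k X
          using that by (simp add: distrib_left ennreal_mult')
        moreover have "0 \<le> 4 * c / ?w" using c by simp
        ultimately show ?thesis unfolding e1 e2 by blast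
      qed
      finally show ?thesis unfolding q_def by (simp add: ennreal_mult mult.assoc)
    qed
    also have "\<dots> \<le> 3 * (?h + ennreal ?k) + ennreal (4 * c / ?w) * (?h + ennreal ?k)"
    proof -
      define X where "X = ?h + ennreal ?k"
      have "?h + ennreal 2 * ennreal ?k \<le> 1 * X + 2 * X"
        unfolding X_def by (intro add_mono) (auto intro: mult_left_mono)
      also have "\<dots> = (1 + 2) * X" by (simp only: distrib_right)
      also have "(1 + 2 :: ennreal) = 3" by simp
      finally have "?h + ennreal 2 * ennreal ?k + ennreal (4 * c / ?w) * X \<le> 3 * X + ennreal (4 * c / ?w) * X" by (rule add_right_mono)
      then show ?thesis unfolding X_def by (simp add: add_ac)
    qed
    also have "\<dots> = ennreal C * (?h + ennreal ?k)"
      using c w unfolding C_def by (simp add: distrib_right add.commute)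
    finally show ?thesis .
  qed
  then show ?thesis using C by blast
qed

text \<open>\<open>K\<close> is a common bound for the two norms, so that the right-hand side is one
  power of \<open>K\<close> and the exponents arising from the energy and from the choice of scales
  add up to \<open>p\<close>.\<close>

lemma gamma_Lp_bound:
  fixes \<alpha> N lam :: real
  assumes n: "DIM('a::euclidean_space) \<ge> 2" and \<alpha>: "0 < \<alpha>" "\<alpha> < 1" and N: "N = DIM('a) + 2 * \<alpha>" and lam: "lam > 0"
  shows "\<exists>p c. 2 < p \<and> 0 < c \<and> (\<forall>A (u::'a \<Rightarrow> complex) f K. A \<in> borel_measurable borel \<longrightarrow> u \<in> borel_measurable borel \<longrightarrow> f \<in> borel_measurable borel \<longrightarrow>
    (AE z in lborel. lam \<le> Re (A z) \<and> cmod (A z) \<le> 1 / lam) \<longrightarrow>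
    gagliardo N u < \<infinity> \<longrightarrow> weak_on_sobolev N A f u \<longrightarrow>
    0 < K \<longrightarrow> l2sq u \<le> ennreal (K\<^sup>2) \<longrightarrow> l2sq f \<le> ennreal (K\<^sup>2) \<longrightarrow>
    (\<integral>\<^sup>+x. ennpowr (gamma_sq N u x) (p / 2) \<partial>lborel) \<le> ennreal (c * K powr p))"
proof -
  have Nn: "N > 0" using \<alpha> by (simp add: N add_nonneg_pos)
  obtain C where C: "C > 0" and cac: "\<And>A (u::'a \<Rightarrow> complex) f r. A \<in> borel_measurable borel \<Longrightarrow> u \<in> borel_measurable borel \<Longrightarrow> f \<in> borel_measurable borel \<Longrightarrow>
    (AE z in lborel. lam \<le> Re (A z) \<and> cmod (A z) \<le> 1 / lam) \<Longrightarrow>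
    l2sq u < \<infinity> \<Longrightarrow> gagliardo N u < \<infinity> \<Longrightarrow> weak_on_sobolev N A f u \<Longrightarrow> 0 < r \<Longrightarrow>
    energy (near N r) u
      \<le> ennreal C * (energy (damped \<alpha> N r) u + ennreal (r powr (2 * \<alpha>)) * l2sq f)"
    using caccioppoli_scale[OF n \<alpha> N lam] by blast
  obtain C2 where C2: "C2 > 0" and gsb: "\<And>(u::'a \<Rightarrow> complex) K r x. u \<in> borel_measurable borel \<Longrightarrow> l2sq u \<le> ennreal (K\<^sup>2) \<Longrightarrow> 0 < r \<Longrightarrow>
    (gamma_sq N u x)
    \<le> ennreal C2 * ((\<integral>\<^sup>+y. ennreal (near N r (dist x y) * (cmod (u x - u y))\<^sup>2) \<partial>lborel) + ennreal (r powr (-N) * K\<^sup>2))"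
    using gamma_scale_bound[OF \<alpha>(1) N] by blast
  define \<epsilon> where "\<epsilon> = min (\<alpha> / 4) (\<alpha> / (8 * C))"
  have \<epsilon>: "0 < \<epsilon>" "\<epsilon> \<le> \<alpha> / 4" "\<epsilon> \<le> \<alpha> / (8 * C)" using \<alpha> C by (auto simp: \<epsilon>_def)
  define p where "p = 2 + 4 * \<epsilon> / N"
  have p: "p > 2" using \<epsilon> Nn by (simp add: p_def)
  have p2: "p / 2 = 1 + 2 * \<epsilon> / N" by (simp add: p_def field_simps)
  define c0 where "c0 = (2 * C2) powr (2 * \<epsilon> / N) * (1 + 2 * C2)"
  have c0: "c0 > 0" using C2 by (simp add: c0_def)
  \<comment> \<open>The gained energy is at most \<open>3 * ?E + l2sq f\<close>, and one more
    \<open>?E\<close> comes from \<open>?g\<close>. As \<open>?E\<close> is at most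
    \<open>2 * K\<^sup>2 / lam\<close>, the sum is at most
    \<open>(8 / lam + 1) * K\<^sup>2\<close>.\<close>
  define c where "c = c0 * (8 / lam + 1)"
  have c: "c > 0" using c0 lam by (simp add: c_def add_pos_pos)
  have "(\<integral>\<^sup>+x. ennpowr (gamma_sq N u x) (p / 2) \<partial>lborel) \<le> ennreal (c * K powr p)"
    if [measurable]: "A \<in> borel_measurable borel" "u \<in> borel_measurable borel" "f \<in> borel_measurable borel"
      and A: "AE z in lborel. lam \<le> Re (A z) \<and> cmod (A z) \<le> 1 / lam"
      and ufin: "gagliardo N u < \<infinity>" and w: "weak_on_sobolev N A f u"
      and K: "0 < K" "l2sq u \<le> ennreal (K\<^sup>2)" "l2sq f \<le> ennreal (K\<^sup>2)" for A and u f :: "'a \<Rightarrow> complex" and K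
  proof -
    have u2: "l2sq u < \<infinity>" using K by (auto intro: le_less_trans)
    let ?E = "gagliardo N u"
    let ?d = "\<lambda>z::'a\<times>'a. dist (fst z) (snd z)"
    let ?s = "\<lambda>z. ?d z powr (-N) * (cmod (u (fst z) - u (snd z)))\<^sup>2"
    have sm[measurable]: "?s \<in> borel_measurable borel" by (rule energy_density_measurable) measurable
    have dm[measurable]: "?d \<in> borel_measurable borel"
    proof -
      have "?d \<in> borel_measurable (borel \<Otimes>\<^sub>M borel)" by measurable
      then show ?thesis by (simp add: borel_prod)
    qed
    \<comment> \<open>With the Gagliardo density as a measure on pairs, every energy with an extra
      radial factor is the integral of a function of the distance, the setting of
      \<open>hole_filling_gain\<close>. The measure is finite because the energy is.\<close>
    define M where "M = density lborel (\<lambda>z. ennreal (?s z))"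
    have Mi: "(\<integral>\<^sup>+z. ennreal (q (?d z)) \<partial>M) = energy (\<lambda>t. q t * t powr (-N)) u"
      if [measurable]: "q \<in> borel_measurable borel" and q: "\<And>t. 0 \<le> q t" for q :: "real \<Rightarrow> real"
    proof -
      have "(\<integral>\<^sup>+z. ennreal (q (?d z)) \<partial>M) = (\<integral>\<^sup>+z. ennreal (?s z) * ennreal (q (?d z)) \<partial>lborel)"
        unfolding M_def by (subst nn_integral_density) auto
      also have "\<dots> = (\<integral>\<^sup>+z. ennreal (q (?d z) * ?d z powr (-N) * (cmod (u (fst z) - u (snd z)))\<^sup>2) \<partial>lborel)"
        using q by (intro nn_integral_cong) (simp add: ennreal_mult[symmetric] mult_ac)
      also have "\<dots> = energy (\<lambda>t. q t * t powr (-N)) u"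
        by (rule energy_eq_prod[symmetric]) measurable
      finally show ?thesis .
    qed
    have ME: "emeasure M (space M) = ?E"
    proof -
      have "(\<integral>\<^sup>+z. ennreal 1 \<partial>M) = energy (\<lambda>t. 1 * t powr (-N)) u" by (rule Mi) auto
      then show ?thesis by simp
    qed
    have fM: "finite_measure M" by (rule finite_measureI) (use ME ufin in auto)
    have "(\<integral>\<^sup>+z. ennreal (if 0 < ?d z \<and> ?d z < 1 then ?d z powr (-2 * \<epsilon>) else 0) \<partial>M) \<le> 3 * emeasure M (space M) + l2sq f"
    proof (rule hole_filling_gain[OF fM _ _ \<alpha>(1) C \<epsilon>])
      show "?d \<in> borel_measurable M" unfolding M_def by simp
      fix r :: real assume r: "0 < r"
      have "(\<integral>\<^sup>+z. ennreal (if ?d z < r then 1 else 0) \<partial>M) = energy (\<lambda>t. (if t < r then 1 else 0) * t powr (-N)) u"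
        by (rule Mi) auto
      also have "\<dots> = energy (near N r) u"
        by (intro arg_cong[where f = "\<lambda>k. energy k u"]) auto
      also have "\<dots> \<le> ennreal C * (energy (damped \<alpha> N r) u + ennreal (r powr (2 * \<alpha>)) * l2sq f)"
        by (rule cac[of A]) (use A u2 ufin w r in auto)
      also have "energy (damped \<alpha> N r) u = energy (\<lambda>t. (if r \<le> t then (t / r) powr (-\<alpha>) else 0) * t powr (-N)) u"
        by (intro arg_cong[where f = "\<lambda>k. energy k u"]) auto
      also have "\<dots> = (\<integral>\<^sup>+z. ennreal (if r \<le> ?d z then (?d z / r) powr (-\<alpha>) else 0) \<partial>M)"
        by (rule Mi[symmetric]) auto
      finally show "(\<integral>\<^sup>+z. ennreal (if ?d z < r then 1 else 0) \<partial>M)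
        \<le> ennreal C * ((\<integral>\<^sup>+z. ennreal (if r \<le> ?d z then (?d z / r) powr (-\<alpha>) else 0) \<partial>M) + ennreal (r powr (2 * \<alpha>)) * l2sq f)" .
    qed auto
    also have "(\<integral>\<^sup>+z. ennreal (if 0 < ?d z \<and> ?d z < 1 then ?d z powr (-2 * \<epsilon>) else 0) \<partial>M)
       = energy (\<lambda>t. (if 0 < t \<and> t < 1 then t powr (-2 * \<epsilon>) else 0) * t powr (-N)) u"
      by (rule Mi) auto
    finally have gain: "energy (\<lambda>t. (if 0 < t \<and> t < 1 then t powr (-2 * \<epsilon>) else 0) * t powr (-N)) u \<le> 3 * ?E + l2sq f"
      unfolding ME .
    let ?g = "\<lambda>x. gamma_sq N u x"
    \<comment> \<open>\<open>?H\<close> is the inner integral of the gained energy, so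
      \<open>gain\<close> controls its integral. At every scale \<open>r \<le> 1\<close> it
      dominates the near part up to the factor \<open>r powr (2 * \<epsilon>)\<close>, because
      \<open>dist x y < r\<close> there.\<close>
    let ?H = "\<lambda>x. \<integral>\<^sup>+y. ennreal ((if 0 < dist x y \<and> dist x y < 1 then dist x y powr (-2 * \<epsilon>) else 0) * dist x y powr (-N) * (cmod (u x - u y))\<^sup>2) \<partial>lborel"
    let ?h = "\<lambda>r x. \<integral>\<^sup>+y. ennreal (near N r (dist x y) * (cmod (u x - u y))\<^sup>2) \<partial>lborel"
    have pt: "ennpowr (?g x) (p / 2) \<le> ennreal (c0 * K powr (4 * \<epsilon> / N)) * (?H x + ?g x)" for x
      unfolding p2 c0_def
    proof (rule ennpowr_bound_of_scales[OF C2 K(1) Nn \<epsilon>(1), where h = "\<lambda>r. ?h r x"])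
      fix r :: real assume r: "0 < r" "r \<le> 1"
      show "?g x \<le> ennreal C2 * (?h r x + ennreal (r powr (-N) * K\<^sup>2))" by (rule gsb) (use K r in auto)
      have "?h r x \<le> (\<integral>\<^sup>+y. ennreal (r powr (2 * \<epsilon>)) * ennreal ((if 0 < dist x y \<and> dist x y < 1 then dist x y powr (-2 * \<epsilon>) else 0) * dist x y powr (-N) * (cmod (u x - u y))\<^sup>2) \<partial>lborel)"
      proof (intro nn_integral_mono)
        fix y
        show "ennreal (near N r (dist x y) * (cmod (u x - u y))\<^sup>2)
          \<le> ennreal (r powr (2 * \<epsilon>)) * ennreal ((if 0 < dist x y \<and> dist x y < 1 then dist x y powr (-2 * \<epsilon>) else 0) * dist x y powr (-N) * (cmod (u x - u y))\<^sup>2)"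
        proof (cases "dist x y < r \<and> x \<noteq> y")
          case True
          have "r powr (-2 * \<epsilon>) \<le> dist x y powr (-2 * \<epsilon>)" using True \<epsilon> by (intro powr_mono2') auto
          then have "r powr (2 * \<epsilon>) * r powr (-2 * \<epsilon>) \<le> r powr (2 * \<epsilon>) * dist x y powr (-2 * \<epsilon>)"
            by (intro mult_left_mono) auto
          then have "1 \<le> r powr (2 * \<epsilon>) * dist x y powr (-2 * \<epsilon>)" using r by (simp add: powr_add[symmetric])
          then have "1 * (dist x y powr (-N) * (cmod (u x - u y))\<^sup>2) \<le> r powr (2 * \<epsilon>) * dist x y powr (-2 * \<epsilon>) * (dist x y powr (-N) * (cmod (u x - u y))\<^sup>2)"
            by (intro mult_right_mono) auto
          then show ?thesis using True r by (simp add: ennreal_mult[symmetric] mult.assoc ennreal_leI)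
        qed auto
      qed
      also have "\<dots> = ennreal (r powr (2 * \<epsilon>)) * ?H x" by (simp add: nn_integral_cmult)
      finally show "?h r x \<le> ennreal (r powr (2 * \<epsilon>)) * ?H x" .
    qed
    have "(\<integral>\<^sup>+x. ennpowr (?g x) (p / 2) \<partial>lborel) \<le> (\<integral>\<^sup>+x. ennreal (c0 * K powr (4 * \<epsilon> / N)) * (?H x + ?g x) \<partial>lborel)"
      by (intro nn_integral_mono pt)
    also have "\<dots> = ennreal (c0 * K powr (4 * \<epsilon> / N)) * (energy (\<lambda>t. (if 0 < t \<and> t < 1 then t powr (-2 * \<epsilon>) else 0) * t powr (-N)) u + ?E)"
      unfolding energy_def by (simp add: nn_integral_cmult nn_integral_add)
    also have "\<dots> \<le> ennreal (c0 * K powr (4 * \<epsilon> / N)) * ((3 * ?E + l2sq f) + ?E)"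
      by (intro mult_left_mono add_right_mono gain) auto
    also have "\<dots> \<le> ennreal (c0 * K powr (4 * \<epsilon> / N)) * ennreal ((8 / lam + 1) * K\<^sup>2)"
    proof (rule mult_left_mono)
      obtain e where e: "?E = ennreal e" "0 \<le> e" using ufin by (cases ?E) auto
      obtain f' where f': "l2sq f = ennreal f'" "0 \<le> f'" using K by (cases "l2sq f") (auto simp: top_unique)
      obtain u' where u': "l2sq u = ennreal u'" "0 \<le> u'" using u2 by (cases "l2sq u") auto
      have "ennreal lam * ?E \<le> l2sq f + l2sq u"
        by (rule energy_bound[of A]) (use A lam u2 ufin w in auto)
      then have "lam * e \<le> f' + u'" using e f' u' lam
        by (simp add: ennreal_mult[symmetric] ennreal_plus[symmetric] del: ennreal_plus)
      moreover have fK: "f' \<le> K\<^sup>2" "u' \<le> K\<^sup>2" using K f' u' by auto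
      ultimately have "e \<le> 2 * K\<^sup>2 / lam" using lam by (simp add: field_simps)
      then have "4 * e + f' \<le> (8 / lam + 1) * K\<^sup>2" using fK by (simp add: algebra_simps)
      then have "ennreal (4 * e + f') \<le> ennreal ((8 / lam + 1) * K\<^sup>2)" by (rule ennreal_leI)
      moreover have "3 * ?E + l2sq f + ?E = ennreal (4 * e + f')"
        unfolding e f' using e f' by (simp add: ennreal_plus[symmetric] ennreal_mult[symmetric] ennreal_numeral[symmetric] del: ennreal_plus ennreal_numeral)
      ultimately show "3 * ?E + l2sq f + ?E \<le> ennreal ((8 / lam + 1) * K\<^sup>2)" by simp
    qed simp
    also have "\<dots> = ennreal (c0 * K powr (4 * \<epsilon> / N) * ((8 / lam + 1) * K\<^sup>2))"
      using c0 lam by (simp add: ennreal_mult)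
    also have "c0 * K powr (4 * \<epsilon> / N) * ((8 / lam + 1) * K\<^sup>2) = c * (K powr (4 * \<epsilon> / N) * K powr 2)"
      using K by (simp add: c_def mult_ac)
    also have "K powr (4 * \<epsilon> / N) * K powr 2 = K powr p" by (simp only: p_def powr_add mult.commute)
    finally show ?thesis .
  qed
  then show ?thesis using p c by blast
qed

section \<open>Smooth bump functions\<close>

text \<open>The usual flat function \<open>exp (- 1 / t)\<close>, divided by powers of
  \<open>t\<close> so that the family is closed under differentiation up to linear combinations. All
  derivatives are thus handled by one formula in \<open>k\<close>.\<close>

definition flat_exp :: "nat \<Rightarrow> real \<Rightarrow> real" where
  "flat_exp k t = (if t > 0 then exp (- (1 / t)) / t ^ k else 0)"

text \<open>The difference quotient at the junction point. On the right the substitution of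
  \<open>1 / t\<close> for \<open>t\<close> reduces it to the exponential outgrowing every
  power.\<close>

lemma flat_exp_quotient_tendsto_0: "((\<lambda>t. flat_exp k t / t) \<longlongrightarrow> 0) (at 0)"
proof -
  have "((\<lambda>t::real. exp (- (1 / t)) / t ^ (k + 1)) \<longlongrightarrow> 0) (at_right 0)"
    unfolding filterlim_at_right_to_top
    by (simp add: power_one_over inverse_eq_divide exp_minus divide_simps)
      (use tendsto_power_div_exp_0[of "Suc k"] in \<open>simp add: mult.commute\<close>)
  then have r: "((\<lambda>t. flat_exp k t / t) \<longlongrightarrow> 0) (at_right 0)"
    by (rule Lim_transform_eventually) (auto simp: flat_exp_def eventually_at_right_less mult.commute intro!: eventually_mono[OF eventually_at_right_less])
  have l: "((\<lambda>t. flat_exp k t / t) \<longlongrightarrow> 0) (at_left 0)"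
    by (rule Lim_transform_eventually[OF tendsto_const])
      (auto simp: flat_exp_def eventually_at_filter)
  show ?thesis using l r by (simp add: filterlim_at_split)
qed

lemma flat_exp_has_derivative:
  "(flat_exp k has_real_derivative flat_exp (k + 2) t - real k * flat_exp (k + 1) t) (at t)"
proof -
  consider "t > 0" | "t < 0" | "t = 0" by linarith
  then show ?thesis
  proof cases
    case 1
    have "((\<lambda>t. exp (- (1 / t)) / t ^ k) has_real_derivative flat_exp (k + 2) t - real k * flat_exp (k + 1) t) (at t)"
    \<comment> \<open>The case \<open>k = 0\<close> is separate because the power rule yields
      \<open>t ^ (k - 1)\<close> with truncated subtraction.\<close>
    proof (cases k)
      case 0
      then show ?thesis using 1 by (auto intro!: derivative_eq_intros simp: flat_exp_def field_simps power2_eq_square)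
    next
      case (Suc m)
      have "((\<lambda>t. exp (- (1 / t)) / t ^ k) has_real_derivative
          (exp (- (1 / t)) * (1 / t\<^sup>2) * t ^ k - exp (- (1 / t)) * (real k * t ^ (k - 1))) / (t ^ k * t ^ k)) (at t)"
        using 1 by (auto intro!: derivative_eq_intros simp: field_simps power2_eq_square)
      also have "(exp (- (1 / t)) * (1 / t\<^sup>2) * t ^ k - exp (- (1 / t)) * (real k * t ^ (k - 1))) / (t ^ k * t ^ k)
        = flat_exp (k + 2) t - real k * flat_exp (k + 1) t"
        using 1 Suc by (simp add: flat_exp_def field_simps power2_eq_square)
      finally show ?thesis .
    qed
    then show ?thesis
      by (rule has_field_derivative_transform_within_open[where S = "{0<..}"]) (use 1 in \<open>auto simp: flat_exp_def\<close>)
  next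
    case 2
    have "((\<lambda>t. 0) has_real_derivative flat_exp (k + 2) t - real k * flat_exp (k + 1) t) (at t)"
      using 2 by (simp add: flat_exp_def)
    then show ?thesis
      by (rule has_field_derivative_transform_within_open[where S = "{..<0}"]) (use 2 in \<open>auto simp: flat_exp_def\<close>)
  next
    case 3
    then show ?thesis
      using flat_exp_quotient_tendsto_0[of k] by (simp add: has_field_derivative_iff flat_exp_def)
  qed
qed

lemma flat_exp_nonneg: "0 \<le> flat_exp k t" by (simp add: flat_exp_def)

section \<open>Smoothness through classes closed under partial derivatives\<close>

definition has_grad :: "(real ^ 'n \<Rightarrow> complex) \<Rightarrow> ('n::finite \<Rightarrow> real ^ 'n \<Rightarrow> complex) \<Rightarrow> bool" where
  "has_grad f G \<longleftrightarrow> (\<forall>x. (f has_derivative (\<lambda>h. \<Sum>i\<in>UNIV. of_real (h $ i) * G i x)) (at x))"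

lemma has_grad_frechet:
  assumes "has_grad f G"
  shows "frechet_derivative f (at x) (axis i 1) = G i x"
proof -
  have "frechet_derivative f (at x) = (\<lambda>h. \<Sum>i\<in>UNIV. of_real (h $ i) * G i x)"
    using assms by (intro frechet_derivative_at[symmetric]) (simp add: has_grad_def)
  moreover have "(\<Sum>j\<in>UNIV. of_real (axis i 1 $ j) * G j x) = (\<Sum>j\<in>UNIV. if j = i then G j x else 0)"
    by (intro sum.cong) (auto simp: axis_def)
  ultimately show ?thesis by simp
qed

text \<open>Any set of functions closed under taking gradients consists of smooth functions, so
  smoothness reduces to one closure property. It is applied to the bumps and to their convolutions
  with a fixed function.\<close>

lemma Ck_function_of_class:
  assumes S: "\<And>f. f \<in> S \<Longrightarrow> \<exists>G. (\<forall>i. G i \<in> S) \<and> has_grad f G" and f: "f \<in> S"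
  shows "Ck_function k f"
  using f
proof (induction k arbitrary: f)
  case 0
  from S[OF 0] have "\<forall>x. f differentiable at x" unfolding has_grad_def differentiable_def by blast
  then show ?case by (auto intro!: differentiable_imp_continuous_on simp: differentiable_on_def)
next
  case (Suc k)
  from S[OF Suc.prems] obtain G where G: "\<And>i. G i \<in> S" "has_grad f G" by blast
  have "\<forall>x. f differentiable at x" using G(2) unfolding has_grad_def differentiable_def by blast
  moreover have "(\<lambda>x. frechet_derivative f (at x) (axis i 1)) = G i" for i
    using has_grad_frechet[OF G(2)] by auto
  ultimately show ?case using Suc.IH G(1) by simp
qed

text \<open>A class closed under partial derivatives; this replaces a calculus of smooth functions.\<close>

inductive_set bump_class :: "real \<Rightarrow> real \<Rightarrow> (real ^ 'n::finite \<Rightarrow> complex) set" for a b :: real where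
  base: "(\<lambda>x. of_real (flat_exp k (a - b * (norm x)\<^sup>2))) \<in> bump_class a b"
| coord: "f \<in> bump_class a b \<Longrightarrow> (\<lambda>x. of_real (x $ i) * f x) \<in> bump_class a b"
| scale: "f \<in> bump_class a b \<Longrightarrow> (\<lambda>x. c * f x) \<in> bump_class a b"
| add: "f \<in> bump_class a b \<Longrightarrow> g \<in> bump_class a b \<Longrightarrow> (\<lambda>x. f x + g x) \<in> bump_class a b"

lemma bump_class_grad:
  assumes "f \<in> bump_class a b"
  shows "\<exists>G. (\<forall>i. G i \<in> bump_class a b) \<and> has_grad f G"
  using assms
proof induction
  case (base k)
  let ?e = "\<lambda>k x. of_real (flat_exp k (a - b * (norm x)\<^sup>2)) :: complex"
  \<comment> \<open>Chain rule: the inner derivative is \<open>-2 * b * x $ i\<close>, and the outer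
    one raises the index of \<open>flat_exp\<close> by two and by one. Each piece is generated by
    the rules of the class.\<close>
  let ?G = "\<lambda>i x. of_real (x $ i) * (of_real (-2 * b) * (?e (k + 2) x + (- of_nat k) * ?e (k + 1) x))"
  have "?G i \<in> bump_class a b" for i
    by (intro bump_class.intros)
  moreover have "has_grad (?e k) ?G"
    unfolding has_grad_def
  proof
    fix x :: "real ^ 'n"
    let ?D = "flat_exp (k + 2) (a - b * (norm x)\<^sup>2) - real k * flat_exp (k + 1) (a - b * (norm x)\<^sup>2)"
    have 1: "((\<lambda>x::real^'n. a - b * (x \<bullet> x)) has_derivative (\<lambda>h. - (b * (2 * (x \<bullet> h))))) (at x)"
      by (auto intro!: derivative_eq_intros simp: inner_commute)
    have "(flat_exp k has_derivative (\<lambda>h. ?D * h)) (at (a - b * (x \<bullet> x)))"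
      using flat_exp_has_derivative[of k "a - b * (x \<bullet> x)"]
      by (simp add: has_field_derivative_def power2_norm_eq_inner)
    from has_derivative_compose[OF 1 this]
    have "((\<lambda>x::real^'n. flat_exp k (a - b * (norm x)\<^sup>2)) has_derivative (\<lambda>h. ?D * (- (b * (2 * (x \<bullet> h)))))) (at x)"
      by (simp add: power2_norm_eq_inner)
    then have "(?e k has_derivative (\<lambda>h. of_real (?D * (- (b * (2 * (x \<bullet> h))))))) (at x)"
      by (rule has_derivative_of_real)
    moreover have "of_real (?D * (- (b * (2 * (x \<bullet> h))))) = (\<Sum>i\<in>UNIV. of_real (h $ i) * ?G i x)" for h
    proof -
      have "x \<bullet> h = (\<Sum>i\<in>UNIV. h $ i * x $ i)" by (simp add: inner_vec_def mult.commute)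
      then have "(of_real (?D * (- (b * (2 * (x \<bullet> h))))) :: complex) = of_real (?D * (-2 * b)) * (\<Sum>i\<in>UNIV. of_real (h $ i) * of_real (x $ i))"
        by simp
      also have "\<dots> = (\<Sum>i\<in>UNIV. of_real (h $ i) * ?G i x)"
        unfolding sum_distrib_left by (intro sum.cong) (simp_all add: algebra_simps)
      finally show ?thesis .
    qed
    ultimately show "(?e k has_derivative (\<lambda>h. \<Sum>i\<in>UNIV. of_real (h $ i) * ?G i x)) (at x)" by simp
  qed
  ultimately show ?case by (intro exI[of _ ?G]) blast
next
  case (coord f j)
  then obtain G where G: "\<And>i. G i \<in> bump_class a b" "has_grad f G" by blast
  let ?G = "\<lambda>i x. of_real (x $ j) * G i x + (if i = j then 1 else 0) * f x"
  have "?G i \<in> bump_class a b" for i by (intro bump_class.intros G coord)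
  moreover have "has_grad (\<lambda>x. of_real (x $ j) * f x) ?G"
    unfolding has_grad_def
  proof
    fix x
    have 1: "((\<lambda>x. of_real (x $ j) :: complex) has_derivative (\<lambda>h. of_real (h $ j))) (at x)"
      by (intro has_derivative_of_real bounded_linear_imp_has_derivative bounded_linear_vec_nth)
    have 2: "(f has_derivative (\<lambda>h. \<Sum>i\<in>UNIV. of_real (h $ i) * G i x)) (at x)"
      using G(2) by (simp add: has_grad_def)
    have "of_real (x $ j) * (\<Sum>i\<in>UNIV. of_real (h $ i) * G i x) + of_real (h $ j) * f x = (\<Sum>i\<in>UNIV. of_real (h $ i) * ?G i x)" for h
    proof -
      have "(\<Sum>i\<in>UNIV. of_real (h $ i) * ?G i x) = (\<Sum>i\<in>UNIV. of_real (x $ j) * (of_real (h $ i) * G i x)) + (\<Sum>i\<in>UNIV. if i = j then of_real (h $ i) * f x else 0)"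
        unfolding sum.distrib[symmetric] by (intro sum.cong) (auto simp: algebra_simps)
      then show ?thesis by (simp add: sum_distrib_left)
    qed
    then show "((\<lambda>x. of_real (x $ j) * f x) has_derivative (\<lambda>h. \<Sum>i\<in>UNIV. of_real (h $ i) * ?G i x)) (at x)"
      using has_derivative_mult[OF 1 2] by simp
  qed
  ultimately show ?case by (intro exI[of _ ?G]) blast
next
  case (scale f c)
  then obtain G where G: "\<And>i. G i \<in> bump_class a b" "has_grad f G" by blast
  have "has_grad (\<lambda>x. c * f x) (\<lambda>i x. c * G i x)"
    unfolding has_grad_def
  proof
    fix x
    have "((\<lambda>x. c * f x) has_derivative (\<lambda>h. c * (\<Sum>i\<in>UNIV. of_real (h $ i) * G i x))) (at x)"
      using G(2) by (intro has_derivative_mult_right) (simp add: has_grad_def)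
    then show "((\<lambda>x. c * f x) has_derivative (\<lambda>h. \<Sum>i\<in>UNIV. of_real (h $ i) * (c * G i x))) (at x)"
      by (simp add: sum_distrib_left mult.left_commute)
  qed
  then show ?case using bump_class.scale[OF G(1)] by (intro exI[of _ "\<lambda>i x. c * G i x"]) blast
next
  case (add f g)
  then obtain G G' where G: "\<And>i. G i \<in> bump_class a b" "has_grad f G" "\<And>i. G' i \<in> bump_class a b" "has_grad g G'" by blast
  have "has_grad (\<lambda>x. f x + g x) (\<lambda>i x. G i x + G' i x)"
    unfolding has_grad_def
  proof
    fix x
    have "((\<lambda>x. f x + g x) has_derivative (\<lambda>h. (\<Sum>i\<in>UNIV. of_real (h $ i) * G i x) + (\<Sum>i\<in>UNIV. of_real (h $ i) * G' i x))) (at x)"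
      using G by (intro has_derivative_add) (simp_all add: has_grad_def)
    then show "((\<lambda>x. f x + g x) has_derivative (\<lambda>h. \<Sum>i\<in>UNIV. of_real (h $ i) * (G i x + G' i x))) (at x)"
      by (simp add: sum.distrib distrib_left)
  qed
  then show ?case using bump_class.add[OF G(1) G(3)] by (intro exI[of _ "\<lambda>i x. G i x + G' i x"]) blast
qed

text \<open>The base functions vanish there and the closure rules preserve zeros, so the whole
  class, including all partial derivatives, lives on the set where
  \<open>b * (norm x)\<^sup>2 < a\<close>.\<close>

lemma bump_class_zero:
  assumes "f \<in> bump_class a b" "a \<le> b * (norm x)\<^sup>2"
  shows "f x = 0"
  using assms by induction (auto simp: flat_exp_def)

lemma bump_class_support:
  fixes f :: "real ^ 'n::finite \<Rightarrow> complex"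
  assumes f: "f \<in> bump_class a b" and b: "0 < b"
  shows "\<exists>R. \<forall>x. R < norm x \<longrightarrow> f x = 0"
proof (intro exI allI impI)
  fix x :: "real ^ 'n" assume x: "sqrt (\<bar>a\<bar> / b) < norm x"
  have "(sqrt (\<bar>a\<bar> / b))\<^sup>2 \<le> (norm x)\<^sup>2" using x b by (intro power_mono) auto
  then have "\<bar>a\<bar> / b \<le> (norm x)\<^sup>2" using b by simp
  then have "a \<le> b * (norm x)\<^sup>2" using b by (simp add: field_simps)
  then show "f x = 0" by (rule bump_class_zero[OF f])
qed

lemma bump_class_continuous:
  assumes "f \<in> bump_class a b"
  shows "continuous_on UNIV f"
proof -
  have "Ck_function 0 f"
    by (rule Ck_function_of_class[of "bump_class a b"]) (use bump_class_grad assms in blast)+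
  then show ?thesis by simp
qed

lemma bump_class_bounded:
  assumes f: "f \<in> bump_class a b" and ab: "0 < b"
  shows "\<exists>B\<ge>0. \<forall>x. cmod (f x) \<le> B"
proof -
  obtain R where z: "\<And>x. norm x > R \<Longrightarrow> f x = 0" using bump_class_support[OF f ab] by blast
  have "compact (f ` cball 0 R)"
    by (intro compact_continuous_image continuous_on_subset[OF bump_class_continuous[OF f]]) auto
  then obtain B where B: "\<forall>y\<in>f ` cball 0 R. norm y \<le> B"
    using compact_imp_bounded bounded_iff by blast
  have "cmod (f x) \<le> max B 0" for x
  proof (cases "norm x > R")
    case False
    then have "f x \<in> f ` cball 0 R" by simp
    then have "cmod (f x) \<le> B" using B by blast
    then show ?thesis by simp
  qed (simp add: z)
  then show ?thesis by (intro exI[of _ "max B 0"]) auto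
qed

lemma grad_sum_bound:
  fixes h :: "real ^ 'n::finite"
  assumes "\<And>i. cmod (c i) \<le> B" "0 \<le> B"
  shows "cmod (\<Sum>i\<in>UNIV. of_real (h $ i) * c i) \<le> real CARD('n) * B * norm h"
proof -
  have "cmod (\<Sum>i\<in>UNIV. of_real (h $ i) * c i) \<le> (\<Sum>i\<in>(UNIV::'n set). norm h * B)"
    by (intro sum_norm_le) (auto simp: norm_mult intro!: mult_mono component_le_norm_cart assms)
  then show ?thesis by (simp add: mult_ac)
qed

lemma bounded_linear_grad:
  fixes c :: "'n::finite \<Rightarrow> complex"
  shows "bounded_linear (\<lambda>h::real^'n. \<Sum>i\<in>UNIV. of_real (h $ i) * c i)"
proof (rule bounded_linear_sum)
  fix i
  have "bounded_linear (\<lambda>h::real^'n. complex_of_real (h $ i))"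
    by (rule bounded_linear_compose[OF bounded_linear_of_real bounded_linear_vec_nth])
  then show "bounded_linear (\<lambda>h::real^'n. of_real (h $ i) * c i)"
    by (rule bounded_linear_mult_const)
qed

lemma bump_class_grad_bounded:
  fixes G :: "'n::finite \<Rightarrow> real ^ 'n \<Rightarrow> complex"
  assumes G: "\<And>i. G i \<in> bump_class a b" and b: "0 < b"
  shows "\<exists>B\<ge>0. \<forall>i x. cmod (G i x) \<le> (B::real)"
proof -
  have "\<forall>i. \<exists>B. 0 \<le> B \<and> (\<forall>x. cmod (G i x) \<le> B)"
    using bump_class_bounded[OF G b] by blast
  then obtain B where B: "\<forall>i. 0 \<le> B i \<and> (\<forall>x. cmod (G i x) \<le> B i)" unfolding choice_iff by blast
  show ?thesis
  proof (intro exI conjI allI)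
    show "0 \<le> (\<Sum>i\<in>UNIV. B i)" using B by (intro sum_nonneg) auto
    fix i x
    have "B i \<le> (\<Sum>i\<in>UNIV. B i)" using B by (intro member_le_sum) auto
    then show "cmod (G i x) \<le> (\<Sum>i\<in>UNIV. B i)" using B order_trans by blast
  qed
qed

lemma bump_class_lipschitz:
  fixes f :: "real ^ 'n::finite \<Rightarrow> complex"
  assumes f: "f \<in> bump_class a b" and b: "0 < b"
  shows "\<exists>L\<ge>0. \<forall>x y. cmod (f x - f y) \<le> L * norm (x - y)"
proof -
  obtain G where G: "\<And>i. G i \<in> bump_class a b" "has_grad f G" using bump_class_grad[OF f] by blast
  obtain B where B: "B \<ge> 0" "\<And>i x. cmod (G i x) \<le> B" using bump_class_grad_bounded[of G, OF G(1) b] by blast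
  have "cmod (f x - f y) \<le> real CARD('n) * B * norm (x - y)" for x y
  proof (rule differentiable_bound[of UNIV f "\<lambda>x h. \<Sum>i\<in>UNIV. of_real (h $ i) * G i x"])
    fix x
    show "(f has_derivative (\<lambda>h. \<Sum>i\<in>UNIV. of_real (h $ i) * G i x)) (at x within UNIV)"
      using G(2) by (simp add: has_grad_def)
    show "onorm (\<lambda>h. \<Sum>i\<in>UNIV. of_real (h $ i) * G i x) \<le> real CARD('n) * B"
      using B by (intro onorm_bound grad_sum_bound) auto
  qed auto
  then show ?thesis using B(1) by (intro exI[of _ "real CARD('n) * B"]) auto
qed

text \<open>The remainder is uniform in \<open>x\<close>, as needed for differentiating a
  convolution with a merely integrable function. The mean value inequality is applied to
  \<open>f\<close> minus its linearisation at \<open>x\<close>, whose derivative on the ball of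
  radius \<open>norm h\<close> is a difference of gradients, hence of order
  \<open>norm h\<close>.\<close>

lemma bump_class_taylor:
  fixes f :: "real ^ 'n::finite \<Rightarrow> complex"
  assumes G: "\<And>i. G i \<in> bump_class a b" "has_grad f G" and b: "0 < b"
  shows "\<exists>L\<ge>0. \<forall>x h. cmod (f (x + h) - f x - (\<Sum>i\<in>UNIV. of_real (h $ i) * G i x)) \<le> L * (norm h)\<^sup>2"
proof -
  have "\<forall>i. \<exists>L. 0 \<le> L \<and> (\<forall>x y. cmod (G i x - G i y) \<le> L * norm (x - y))"
    by (intro allI bump_class_lipschitz[OF G(1) b])
  then obtain L' where "\<forall>i. 0 \<le> L' i \<and> (\<forall>x y. cmod (G i x - G i y) \<le> L' i * norm (x - y))"
    unfolding choice_iff by blast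
  then have L': "\<And>i. L' i \<ge> 0" "\<And>i x y. cmod (G i x - G i y) \<le> L' i * norm (x - y)" by auto
  define L where "L = (\<Sum>i\<in>UNIV. L' i)"
  have LL: "L' i \<le> L" for i unfolding L_def using L'(1) by (intro member_le_sum) auto
  have L0: "L \<ge> 0" unfolding L_def using L'(1) by (intro sum_nonneg)
  have L: "cmod (G i x - G i y) \<le> L * norm (x - y)" for i x y
  proof -
    have "L' i * norm (x - y) \<le> L * norm (x - y)" by (intro mult_right_mono LL) auto
    then show ?thesis using L'(2)[of i x y] by linarith
  qed
  have "cmod (f (x + h) - f x - (\<Sum>i\<in>UNIV. of_real (h $ i) * G i x)) \<le> (real CARD('n) * L) * (norm h)\<^sup>2" for x h
  proof -
    define g where "g y = f y - (\<Sum>i\<in>UNIV. of_real (y $ i) * G i x)" for y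
    have "cmod (g (x + h) - g x) \<le> (real CARD('n) * (L * norm h)) * norm ((x + h) - x)"
    proof (rule differentiable_bound[of "cball x (norm h)" g "\<lambda>y k. (\<Sum>i\<in>UNIV. of_real (k $ i) * (G i y - G i x))"])
      fix y assume y: "y \<in> cball x (norm h)"
      have l: "((\<lambda>y. \<Sum>i\<in>UNIV. of_real (y $ i) * G i x) has_derivative (\<lambda>k. \<Sum>i\<in>UNIV. of_real (k $ i) * G i x)) (at y)"
        by (intro bounded_linear_imp_has_derivative bounded_linear_grad)
      have "(f has_derivative (\<lambda>k. \<Sum>i\<in>UNIV. of_real (k $ i) * G i y)) (at y)"
        using G(2) unfolding has_grad_def by (rule spec)
      from has_derivative_diff[OF this l]
      have "(g has_derivative (\<lambda>k. \<Sum>i\<in>UNIV. of_real (k $ i) * (G i y - G i x))) (at y)"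
        unfolding g_def[abs_def] by (simp only: sum_subtractf right_diff_distrib)
      then show "(g has_derivative (\<lambda>k. \<Sum>i\<in>UNIV. of_real (k $ i) * (G i y - G i x))) (at y within cball x (norm h))"
        by (rule has_derivative_at_withinI)
      have "cmod (G i y - G i x) \<le> L * norm h" for i
      proof -
        have "norm (y - x) \<le> norm h" using y by (simp add: dist_norm norm_minus_commute)
        then have "L * norm (y - x) \<le> L * norm h" using L0 by (rule mult_left_mono)
        then show ?thesis using L[of i y x] by linarith
      qed
      then have "cmod (\<Sum>i\<in>UNIV. of_real (k $ i) * (G i y - G i x)) \<le> real CARD('n) * (L * norm h) * norm k" for k
        using L0 by (intro grad_sum_bound mult_nonneg_nonneg norm_ge_zero)
      then show "onorm (\<lambda>k. \<Sum>i\<in>UNIV. of_real (k $ i) * (G i y - G i x)) \<le> real CARD('n) * (L * norm h)"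
        using L0 by (intro onorm_bound mult_nonneg_nonneg norm_ge_zero of_nat_0_le_iff)
    next
      show "x + h \<in> cball x (norm h)" "x \<in> cball x (norm h)" by (simp_all add: dist_norm)
    qed (rule convex_cball)
    moreover have "g (x + h) - g x = f (x + h) - f x - (\<Sum>i\<in>UNIV. of_real (h $ i) * G i x)"
    proof -
      have "(\<Sum>i\<in>UNIV. of_real ((x + h) $ i) * G i x) = (\<Sum>i\<in>UNIV. of_real (x $ i) * G i x) + (\<Sum>i\<in>UNIV. of_real (h $ i) * G i x)"
        unfolding sum.distrib[symmetric] by (intro sum.cong) (simp_all add: distrib_right)
      then show ?thesis unfolding g_def by (simp only:) simp
    qed
    ultimately have "cmod (f (x + h) - f x - (\<Sum>i\<in>UNIV. of_real (h $ i) * G i x)) \<le> real CARD('n) * (L * norm h) * norm ((x + h) - x)"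
      by (simp only:)
    then show ?thesis by (simp add: power2_eq_square mult.assoc)
  qed
  then show ?thesis using L0 by (intro exI[of _ "real CARD('n) * L"]) auto
qed

section \<open>Convolution of an integrable function with a bump\<close>

definition convolution :: "('a::euclidean_space \<Rightarrow> complex) \<Rightarrow> ('a \<Rightarrow> complex) \<Rightarrow> 'a \<Rightarrow> complex" where
  "convolution \<eta> w x = (\<integral>z. \<eta> (x - z) * w z \<partial>lborel)"

lemma convolution_integrable:
  assumes \<eta>: "\<eta> \<in> bump_class a b" and b: "0 < b" and w: "integrable lborel w"
  shows "integrable lborel (\<lambda>z. \<eta> (x - z) * w z)"
proof -
  obtain B where B: "\<And>x. cmod (\<eta> x) \<le> B" using bump_class_bounded[OF \<eta> b] by blast
  have [measurable]: "\<eta> \<in> borel_measurable borel" "w \<in> borel_measurable borel"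
    using borel_measurable_continuous_onI[OF bump_class_continuous[OF \<eta>]] borel_measurable_integrable[OF w] by auto
  show ?thesis
  proof (rule Bochner_Integration.integrable_bound)
    show "integrable lborel (\<lambda>z. B * cmod (w z))" using w by auto
    show "AE z in lborel. norm (\<eta> (x - z) * w z) \<le> norm (B * cmod (w z))"
    proof (intro AE_I2)
      fix z
      have "cmod (\<eta> (x - z)) * cmod (w z) \<le> B * cmod (w z)" by (intro mult_right_mono B) auto
      also have "\<dots> \<le> norm (B * cmod (w z))" by simp
      finally show "norm (\<eta> (x - z) * w z) \<le> norm (B * cmod (w z))" by (simp add: norm_mult)
    qed
  qed measurable
qed

text \<open>The uniform quadratic remainder is integrated against \<open>cmod (w z)\<close>; this
  yields a remainder of order \<open>(norm h)\<^sup>2\<close> without any passage to the limit under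
  the integral.\<close>

lemma convolution_grad:
  fixes w :: "real ^ 'n::finite \<Rightarrow> complex"
  assumes G: "\<And>i. G i \<in> bump_class a b" "has_grad \<eta> G" "\<eta> \<in> bump_class a b" and b: "0 < b" and w: "integrable lborel w"
  shows "has_grad (convolution \<eta> w) (\<lambda>i. convolution (G i) w)"
  unfolding has_grad_def
proof
  fix x
  obtain L where L0: "L \<ge> 0" and L: "\<And>x h. cmod (\<eta> (x + h) - \<eta> x - (\<Sum>i\<in>UNIV. of_real (h $ i) * G i x)) \<le> L * (norm h)\<^sup>2"
    using bump_class_taylor[OF G(1,2) b] by blast
  define I where "I = (\<integral>z. cmod (w z) \<partial>lborel)"
  have I0: "I \<ge> 0" unfolding I_def by (intro integral_nonneg_AE) auto
  note i = convolution_integrable[OF G(1) b w] convolution_integrable[OF G(3) b w]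
  let ?D = "\<lambda>h. \<Sum>i\<in>UNIV. of_real (h $ i) * convolution (G i) w x"
  have bound: "cmod (convolution \<eta> w (x + h) - convolution \<eta> w x - ?D h) \<le> L * I * (norm h)\<^sup>2" for h
  proof -
    have "convolution \<eta> w (x + h) - convolution \<eta> w x - ?D h = (\<integral>z. \<eta> (x + h - z) * w z - \<eta> (x - z) * w z - (\<Sum>i\<in>UNIV. of_real (h $ i) * (G i (x - z) * w z)) \<partial>lborel)"
      unfolding convolution_def using i by (simp add: Bochner_Integration.integral_diff Bochner_Integration.integral_sum)
    also have "cmod \<dots> \<le> (\<integral>z. L * (norm h)\<^sup>2 * cmod (w z) \<partial>lborel)"
    proof (rule Bochner_Integration.integral_norm_bound_integral)
      show "integrable lborel (\<lambda>z. \<eta> (x + h - z) * w z - \<eta> (x - z) * w z - (\<Sum>i\<in>UNIV. of_real (h $ i) * (G i (x - z) * w z)))"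
        using i by (intro Bochner_Integration.integrable_diff Bochner_Integration.integrable_sum integrable_mult_right) auto
      show "integrable lborel (\<lambda>z. L * (norm h)\<^sup>2 * cmod (w z))" using w by auto
      fix z
      have "\<eta> (x + h - z) * w z - \<eta> (x - z) * w z - (\<Sum>i\<in>UNIV. of_real (h $ i) * (G i (x - z) * w z))
        = (\<eta> ((x - z) + h) - \<eta> (x - z) - (\<Sum>i\<in>UNIV. of_real (h $ i) * G i (x - z))) * w z"
        by (simp add: algebra_simps sum_distrib_right sum_distrib_left)
      then show "cmod (\<eta> (x + h - z) * w z - \<eta> (x - z) * w z - (\<Sum>i\<in>UNIV. of_real (h $ i) * (G i (x - z) * w z))) \<le> L * (norm h)\<^sup>2 * cmod (w z)"
        using mult_right_mono[OF L, of "cmod (w z)"] by (simp add: norm_mult)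
    qed
    also have "\<dots> = L * I * (norm h)\<^sup>2" by (simp add: I_def)
    finally show ?thesis .
  qed
  show "(convolution \<eta> w has_derivative ?D) (at x)"
    unfolding has_derivative_at
  proof
    show "bounded_linear ?D"
      by (rule bounded_linear_grad)
    have t: "((\<lambda>h::real^'n. L * I * norm h) \<longlongrightarrow> 0) (at 0)"
      by (rule tendsto_mult_right_zero[OF tendsto_norm_zero[OF tendsto_ident_at]])
    show "(\<lambda>h. norm (convolution \<eta> w (x + h) - convolution \<eta> w x - ?D h) / norm h) \<midarrow>0\<rightarrow> 0"
    proof (rule Lim_null_comparison[OF _ t], intro always_eventually allI)
      fix h :: "real ^ 'n"
      show "norm (norm (convolution \<eta> w (x + h) - convolution \<eta> w x - ?D h) / norm h) \<le> L * I * norm h"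
        using bound[of h] by (cases "h = 0") (auto simp: field_simps power2_eq_square)
    qed
  qed
qed

lemma convolution_test_function:
  fixes w :: "real ^ 'n::finite \<Rightarrow> complex"
  assumes \<eta>: "\<eta> \<in> bump_class a b" and b: "0 < b" and w: "integrable lborel w" "\<And>x. norm x > R \<Longrightarrow> w x = 0"
  shows "convolution \<eta> w \<in> test_functions"
proof -
  \<comment> \<open>By \<open>convolution_grad\<close> the derivatives fall on the bump, so this
    image is again closed under gradients.\<close>
  let ?S = "(\<lambda>\<eta>. convolution \<eta> w) ` bump_class a b"
  have "Ck_function k (convolution \<eta> w)" for k
  proof (rule Ck_function_of_class[of ?S])
    fix f assume "f \<in> ?S"
    then obtain \<eta> where \<eta>: "\<eta> \<in> bump_class a b" "f = convolution \<eta> w" by blast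
    then show "\<exists>G. (\<forall>i. G i \<in> ?S) \<and> has_grad f G"
      using bump_class_grad[OF \<eta>(1)] convolution_grad[OF _ _ \<eta>(1) b w(1)] by (metis imageI)
  qed (use \<eta> in blast)
  moreover have "compact (closure {x. convolution \<eta> w x \<noteq> 0})"
  proof -
    obtain R' where z: "\<And>x. norm x > R' \<Longrightarrow> \<eta> x = 0" using bump_class_support[OF \<eta> b] by blast
    have "convolution \<eta> w x = 0" if x: "norm x > R + R'" for x
    proof -
      have "\<eta> (x - z) * w z = 0" for z
      proof (cases "norm z > R")
        case False
        then have "norm (x - z) > R'" using x norm_triangle_ineq2[of x z] by linarith
        then show ?thesis using z by simp
      qed (use w in simp)
      then show ?thesis unfolding convolution_def by (simp only: Bochner_Integration.integral_zero)
    qed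
    then have "{x. convolution \<eta> w x \<noteq> 0} \<subseteq> cball 0 (R + R')" by (force simp: not_less[symmetric])
    then show ?thesis by (meson bounded_cball bounded_closure bounded_subset closed_closure compact_eq_bounded_closed)
  qed
  ultimately show ?thesis by (simp add: test_functions_def)
qed

section \<open>Density of test functions\<close>

text \<open>The classical bump \<open>exp (- 1 / (1 - (norm z / \<delta>)\<^sup>2))\<close>,
  normalised. Membership in \<open>bump_class\<close> gives smooth averages, and evenness identifies
  an average with a convolution.\<close>

lemma ex_mollifier:
  "\<exists>C>0. \<forall>\<delta>>0. \<exists>\<psi>::real ^ 'n::finite \<Rightarrow> real. avg_kernel \<psi> (C * \<delta> powr (- real CARD('n))) \<delta>
     \<and> (\<lambda>x. of_real (\<psi> x)) \<in> bump_class 1 (1 / \<delta>\<^sup>2) \<and> (\<forall>z. \<psi> (- z) = \<psi> z)"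
proof -
  let ?n = "CARD('n)"
  let ?w = "unit_ball_vol ?n"
  have w: "?w > 0" by simp
  \<comment> \<open>For \<open>norm z < \<delta> / 2\<close> the argument of the bump is at least
    \<open>1 - 1 / 4\<close>; \<open>m0\<close> times the volume of this half-size ball bounds the
    mass from below.\<close>
  define m0 where "m0 = flat_exp 0 (3 / 4)"
  have m0: "m0 > 0" by (simp add: m0_def flat_exp_def)
  define C where "C = 2 ^ ?n / (m0 * ?w)"
  have C: "C > 0" using w m0 by (simp add: C_def)
  have mono: "flat_exp 0 s \<le> flat_exp 0 t" if "s \<le> t" for s t
    using that by (auto simp: flat_exp_def frac_le)
  have le1: "flat_exp 0 t \<le> 1" for t by (simp add: flat_exp_def)
  have "\<exists>\<psi>::real ^ 'n \<Rightarrow> real. avg_kernel \<psi> (C * \<delta> powr (- real ?n)) \<delta>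
     \<and> (\<lambda>x. of_real (\<psi> x)) \<in> bump_class 1 (1 / \<delta>\<^sup>2) \<and> (\<forall>z. \<psi> (- z) = \<psi> z)" if \<delta>: "\<delta> > 0" for \<delta> :: real
  proof -
    define h :: "real ^ 'n \<Rightarrow> real" where "h z = flat_exp 0 (1 - 1 / \<delta>\<^sup>2 * (norm z)\<^sup>2)" for z
    have hb: "(\<lambda>x. of_real (h x)) \<in> bump_class 1 (1 / \<delta>\<^sup>2)" unfolding h_def by (rule bump_class.base)
    have "(\<lambda>x. Re (of_real (h x))) \<in> borel_measurable borel"
      by (intro measurable_compose[OF borel_measurable_continuous_onI[OF bump_class_continuous[OF hb]]]
          borel_measurable_continuous_onI continuous_intros)
    then have hm[measurable]: "h \<in> borel_measurable borel" by simp
    have h0: "0 \<le> h z" "h z \<le> 1" for z by (auto simp: h_def flat_exp_nonneg le1)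
    have hs: "h z = 0" if "norm z > \<delta>" for z
    proof -
      have "\<delta>\<^sup>2 \<le> (norm z)\<^sup>2" using that \<delta> by (intro power_mono) auto
      then have "1 - 1 / \<delta>\<^sup>2 * (norm z)\<^sup>2 \<le> 0" using \<delta> by (simp add: field_simps)
      then show ?thesis by (simp add: h_def flat_exp_def)
    qed
    let ?I = "\<integral>\<^sup>+z. ennreal (h z) \<partial>lborel"
    define m where "m = m0 * (?w * (\<delta> / 2) ^ ?n)"
    have m: "m > 0" using w m0 \<delta> by (simp add: m_def)
    have "ennreal m0 * emeasure lborel (ball (0::real^'n) (\<delta> / 2)) = (\<integral>\<^sup>+z. ennreal m0 * indicator (ball (0::real^'n) (\<delta> / 2)) z \<partial>lborel)"
      by (subst nn_integral_cmult_indicator) auto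
    also have "\<dots> \<le> ?I"
    proof (intro nn_integral_mono)
      fix z :: "real ^ 'n"
      have "m0 \<le> h z" if "norm z < \<delta> / 2"
      proof -
        have "(norm z)\<^sup>2 \<le> (\<delta> / 2)\<^sup>2" using that by (intro power_mono) auto
        then have "3 / 4 \<le> 1 - 1 / \<delta>\<^sup>2 * (norm z)\<^sup>2" using \<delta> by (simp add: field_simps power_divide)
        then show ?thesis unfolding m0_def h_def by (rule mono)
      qed
      then show "ennreal m0 * indicator (ball 0 (\<delta> / 2)) z \<le> ennreal (h z)"
        by (auto simp: indicator_def intro!: ennreal_leI)
    qed
    finally have mI: "ennreal m \<le> ?I"
      using \<delta> m0 by (simp add: emeasure_ball ennreal_mult[symmetric] m_def)
    have Cm: "1 / m = C * \<delta> powr (- real ?n)"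
      using \<delta> w m0 unfolding m_def C_def by (simp add: powr_minus powr_realpow field_simps power_divide)
    obtain c where "m \<le> c" and k: "avg_kernel (\<lambda>z. h z / c) (1 / m) \<delta>"
      using normalized_kernel[OF hm h0 hs m mI] by blast
    define \<psi> where "\<psi> z = h z / c" for z
    have "avg_kernel \<psi> (C * \<delta> powr (- real ?n)) \<delta>" using k unfolding Cm \<psi>_def[abs_def] .
    moreover have "(\<lambda>x. of_real (\<psi> x)) \<in> bump_class 1 (1 / \<delta>\<^sup>2)"
      using bump_class.scale[OF hb, of "of_real (1 / c)"] by (simp add: \<psi>_def)
    moreover have "\<psi> (- z) = \<psi> z" for z by (simp add: \<psi>_def h_def)
    ultimately show ?thesis by blast
  qed
  then show ?thesis using C by blast
qed

section \<open>Stability of the weak equation under approximation\<close>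

definition weak_eq :: "real \<Rightarrow> ('a::euclidean_space \<times> 'a \<Rightarrow> complex) \<Rightarrow> ('a \<Rightarrow> complex) \<Rightarrow> ('a \<Rightarrow> complex) \<Rightarrow> ('a \<Rightarrow> complex) \<Rightarrow> bool" where
  "weak_eq N A f u \<phi> \<longleftrightarrow> (\<integral>z. form_density N A u \<phi> z \<partial>lborel) = (\<integral>x. f x * cnj (\<phi> x) \<partial>lborel)"

definition sobolev_borel :: "real \<Rightarrow> ('a::euclidean_space \<Rightarrow> complex) \<Rightarrow> bool" where
  "sobolev_borel N \<phi> \<longleftrightarrow> \<phi> \<in> borel_measurable borel \<and> l2sq \<phi> < \<infinity> \<and> gagliardo N \<phi> < \<infinity>"

text \<open>The defect \<open>D\<close> of the equation is conjugate linear in the test function and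
  vanishes at each \<open>\<phi>k k\<close>, so it equals the defect at the difference, which is
  small by the two Young bounds.\<close>

lemma weak_eq_limit:
  fixes u f :: "'a::euclidean_space \<Rightarrow> complex"
  assumes [measurable]: "A \<in> borel_measurable borel" "f \<in> borel_measurable borel"
    and A: "AE z in lborel. cmod (A z) \<le> \<Lambda>" and f: "l2sq f < \<infinity>"
    and u: "sobolev_borel N u" and \<phi>: "sobolev_borel N \<phi>" and \<phi>k: "\<And>k. sobolev_borel N (\<phi>k k)"
    and eq: "\<And>k. weak_eq N A f u (\<phi>k k)"
    and l2: "(\<lambda>k. l2sq (\<lambda>x. \<phi> x - \<phi>k k x)) \<longlonglongrightarrow> 0"
    and en: "(\<lambda>k::nat. gagliardo N (\<lambda>x. \<phi> x - \<phi>k k x)) \<longlonglongrightarrow> 0"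
  shows "weak_eq N A f u \<phi>"
proof -
  have [measurable]: "u \<in> borel_measurable borel" "\<phi> \<in> borel_measurable borel" "\<And>k. \<phi>k k \<in> borel_measurable borel"
    using u \<phi> \<phi>k by (auto simp: sobolev_borel_def)
  let ?E = "gagliardo N"
  define D where "D = (\<integral>z. form_density N A u \<phi> z \<partial>lborel) - (\<integral>x. f x * cnj (\<phi> x) \<partial>lborel)"
  obtain e where e: "?E u = ennreal e" "0 \<le> e" using u by (cases "?E u") (auto simp: sobolev_borel_def)
  obtain f' where f': "l2sq f = ennreal f'" "0 \<le> f'" using f by (cases "l2sq f") auto
  \<comment> \<open>When energy and squared norm of the difference are both below
    \<open>t\<^sup>2\<close>, Young's inequality with parameter \<open>t\<close> bounds the defect
    by exactly \<open>t * M\<close>.\<close>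
  define M where "M = \<bar>\<Lambda>\<bar> * (e + 1) + f' + 1"
  have M: "M > 0" using e f' by (simp add: M_def add_nonneg_pos)
  have small: "cmod D \<le> t * M" if t: "t > 0" for t
  proof -
    have t2: "ennreal (t\<^sup>2) > 0" using t by simp
    have "eventually (\<lambda>k. l2sq (\<lambda>x. \<phi> x - \<phi>k k x) < ennreal (t\<^sup>2) \<and> ?E (\<lambda>x. \<phi> x - \<phi>k k x) < ennreal (t\<^sup>2)) sequentially"
      using order_tendstoD(2)[OF l2 t2] order_tendstoD(2)[OF en t2] by eventually_elim auto
    then obtain k where k: "l2sq (\<lambda>x. \<phi> x - \<phi>k k x) < ennreal (t\<^sup>2)" "?E (\<lambda>x. \<phi> x - \<phi>k k x) < ennreal (t\<^sup>2)"
      unfolding eventually_sequentially by blast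
    define v where "v x = \<phi> x - \<phi>k k x" for x
    have [measurable]: "v \<in> borel_measurable borel" unfolding v_def by measurable
    have i: "integrable lborel (form_density N A u \<phi>)" "integrable lborel (form_density N A u (\<phi>k k))"
      using u \<phi> \<phi>k[of k] by (auto intro!: form_density_integrable A simp: sobolev_borel_def)
    have j: "integrable lborel (\<lambda>x. f x * cnj (\<phi> x))" "integrable lborel (\<lambda>x. f x * cnj (\<phi>k k x))"
      using f \<phi> \<phi>k[of k] by (auto intro!: integrable_l2_pairing simp: sobolev_borel_def)
    have "(\<integral>z. form_density N A u v z \<partial>lborel) = (\<integral>z. form_density N A u \<phi> z - form_density N A u (\<phi>k k) z \<partial>lborel)"
      by (intro Bochner_Integration.integral_cong) (auto simp: form_density_def v_def algebra_simps)
    also have "\<dots> = (\<integral>z. form_density N A u \<phi> z \<partial>lborel) - (\<integral>z. form_density N A u (\<phi>k k) z \<partial>lborel)"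
      using i by simp
    finally have 1: "(\<integral>z. form_density N A u v z \<partial>lborel) = \<dots>" .
    have "(\<integral>x. f x * cnj (v x) \<partial>lborel) = (\<integral>x. f x * cnj (\<phi> x) - f x * cnj (\<phi>k k x) \<partial>lborel)"
      by (intro Bochner_Integration.integral_cong) (auto simp: v_def algebra_simps)
    also have "\<dots> = (\<integral>x. f x * cnj (\<phi> x) \<partial>lborel) - (\<integral>x. f x * cnj (\<phi>k k x) \<partial>lborel)"
      using j by simp
    finally have 2: "(\<integral>x. f x * cnj (v x) \<partial>lborel) = \<dots>" .
    have "D = (\<integral>z. form_density N A u v z \<partial>lborel) - (\<integral>x. f x * cnj (v x) \<partial>lborel)"
      using eq[of k] unfolding 1 2 D_def weak_eq_def by simp
    then have "cmod D \<le> cmod (\<integral>z. form_density N A u v z \<partial>lborel) + cmod (\<integral>x. f x * cnj (v x) \<partial>lborel)"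
      using norm_triangle_ineq4 by blast
    then have "ennreal (cmod D) \<le> ennreal (cmod (\<integral>z. form_density N A u v z \<partial>lborel)) + ennreal (cmod (\<integral>x. f x * cnj (v x) \<partial>lborel))"
      by (simp add: ennreal_plus[symmetric] ennreal_leI del: ennreal_plus)
    also have "\<dots> \<le> ennreal \<bar>\<Lambda>\<bar> * (ennreal t * ?E u + ennreal (1 / t) * ?E v) + (ennreal t * l2sq f + ennreal (1 / t) * l2sq v)"
      by (intro add_mono form_bound l2_pairing_bound A t) measurable
    also have "\<dots> \<le> ennreal \<bar>\<Lambda>\<bar> * (ennreal t * ennreal e + ennreal (1 / t) * ennreal (t\<^sup>2)) + (ennreal t * ennreal f' + ennreal (1 / t) * ennreal (t\<^sup>2))"
      using k unfolding e f' v_def[abs_def] by (intro add_mono mult_left_mono order_refl) auto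
    also have "\<dots> = ennreal (\<bar>\<Lambda>\<bar> * (t * e + 1 / t * t\<^sup>2) + (t * f' + 1 / t * t\<^sup>2))"
    proof -
      have gen: "ennreal l * (ennreal t * ennreal e + ennreal s * ennreal q) + (ennreal t * ennreal f' + ennreal s * ennreal q)
        = ennreal (l * (t * e + s * q) + (t * f' + s * q))" if "0 \<le> l" "0 \<le> s" "0 \<le> q" for l s q
        using that e f' t by (simp add: ennreal_mult)
      show ?thesis by (rule gen) (use t in auto)
    qed
    also have "\<bar>\<Lambda>\<bar> * (t * e + 1 / t * t\<^sup>2) + (t * f' + 1 / t * t\<^sup>2) = t * M"
      using t by (simp add: M_def power2_eq_square algebra_simps)
    finally show ?thesis using t M by simp
  qed
  have "cmod D \<le> 0"
  proof (rule field_le_epsilon)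
    fix d :: real assume "d > 0"
    then show "cmod D \<le> 0 + d" using small[of "d / M"] M by simp
  qed
  then show ?thesis by (simp add: D_def weak_eq_def)
qed

section \<open>Approximation in the Sobolev norm\<close>

lemma l2sq_diff_le:
  assumes [measurable]: "u \<in> borel_measurable borel" "v \<in> borel_measurable borel"
  shows "l2sq (\<lambda>x. u x - v x) \<le> 2 * l2sq u + 2 * l2sq v"
proof -
  have "l2sq (\<lambda>x. u x - v x) \<le> (\<integral>\<^sup>+x. 2 * ennreal ((cmod (u x))\<^sup>2) + 2 * ennreal ((cmod (v x))\<^sup>2) \<partial>lborel)"
    unfolding l2sq_def
  proof (intro nn_integral_mono)
    fix x
    have "ennreal ((cmod (u x - v x))\<^sup>2) \<le> ennreal (2 * (cmod (u x))\<^sup>2 + 2 * (cmod (v x))\<^sup>2)"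
      by (intro ennreal_leI norm_diff_sq_le)
    then show "ennreal ((cmod (u x - v x))\<^sup>2) \<le> 2 * ennreal ((cmod (u x))\<^sup>2) + 2 * ennreal ((cmod (v x))\<^sup>2)"
      by (simp add: ennreal_mult)
  qed
  also have "\<dots> = 2 * l2sq u + 2 * l2sq v"
    unfolding l2sq_def by (simp add: nn_integral_add nn_integral_cmult)
  finally show ?thesis .
qed

lemma sobolev_borel_diff:
  assumes "sobolev_borel N u" "sobolev_borel N v"
  shows "sobolev_borel N (\<lambda>x. u x - v x)"
proof -
  have [measurable]: "u \<in> borel_measurable borel" "v \<in> borel_measurable borel" using assms by (auto simp: sobolev_borel_def)
  have "l2sq (\<lambda>x. u x - v x) < \<infinity>"
    by (rule le_less_trans[OF l2sq_diff_le]) (use assms in \<open>auto simp: sobolev_borel_def ennreal_mult_less_top\<close>)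
  moreover have "gagliardo N (\<lambda>x. u x - v x) < \<infinity>"
    by (rule le_less_trans[OF energy_diff_le]) (use assms in \<open>auto simp: sobolev_borel_def ennreal_mult_less_top\<close>)
  ultimately show ?thesis by (simp add: sobolev_borel_def)
qed

lemma energy_tail_le:
  fixes v :: "'a::euclidean_space \<Rightarrow> complex" and N s :: real
  assumes [measurable]: "v \<in> borel_measurable borel" and N: "N > DIM('a)" and s: "s > 0"
  shows "energy (far N s) v
    \<le> ennreal (4 * (N * unit_ball_vol (DIM('a)) / (N - DIM('a))) * s powr (DIM('a) - N)) * l2sq v"
proof -
  have "energy (far N s) v
    \<le> 4 * (\<integral>\<^sup>+(h::'a). ennreal (if s \<le> norm h then norm h powr (-N) else 0) \<partial>lborel) * l2sq v"
    by (intro energy_le_l2sq) auto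
  also have "\<dots> \<le> 4 * ennreal (N * unit_ball_vol (DIM('a)) / (N - DIM('a)) * s powr (DIM('a) - N)) * l2sq v"
    by (intro mult_right_mono mult_left_mono nn_integral_radial_tail N s) auto
  also have "4 * ennreal (N * unit_ball_vol (DIM('a)) / (N - DIM('a)) * s powr (DIM('a) - N)) = ennreal (4 * (N * unit_ball_vol (DIM('a)) / (N - DIM('a))) * s powr (DIM('a) - N))"
    by (subst ennreal_numeral[symmetric], subst ennreal_mult'[symmetric]) (auto simp: mult.assoc)
  finally show ?thesis .
qed

text \<open>Dominated convergence: off the diagonal the weight vanishes as soon as
  \<open>s k\<close> falls below the distance, and on the diagonal the density is zero.\<close>

lemma energy_near_tendsto_0:
  assumes u: "sobolev_borel N u" and s: "s \<longlonglongrightarrow> 0"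
  shows "(\<lambda>k. energy (near N (s k)) u) \<longlonglongrightarrow> 0"
proof -
  have [measurable]: "u \<in> borel_measurable borel" using u by (simp add: sobolev_borel_def)
  let ?d = "\<lambda>z. dist (fst z) (snd z)"
  let ?f = "\<lambda>\<kappa> z. ennreal (\<kappa> (?d z) * (cmod (u (fst z) - u (snd z)))\<^sup>2)"
  let ?\<kappa> = "\<lambda>k t. if t < s k then t powr (-N) else 0"
  have m: "?f \<kappa> \<in> borel_measurable lborel" if [measurable]: "\<kappa> \<in> borel_measurable borel" for \<kappa>
    using energy_density_measurable[of \<kappa> u] by simp
  have "(\<lambda>k. \<integral>\<^sup>+z. ?f (?\<kappa> k) z \<partial>lborel) \<longlonglongrightarrow> (\<integral>\<^sup>+z. 0 \<partial>(lborel :: ('a \<times> 'a) measure))"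
  proof (rule nn_integral_dominated_convergence[where w = "?f (\<lambda>t. t powr (-N))"])
    show "?f (?\<kappa> k) \<in> borel_measurable lborel" for k by (rule m) measurable
    show "?f (\<lambda>t. t powr (-N)) \<in> borel_measurable lborel" by (rule m) measurable
    show "(\<integral>\<^sup>+z. ?f (\<lambda>t. t powr (-N)) z \<partial>lborel) < \<infinity>"
      using u energy_eq_prod[of "\<lambda>t. t powr (-N)" u] by (simp add: sobolev_borel_def)
    show "AE z in lborel. (\<lambda>k. ?f (?\<kappa> k) z) \<longlonglongrightarrow> 0"
    proof (intro AE_I2)
      fix z :: "'a \<times> 'a"
      show "(\<lambda>k. ?f (?\<kappa> k) z) \<longlonglongrightarrow> 0"
      proof (cases "?d z = 0")
        case True
        then have "(\<lambda>k. ?f (?\<kappa> k) z) = (\<lambda>k. 0)" by auto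
        then show ?thesis by (simp only: tendsto_const)
      next
        case False
        then have "?d z > 0" by simp
        with s have "eventually (\<lambda>k. s k < ?d z) sequentially" by (rule order_tendstoD)
        then have "eventually (\<lambda>k. ?f (?\<kappa> k) z = 0) sequentially" by eventually_elim auto
        then show ?thesis by (rule tendsto_eventually)
      qed
    qed
  qed (auto intro!: AE_I2 ennreal_leI mult_right_mono)
  moreover have "(\<integral>\<^sup>+z. ?f (?\<kappa> k) z \<partial>lborel) = energy (?\<kappa> k) u" for k
    by (rule energy_eq_prod[symmetric]) measurable
  ultimately show ?thesis by simp
qed

lemma tendsto_0_ennreal_bound:
  fixes F :: "nat \<Rightarrow> ennreal"
  assumes "\<And>k. F k \<le> ennreal (r k)" and "r \<longlonglongrightarrow> 0"
  shows "F \<longlonglongrightarrow> 0"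
proof (rule tendsto_sandwich[of "\<lambda>_. 0" _ _ "\<lambda>k. ennreal (r k)"])
  show "(\<lambda>k. ennreal (r k)) \<longlonglongrightarrow> 0" using tendsto_ennrealI[OF assms(2)] by simp
qed (use assms(1) in auto)

text \<open>No continuity of translations is needed: below the scale \<open>s\<close> the energy of \<open>w\<close> itself is small, and
  above it the energy of the difference is controlled by its \<open>L\<^sup>2\<close> norm, which is small because the
  mollifier has the much smaller width \<open>\<delta> = s\<^sup>2\<close>.\<close>

lemma mollification_approx:
  fixes w :: "real ^ 'n::finite \<Rightarrow> complex" and \<alpha> N :: real
  assumes \<alpha>: "0 < \<alpha>" and N: "N = CARD('n) + 2 * \<alpha>"
    and w: "sobolev_borel N w" and supp: "\<And>x. norm x > R \<Longrightarrow> w x = 0"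
  shows "\<exists>\<phi>. (\<forall>k::nat. \<phi> k \<in> test_functions \<and> sobolev_borel N (\<phi> k)) \<and>
    (\<lambda>k. l2sq (\<lambda>x. w x - \<phi> k x)) \<longlonglongrightarrow> 0 \<and> (\<lambda>k. gagliardo N (\<lambda>x. w x - \<phi> k x)) \<longlonglongrightarrow> 0"
proof -
  let ?n = "real CARD('n)"
  let ?E = "gagliardo N"
  have Nn: "N > real DIM(real^'n)" using \<alpha> by (simp add: N)
  have wm[measurable]: "w \<in> borel_measurable borel" and w2: "l2sq w < \<infinity>" and wE: "?E w < \<infinity>"
    using w by (auto simp: sobolev_borel_def)
  obtain C where C: "C > 0" and mol: "\<And>\<delta>. \<delta> > 0 \<Longrightarrow> \<exists>\<psi>::real ^ 'n \<Rightarrow> real. avg_kernel \<psi> (C * \<delta> powr (- ?n)) \<delta>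
     \<and> (\<lambda>x. of_real (\<psi> x)) \<in> bump_class 1 (1 / \<delta>\<^sup>2) \<and> (\<forall>z. \<psi> (- z) = \<psi> z)"
    using ex_mollifier[where 'n='n] by blast
  define s where "s k = inverse (real (Suc k))" for k
  have s: "s k > 0" for k by (simp add: s_def)
  have s0: "s \<longlonglongrightarrow> 0" unfolding s_def by (rule LIMSEQ_inverse_real_of_nat)
  have sp: "(\<lambda>k. c * s k powr a) \<longlonglongrightarrow> 0" if "a > 0" for a c
  proof -
    have "(\<lambda>k. s k powr a) \<longlonglongrightarrow> 0 powr a"
      by (rule tendsto_powr2[OF s0 tendsto_const]) (use s that in \<open>auto intro: less_imp_le always_eventually\<close>)
    then show ?thesis by (simp add: tendsto_mult_right_zero)
  qed
  define \<delta> where "\<delta> k = (s k)\<^sup>2" for k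
  have \<delta>: "\<delta> k > 0" for k unfolding \<delta>_def using s[of k] by simp
  have "\<forall>k. \<exists>\<psi>::real ^ 'n \<Rightarrow> real. avg_kernel \<psi> (C * \<delta> k powr (- ?n)) (\<delta> k)
     \<and> (\<lambda>x. of_real (\<psi> x)) \<in> bump_class 1 (1 / (\<delta> k)\<^sup>2) \<and> (\<forall>z. \<psi> (- z) = \<psi> z)"
    using mol \<delta> by blast
  then obtain \<psi> :: "nat \<Rightarrow> real ^ 'n \<Rightarrow> real" where "\<forall>k. avg_kernel (\<psi> k) (C * \<delta> k powr (- ?n)) (\<delta> k)
     \<and> (\<lambda>x. of_real (\<psi> k x)) \<in> bump_class 1 (1 / (\<delta> k)\<^sup>2) \<and> (\<forall>z. \<psi> k (- z) = \<psi> k z)"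
    by (rule choice[THEN exE])
  then have K: "avg_kernel (\<psi> k) (C * \<delta> k powr (- ?n)) (\<delta> k)"
    and B: "(\<lambda>x. of_real (\<psi> k x)) \<in> bump_class 1 (1 / (\<delta> k)\<^sup>2)" and ev: "\<psi> k (- z) = \<psi> k z" for k z by auto
  define \<phi> where "\<phi> k = avg (\<psi> k) w" for k
  have \<phi>m[measurable]: "\<phi> k \<in> borel_measurable borel" for k
    unfolding \<phi>_def by (rule avg_kernel.avg_measurable[OF K wm])
  obtain e where e: "?E w = ennreal e" "0 \<le> e" using wE by (cases "?E w") auto
  \<comment> \<open>On the support of the kernel the distance is at most \<open>\<delta> k\<close>.
    Writing \<open>\<delta> powr (-n)\<close> as
    \<open>\<delta> powr (2 * \<alpha>) * \<delta> powr (-N)\<close> bounds the kernel by a small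
    multiple of the Gagliardo weight.\<close>
  have l2: "l2sq (\<lambda>x. w x - \<phi> k x) \<le> ennreal (C * e * \<delta> k powr (2 * \<alpha>))" for k
  proof -
    interpret avg_kernel "\<psi> k" "C * \<delta> k powr (- ?n)" "\<delta> k" by (rule K)
    have "l2sq (\<lambda>x. w x - \<phi> k x) \<le> (\<integral>\<^sup>+x. \<integral>\<^sup>+z. ennreal (\<psi> k (z - x) * (cmod (w x - w z))\<^sup>2) \<partial>lborel \<partial>lborel)"
      unfolding \<phi>_def by (rule l2sq_minus_avg[OF wm w2])
    also have "\<dots> \<le> energy (\<lambda>t. (C * \<delta> k powr (2 * \<alpha>)) * t powr (-N)) w"
      unfolding energy_def
    proof (intro nn_integral_mono ennreal_leI)
      fix x z
      show "\<psi> k (z - x) * (cmod (w x - w z))\<^sup>2 \<le> C * \<delta> k powr (2 * \<alpha>) * dist x z powr (-N) * (cmod (w x - w z))\<^sup>2"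
      proof (cases "x = z")
        case False
        show ?thesis
        proof (intro mult_right_mono)
          show "\<psi> k (z - x) \<le> C * \<delta> k powr (2 * \<alpha>) * dist x z powr (-N)"
          proof (cases "norm (z - x) > \<delta> k")
            case True
            then show ?thesis using supp C by simp
          next
            case F: False
            have "\<delta> k powr (-N) \<le> dist x z powr (-N)"
              using F False Nn by (intro powr_mono2') (auto simp: dist_norm norm_minus_commute)
            then have "C * \<delta> k powr (2 * \<alpha>) * \<delta> k powr (-N) \<le> C * \<delta> k powr (2 * \<alpha>) * dist x z powr (-N)"
              using C by (intro mult_left_mono) auto
            moreover have "\<delta> k powr (2 * \<alpha>) * \<delta> k powr (-N) = \<delta> k powr (- ?n)"
              by (simp add: powr_add[symmetric] N)
            ultimately show ?thesis using bound[of "z - x"] by (simp add: mult.assoc)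
          qed
        qed auto
      qed simp
    qed
    also have "\<dots> = ennreal (C * \<delta> k powr (2 * \<alpha>)) * ennreal e"
      using C unfolding e(1)[symmetric] by (intro energy_cmult) auto
    also have "\<dots> = ennreal (C * e * \<delta> k powr (2 * \<alpha>))"
      using C e by (simp add: ennreal_mult[symmetric] mult_ac)
    finally show ?thesis .
  qed
  have test: "\<phi> k \<in> test_functions" for k
  proof -
    \<comment> \<open>Averages evaluate the kernel at \<open>z - x\<close>, convolutions at
      \<open>x - z\<close>.\<close>
    have "\<psi> k (z - x) = \<psi> k (x - z)" for x z using ev[of k "x - z"] by simp
    then have "\<phi> k = convolution (\<lambda>x. of_real (\<psi> k x)) w"
      unfolding \<phi>_def avg_def[abs_def] convolution_def[abs_def] by simp
    moreover have "integrable lborel w"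
    proof -
      have "integrable lborel (\<lambda>z. of_real (indicator (cball 0 R) z) * w z)"
        by (rule integrable_mult_l2[where B = 1 and R = R and x = 0]) (use w2 in \<open>auto simp: indicator_def\<close>)
      also have "(\<lambda>z. of_real (indicator (cball 0 R) z) * w z) = w"
      proof
        fix z show "of_real (indicator (cball 0 R) z) * w z = w z"
          using supp[of z] by (cases "norm z \<le> R") auto
      qed
      finally show ?thesis .
    qed
    ultimately show ?thesis
      using convolution_test_function[OF B, of k w R] supp \<delta>[of k] by simp
  qed
  have sp': "sobolev_borel N (\<phi> k)" for k
  proof -
    interpret avg_kernel "\<psi> k" "C * \<delta> k powr (- ?n)" "\<delta> k" by (rule K)
    have "l2sq (\<lambda>x. w x - (w x - \<phi> k x)) \<le> 2 * l2sq w + 2 * l2sq (\<lambda>x. w x - \<phi> k x)"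
      by (rule l2sq_diff_le) measurable
    also have "\<dots> \<le> 2 * l2sq w + 2 * ennreal (C * e * \<delta> k powr (2 * \<alpha>))"
      by (intro add_left_mono mult_left_mono l2) auto
    also have "\<dots> < \<infinity>" using w2 by (simp add: ennreal_mult_less_top)
    finally have "l2sq (\<phi> k) < \<infinity>" by simp
    moreover have "?E (\<phi> k) \<le> ?E w"
      unfolding \<phi>_def by (rule energy_avg_le[OF wm _ w2]) auto
    ultimately show ?thesis using wE unfolding sobolev_borel_def by (auto intro: le_less_trans)
  qed
  have t1: "(\<lambda>k. l2sq (\<lambda>x. w x - \<phi> k x)) \<longlonglongrightarrow> 0"
  proof (rule tendsto_0_ennreal_bound)
    have "\<delta> k powr (2 * \<alpha>) = s k powr (4 * \<alpha>)" for k
    proof -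
      have "(s k)\<^sup>2 = s k powr 2" using s[of k] by simp
      then show ?thesis unfolding \<delta>_def by (simp only: powr_powr) simp
    qed
    then show "(\<lambda>k. C * e * \<delta> k powr (2 * \<alpha>)) \<longlonglongrightarrow> 0" using sp[of "4 * \<alpha>" "C * e"] \<alpha> by simp
  qed (rule l2)
  define c where "c = 4 * (N * unit_ball_vol ?n / (N - ?n))"
  have c: "c \<ge> 0" using Nn by (simp add: c_def)
  \<comment> \<open>Averaging does not increase the near energy, hence the factor 4. The tail
    contributes \<open>s k powr (-2 * \<alpha>)\<close> times
    \<open>\<delta> k powr (2 * \<alpha>)\<close>, and \<open>\<delta> k = (s k)\<^sup>2\<close>
    turns this into the vanishing \<open>s k powr (2 * \<alpha>)\<close>.\<close>
  have en: "?E (\<lambda>x. w x - \<phi> k x) \<le> 4 * energy (near N (s k)) w + ennreal (c * C * e * s k powr (2 * \<alpha>))" for k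
  proof -
    interpret avg_kernel "\<psi> k" "C * \<delta> k powr (- ?n)" "\<delta> k" by (rule K)
    let ?\<kappa> = "\<lambda>t. if t < s k then t powr (-N) else 0"
    let ?\<kappa>' = "\<lambda>t. if s k \<le> t then t powr (-N) else 0"
    have "?E (\<lambda>x. w x - \<phi> k x) \<le> energy (\<lambda>t. ?\<kappa> t + ?\<kappa>' t) (\<lambda>x. w x - \<phi> k x)"
      by (intro energy_mono) auto
    also have "\<dots> = energy ?\<kappa> (\<lambda>x. w x - \<phi> k x) + energy ?\<kappa>' (\<lambda>x. w x - \<phi> k x)"
      by (intro energy_add) auto
    also have "energy ?\<kappa> (\<lambda>x. w x - \<phi> k x) \<le> 2 * energy ?\<kappa> w + 2 * energy ?\<kappa> (\<phi> k)"
      by (intro energy_diff_le) auto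
    also have "\<dots> \<le> 2 * energy ?\<kappa> w + 2 * energy ?\<kappa> w"
      unfolding \<phi>_def by (intro add_left_mono mult_left_mono energy_avg_le wm w2) auto
    also have "\<dots> = 4 * energy ?\<kappa> w" by (simp add: distrib_right[symmetric])
    also have "energy ?\<kappa>' (\<lambda>x. w x - \<phi> k x) \<le> ennreal (c * s k powr (?n - N)) * l2sq (\<lambda>x. w x - \<phi> k x)"
      using energy_tail_le[of "\<lambda>x. w x - \<phi> k x" N "s k"] Nn s[of k] by (simp add: c_def)
    also have "\<dots> \<le> ennreal (c * s k powr (?n - N)) * ennreal (C * e * \<delta> k powr (2 * \<alpha>))"
      by (intro mult_left_mono l2) auto
    also have "\<dots> = ennreal (c * C * e * (s k powr (?n - N) * \<delta> k powr (2 * \<alpha>)))"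
      using c C e by (simp add: ennreal_mult[symmetric] mult_ac)
    also have "s k powr (?n - N) * \<delta> k powr (2 * \<alpha>) = s k powr (2 * \<alpha>)"
    proof -
      have "(s k)\<^sup>2 = s k powr 2" using s[of k] by simp
      then have "\<delta> k powr (2 * \<alpha>) = s k powr (2 * (2 * \<alpha>))" unfolding \<delta>_def by (simp only: powr_powr)
      then show ?thesis by (simp add: powr_add[symmetric] N)
    qed
    finally show ?thesis by (simp add: add_mono)
  qed
  have "(\<lambda>k. 4 * energy (near N (s k)) w + ennreal (c * C * e * s k powr (2 * \<alpha>))) \<longlonglongrightarrow> 4 * 0 + ennreal 0"
    using sp[of "2 * \<alpha>" "c * C * e"] \<alpha>
    by (intro tendsto_add tendsto_ennrealI ennreal_tendsto_cmult energy_near_tendsto_0[OF w s0]) auto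
  then have lim: "(\<lambda>k. 4 * energy (near N (s k)) w + ennreal (c * C * e * s k powr (2 * \<alpha>))) \<longlonglongrightarrow> 0"
    by simp
  have t2: "(\<lambda>k. ?E (\<lambda>x. w x - \<phi> k x)) \<longlonglongrightarrow> 0"
    by (rule tendsto_sandwich[OF _ _ tendsto_const lim]) (use en in \<open>auto intro!: always_eventually\<close>)
  show ?thesis using test sp' t1 t2 by blast
qed

lemma nn_integral_outside_tendsto_0:
  fixes g :: "'a::euclidean_space \<Rightarrow> ennreal"
  assumes [measurable]: "g \<in> borel_measurable borel" and fin: "(\<integral>\<^sup>+x. g x \<partial>lborel) < \<infinity>"
  shows "(\<lambda>k. \<integral>\<^sup>+x. (if real (Suc k) < norm x then g x else 0) \<partial>lborel) \<longlonglongrightarrow> 0"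
proof -
  have "(\<lambda>k. \<integral>\<^sup>+x. (if real (Suc k) < norm x then g x else 0) \<partial>lborel) \<longlonglongrightarrow> (\<integral>\<^sup>+x. 0 \<partial>(lborel :: 'a measure))"
  proof (rule nn_integral_dominated_convergence[where w = g])
    show "AE x in lborel. (\<lambda>k. if real (Suc k) < norm x then g x else 0) \<longlonglongrightarrow> 0"
    proof (intro AE_I2 tendsto_eventually)
      fix x :: 'a
      obtain m :: nat where m: "norm x \<le> real m" using real_arch_simple by blast
      show "eventually (\<lambda>k. (if real (Suc k) < norm x then g x else 0) = 0) sequentially"
        using eventually_ge_at_top[of m] by eventually_elim (use m in auto)
    qed
  qed (use fin in auto)
  then show ?thesis by simp
qed

text \<open>What is cut away is \<open>\<zeta> R x * v x\<close>. The discrete product rule splits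
  its energy into a part with \<open>\<zeta> R x\<close>, which is a tail of the integrable function
  \<open>gamma_sq N v\<close>, and a part with differences of \<open>\<zeta> R\<close>, which is at
  most the squared norm of \<open>v\<close> times a multiple of
  \<open>R powr (- (2 * \<alpha>))\<close>.\<close>

lemma cutoff_approx:
  fixes v :: "'a::euclidean_space \<Rightarrow> complex" and \<alpha> N :: real
  assumes n: "DIM('a) \<ge> 2" and \<alpha>: "0 < \<alpha>" "\<alpha> < 1" and N: "N = DIM('a) + 2 * \<alpha>" and v: "sobolev_borel N v"
  shows "\<exists>\<phi>. (\<forall>k::nat. sobolev_borel N (\<phi> k) \<and> (\<forall>x. norm x > 2 * real (Suc k) \<longrightarrow> \<phi> k x = 0)) \<and>
    (\<lambda>k. l2sq (\<lambda>x. v x - \<phi> k x)) \<longlonglongrightarrow> 0 \<and> (\<lambda>k. gagliardo N (\<lambda>x. v x - \<phi> k x)) \<longlonglongrightarrow> 0"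
proof -
  let ?n = "real DIM('a)" let ?w = "unit_ball_vol ?n"
  let ?E = "gagliardo N"
  have Nn: "N > ?n" "N > 0" using \<alpha> by (auto simp: N add_nonneg_pos)
  define s where "s = N - 2"
  have n2: "?n \<ge> 2" using n by simp
  have s: "0 < s" "s < ?n" using \<alpha> n2 by (auto simp: s_def N)
  have vm[measurable]: "v \<in> borel_measurable borel" and v2: "l2sq v < \<infinity>" and vE: "?E v < \<infinity>"
    using v by (auto simp: sobolev_borel_def)
  define c where "c = (s * ?w / (?n - s) + ?w) + N * ?w / (N - ?n)"
  have c: "c \<ge> 0" using s Nn by (simp add: c_def)
  \<comment> \<open>\<open>1 - \<zeta> R\<close> is a piecewise linear cutoff, equal to 1 up to norm
    \<open>R\<close> and to 0 beyond \<open>2 * R\<close>. Lipschitz continuity is enough here;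
    smoothness is supplied by mollification afterwards.\<close>
  define \<zeta> where "\<zeta> R x = 1 - max 0 (min 1 (2 - norm x / R))" for R :: real and x :: 'a
  have \<zeta>01: "0 \<le> \<zeta> R x" "\<zeta> R x \<le> 1" for R x by (auto simp: \<zeta>_def)
  have \<zeta>0: "\<zeta> R x = 0" if "norm x \<le> R" "R > 0" for R x
    using that by (simp add: \<zeta>_def divide_simps)
  have \<zeta>1: "\<zeta> R x = 1" if "norm x > 2 * R" "R > 0" for R x
    using that by (simp add: \<zeta>_def divide_simps)
  have \<zeta>L: "\<bar>\<zeta> R x - \<zeta> R y\<bar> \<le> dist x y / R" if "R > 0" for R x y
  proof -
    have "\<bar>\<zeta> R x - \<zeta> R y\<bar> \<le> \<bar>norm x / R - norm y / R\<bar>" unfolding \<zeta>_def by linarith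
    also have "\<dots> = \<bar>norm x - norm y\<bar> / R" using that by (simp add: diff_divide_distrib[symmetric] abs_divide)
    also have "\<dots> \<le> dist x y / R" using that norm_triangle_ineq3[of x y] by (intro divide_right_mono) (auto simp: dist_norm)
    finally show ?thesis .
  qed
  define \<phi> where "\<phi> k x = of_real (1 - \<zeta> (real (Suc k)) x) * v x" for k x
  have w: "v x - \<phi> k x = of_real (\<zeta> (real (Suc k)) x) * v x" for k x by (simp add: \<phi>_def algebra_simps)
  have \<zeta>m[measurable]: "\<zeta> R \<in> borel_measurable borel" for R unfolding \<zeta>_def by measurable
  have \<phi>m[measurable]: "\<phi> k \<in> borel_measurable borel" for k unfolding \<phi>_def by measurable
  have l2: "l2sq (\<lambda>x. v x - \<phi> k x) \<le> (\<integral>\<^sup>+x. (if real (Suc k) < norm x then ennreal ((cmod (v x))\<^sup>2) else 0) \<partial>lborel)" for k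
    unfolding l2sq_def
  proof (intro nn_integral_mono)
    fix x
    show "ennreal ((cmod (v x - \<phi> k x))\<^sup>2) \<le> (if real (Suc k) < norm x then ennreal ((cmod (v x))\<^sup>2) else 0)"
    proof (cases "real (Suc k) < norm x")
      case True
      have "cmod (v x - \<phi> k x) \<le> 1 * cmod (v x)"
        unfolding w norm_mult using \<zeta>01 by (intro mult_right_mono) auto
      then show ?thesis using True by (auto intro!: ennreal_leI power_mono)
    next
      case False
      then show ?thesis unfolding w using \<zeta>0[of x "real (Suc k)"] by simp
    qed
  qed
  have t1: "(\<lambda>k. l2sq (\<lambda>x. v x - \<phi> k x)) \<longlonglongrightarrow> 0"
  proof (rule tendsto_sandwich[OF _ _ tendsto_const nn_integral_outside_tendsto_0])
    show "(\<lambda>x. ennreal ((cmod (v x))\<^sup>2)) \<in> borel_measurable borel" by measurable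
    show "(\<integral>\<^sup>+x. ennreal ((cmod (v x))\<^sup>2) \<partial>lborel) < \<infinity>" using v2 by (simp add: l2sq_def)
  qed (use l2 in auto)
  define g where "g x = (gamma_sq N v x)" for x
  have gm[measurable]: "g \<in> borel_measurable borel" unfolding g_def by measurable
  have gE: "(\<integral>\<^sup>+x. g x \<partial>lborel) = ?E v" by (simp add: g_def energy_def)
  \<comment> \<open>A majorant of \<open>t powr (-N)\<close> times the squared difference of
    \<open>\<zeta> R\<close> at distance \<open>t\<close>: below \<open>R\<close> that square is at
    most \<open>(t / R)\<^sup>2\<close>, above \<open>R\<close> at most 1. Both pieces integrate to
    a multiple of \<open>R powr (- (2 * \<alpha>))\<close>.\<close>
  define m where "m R t = (if t < R then t powr (-s) else 0) / R\<^sup>2 + (if R \<le> t then t powr (-N) else 0)" for R t :: real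
  have mm[measurable]: "m R \<in> borel_measurable borel" for R unfolding m_def by measurable
  have mI: "(\<integral>\<^sup>+(y::'a). ennreal (m R (norm y)) \<partial>lborel) \<le> ennreal (c * R powr (- (2 * \<alpha>)))" if R: "R > 0" for R
  proof -
    have "(\<integral>\<^sup>+(y::'a). ennreal (m R (norm y)) \<partial>lborel)
      = (\<integral>\<^sup>+(y::'a). ennreal (1 / R\<^sup>2) * ennreal (if norm y < R then norm y powr (-s) else 0) + ennreal (if R \<le> norm y then norm y powr (-N) else 0) \<partial>lborel)"
      using R by (intro nn_integral_cong) (simp add: m_def ennreal_plus[symmetric] ennreal_mult[symmetric] del: ennreal_plus)
    also have "\<dots> = ennreal (1 / R\<^sup>2) * (\<integral>\<^sup>+(y::'a). ennreal (if norm y < R then norm y powr (-s) else 0) \<partial>lborel) + (\<integral>\<^sup>+(y::'a). ennreal (if R \<le> norm y then norm y powr (-N) else 0) \<partial>lborel)"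
      by (simp add: nn_integral_add nn_integral_cmult)
    also have "\<dots> \<le> ennreal (1 / R\<^sup>2) * ennreal ((s * ?w / (?n - s) + ?w) * R powr (?n - s)) + ennreal (N * ?w / (N - ?n) * R powr (?n - N))"
      by (intro add_mono mult_left_mono nn_integral_radial_near nn_integral_radial_tail s Nn R) auto
    also have "\<dots> = ennreal (1 / R\<^sup>2 * ((s * ?w / (?n - s) + ?w) * R powr (?n - s)) + N * ?w / (N - ?n) * R powr (?n - N))"
      using s Nn R by (subst ennreal_mult[symmetric]) (auto simp: ennreal_plus[symmetric] simp del: ennreal_plus)
    also have "1 / R\<^sup>2 * ((s * ?w / (?n - s) + ?w) * R powr (?n - s)) + N * ?w / (N - ?n) * R powr (?n - N) = c * R powr (- (2 * \<alpha>))"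
    proof -
      have "R\<^sup>2 = R powr 2" using R by simp
      then have "1 / R\<^sup>2 * R powr (?n - s) = R powr (-2) * R powr (?n - s)" by (simp only: powr_minus_divide)
      also have "\<dots> = R powr (- (2 * \<alpha>))" by (simp add: powr_add[symmetric] s_def N)
      finally have "1 / R\<^sup>2 * ((s * ?w / (?n - s) + ?w) * R powr (?n - s)) = (s * ?w / (?n - s) + ?w) * R powr (- (2 * \<alpha>))"
        by (metis mult.left_commute)
      moreover have "R powr (?n - N) = R powr (- (2 * \<alpha>))" by (simp add: N)
      ultimately show ?thesis by (simp only: c_def distrib_right)
    qed
    finally show ?thesis .
  qed
  have en: "?E (\<lambda>x. v x - \<phi> k x) \<le> 2 * (\<integral>\<^sup>+x. (if real (Suc k) < norm x then g x else 0) \<partial>lborel)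
      + 2 * (l2sq v * ennreal (c * real (Suc k) powr (- (2 * \<alpha>))))" for k
  proof -
    define R where "R = real (Suc k)"
    have R: "R > 0" by (simp add: R_def)
    have "?E (\<lambda>x. v x - \<phi> k x) \<le> (\<integral>\<^sup>+x. \<integral>\<^sup>+y. 2 * ((if R < norm x then 1 else 0) * ennreal (dist x y powr (-N) * (cmod (v x - v y))\<^sup>2))
       + 2 * (ennreal ((cmod (v y))\<^sup>2) * ennreal (m R (dist y x))) \<partial>lborel \<partial>lborel)"
      unfolding energy_def
    proof (intro nn_integral_mono)
      fix x y :: 'a
      let ?d = "dist x y powr (-N)"
      \<comment> \<open>The cutoff factor is attached to \<open>x\<close> and the value of
        \<open>v\<close> to \<open>y\<close>, so that the first summand vanishes for
        \<open>norm x \<le> R\<close> and the second can be integrated in \<open>x\<close>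
        first.\<close>
      have d: "(v x - \<phi> k x) - (v y - \<phi> k y) = of_real (\<zeta> R x) * (v x - v y) - of_real (\<zeta> R y - \<zeta> R x) * v y"
        unfolding w R_def by (simp add: algebra_simps)
      have "(cmod ((v x - \<phi> k x) - (v y - \<phi> k y)))\<^sup>2 \<le> 2 * ((\<zeta> R x)\<^sup>2 * (cmod (v x - v y))\<^sup>2) + 2 * ((\<zeta> R y - \<zeta> R x)\<^sup>2 * (cmod (v y))\<^sup>2)"
        unfolding d by (rule order_trans[OF norm_diff_sq_le]) (simp add: norm_mult power_mult_distrib del: of_real_diff)
      then have 1: "?d * (cmod ((v x - \<phi> k x) - (v y - \<phi> k y)))\<^sup>2 \<le> ?d * (2 * ((\<zeta> R x)\<^sup>2 * (cmod (v x - v y))\<^sup>2) + 2 * ((\<zeta> R y - \<zeta> R x)\<^sup>2 * (cmod (v y))\<^sup>2))"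
        by (intro mult_left_mono) auto
      have "(\<zeta> R x)\<^sup>2 \<le> (if R < norm x then 1 else 0)"
        using \<zeta>0[of x R] R \<zeta>01[of R x] by (auto simp: power_le_one)
      then have 2: "?d * (2 * ((\<zeta> R x)\<^sup>2 * (cmod (v x - v y))\<^sup>2)) \<le> 2 * ((if R < norm x then 1 else 0) * (?d * (cmod (v x - v y))\<^sup>2))"
        using mult_right_mono[of "(\<zeta> R x)\<^sup>2" "if R < norm x then 1 else 0" "2 * (?d * (cmod (v x - v y))\<^sup>2)"] by (simp add: mult_ac split: if_splits)
      have "?d * (\<zeta> R y - \<zeta> R x)\<^sup>2 \<le> m R (dist y x)"
      proof (cases "dist x y < R")
        case True
        have "(\<zeta> R y - \<zeta> R x)\<^sup>2 \<le> (dist x y / R)\<^sup>2"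
          using \<zeta>L[OF R, of y x] by (intro power2_le_iff_abs_le[THEN iffD2]) (auto simp: dist_commute R less_imp_le)
        then have "?d * (\<zeta> R y - \<zeta> R x)\<^sup>2 \<le> ?d * (dist x y / R)\<^sup>2" by (intro mult_left_mono) auto
        also have "\<dots> = ?d * (dist x y)\<^sup>2 / R\<^sup>2" by (simp add: power_divide)
        also have "?d * (dist x y)\<^sup>2 = dist x y powr (-s)"
        proof (cases "x = y")
          case False
          then have "(dist x y)\<^sup>2 = dist x y powr 2" by simp
          then have "?d * (dist x y)\<^sup>2 = dist x y powr (-N + 2)" by (simp only: powr_add)
          then show ?thesis by (simp add: s_def)
        qed simp
        finally show ?thesis using True by (simp add: m_def dist_commute)
      next
        case False
        have "\<bar>\<zeta> R y - \<zeta> R x\<bar> \<le> 1" using \<zeta>01[of R x] \<zeta>01[of R y] by linarith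
        then have "(\<zeta> R y - \<zeta> R x)\<^sup>2 \<le> 1" by (simp add: abs_square_le_1)
        then have "?d * (\<zeta> R y - \<zeta> R x)\<^sup>2 \<le> ?d * 1" by (intro mult_left_mono) auto
        then show ?thesis using False by (simp add: m_def dist_commute)
      qed
      then have 3: "?d * (\<zeta> R y - \<zeta> R x)\<^sup>2 * (2 * (cmod (v y))\<^sup>2) \<le> m R (dist y x) * (2 * (cmod (v y))\<^sup>2)"
        by (intro mult_right_mono) auto
      have m0: "0 \<le> m R (dist y x)" by (simp add: m_def)
      have "?d * (cmod ((v x - \<phi> k x) - (v y - \<phi> k y)))\<^sup>2 \<le> 2 * ((if R < norm x then 1 else 0) * (?d * (cmod (v x - v y))\<^sup>2)) + 2 * ((cmod (v y))\<^sup>2 * m R (dist y x))"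
        using 1 2 3 by (simp add: algebra_simps)
      then have "ennreal (?d * (cmod ((v x - \<phi> k x) - (v y - \<phi> k y)))\<^sup>2) \<le> ennreal (2 * ((if R < norm x then 1 else 0) * (?d * (cmod (v x - v y))\<^sup>2)) + 2 * ((cmod (v y))\<^sup>2 * m R (dist y x)))"
        by (rule ennreal_leI)
      also have "\<dots> = 2 * ((if R < norm x then 1 else 0) * ennreal (?d * (cmod (v x - v y))\<^sup>2)) + 2 * (ennreal ((cmod (v y))\<^sup>2) * ennreal (m R (dist y x)))"
        using m0 by (simp add: ennreal_mult)
      finally show "ennreal (?d * (cmod ((v x - \<phi> k x) - (v y - \<phi> k y)))\<^sup>2) \<le> \<dots>" .
    qed
    also have "\<dots> = 2 * (\<integral>\<^sup>+x. \<integral>\<^sup>+y. (if R < norm x then 1 else 0) * ennreal (dist x y powr (-N) * (cmod (v x - v y))\<^sup>2) \<partial>lborel \<partial>lborel)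
       + 2 * (\<integral>\<^sup>+x. \<integral>\<^sup>+y. ennreal ((cmod (v y))\<^sup>2) * ennreal (m R (dist y x)) \<partial>lborel \<partial>lborel)"
      by (simp add: nn_integral_add nn_integral_cmult)
    also have "(\<integral>\<^sup>+x. \<integral>\<^sup>+y. (if R < norm x then 1 else 0) * ennreal (dist x y powr (-N) * (cmod (v x - v y))\<^sup>2) \<partial>lborel \<partial>lborel)
       = (\<integral>\<^sup>+x. (if R < norm x then g x else 0) \<partial>lborel)"
      unfolding g_def by (intro nn_integral_cong) simp
    also have "(\<integral>\<^sup>+x. \<integral>\<^sup>+y. ennreal ((cmod (v y))\<^sup>2) * ennreal (m R (dist y x)) \<partial>lborel \<partial>lborel)
       = (\<integral>\<^sup>+y. \<integral>\<^sup>+x. ennreal ((cmod (v y))\<^sup>2) * ennreal (m R (dist y x)) \<partial>lborel \<partial>lborel)"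
      by (rule lborel_pair.Fubini') measurable
    also have "\<dots> = l2sq v * (\<integral>\<^sup>+(h::'a). ennreal (m R (norm h)) \<partial>lborel)"
      unfolding l2sq_def by (simp add: nn_integral_cmult nn_integral_multc nn_integral_lborel_dist[of "\<lambda>t. ennreal (m R t)"])
    also have "2 * (\<integral>\<^sup>+x. (if R < norm x then g x else 0) \<partial>lborel) + 2 * (l2sq v * (\<integral>\<^sup>+(h::'a). ennreal (m R (norm h)) \<partial>lborel))
      \<le> 2 * (\<integral>\<^sup>+x. (if R < norm x then g x else 0) \<partial>lborel) + 2 * (l2sq v * ennreal (c * R powr (- (2 * \<alpha>))))"
      by (intro add_left_mono mult_left_mono mI R) auto
    finally show ?thesis unfolding R_def .
  qed
  obtain b where b: "l2sq v = ennreal b" "0 \<le> b" using v2 by (cases "l2sq v") auto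
  have "(\<lambda>k. 2 * (\<integral>\<^sup>+x. (if real (Suc k) < norm x then g x else 0) \<partial>lborel) + 2 * (l2sq v * ennreal (c * real (Suc k) powr (- (2 * \<alpha>))))) \<longlonglongrightarrow> 2 * 0 + 2 * (l2sq v * ennreal (c * 0))"
  proof (intro tendsto_add ennreal_tendsto_cmult tendsto_ennrealI tendsto_mult tendsto_const)
    show "(\<lambda>k. \<integral>\<^sup>+x. (if real (Suc k) < norm x then g x else 0) \<partial>lborel) \<longlonglongrightarrow> 0"
      by (rule nn_integral_outside_tendsto_0) (use vE gE in auto)
    have "filterlim (\<lambda>k. real (Suc k)) at_top sequentially"
      by (rule filterlim_compose[OF filterlim_real_sequentially filterlim_Suc])
    then show "(\<lambda>k. real (Suc k) powr (- (2 * \<alpha>))) \<longlonglongrightarrow> 0"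
      by (intro tendsto_neg_powr) (use \<alpha> in auto)
  qed (use v2 in auto)
  then have lim: "(\<lambda>k. 2 * (\<integral>\<^sup>+x. (if real (Suc k) < norm x then g x else 0) \<partial>lborel) + 2 * (l2sq v * ennreal (c * real (Suc k) powr (- (2 * \<alpha>))))) \<longlonglongrightarrow> 0"
    by simp
  have t2: "(\<lambda>k. ?E (\<lambda>x. v x - \<phi> k x)) \<longlonglongrightarrow> 0"
    by (rule tendsto_sandwich[OF _ _ tendsto_const lim]) (use en in \<open>auto intro!: always_eventually\<close>)
  have sp: "sobolev_borel N (\<phi> k)" for k
  proof -
    have "l2sq (\<lambda>x. v x - \<phi> k x) \<le> l2sq v"
      unfolding l2sq_def
    proof (intro nn_integral_mono ennreal_leI power_mono)
      fix x
      have "cmod (v x - \<phi> k x) \<le> 1 * cmod (v x)"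
        unfolding w norm_mult using \<zeta>01 by (intro mult_right_mono) auto
      then show "cmod (v x - \<phi> k x) \<le> cmod (v x)" by simp
    qed auto
    then have "l2sq (\<lambda>x. v x - \<phi> k x) < \<infinity>" using v2 by (rule le_less_trans)
    moreover have "?E (\<lambda>x. v x - \<phi> k x) < \<infinity>"
    proof (rule le_less_trans[OF en])
      have "(\<integral>\<^sup>+x. (if real (Suc k) < norm x then g x else 0) \<partial>lborel) \<le> (\<integral>\<^sup>+x. g x \<partial>lborel)"
        by (intro nn_integral_mono) auto
      then have "(\<integral>\<^sup>+x. (if real (Suc k) < norm x then g x else 0) \<partial>lborel) < \<infinity>"
        using vE gE by (auto intro: le_less_trans)
      then show "2 * (\<integral>\<^sup>+x. (if real (Suc k) < norm x then g x else 0) \<partial>lborel) + 2 * (l2sq v * ennreal (c * real (Suc k) powr (- (2 * \<alpha>)))) < \<infinity>"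
        using v2 by (simp add: ennreal_mult_less_top)
    qed
    ultimately have "sobolev_borel N (\<lambda>x. v x - \<phi> k x)" by (simp add: sobolev_borel_def)
    from sobolev_borel_diff[OF v this] show ?thesis by simp
  qed
  have supp: "\<phi> k x = 0" if "norm x > 2 * real (Suc k)" for k x
    using \<zeta>1[OF that] by (simp add: \<phi>_def)
  show ?thesis using sp supp t1 t2 by blast
qed

text \<open>The order is forced: mollification yields a compactly supported function only if the
  support was bounded before. The equation therefore passes from test functions to Sobolev functions
  of bounded support, and from these by cutoff to all.\<close>

lemma weak_on_sobolev_of_test_functions:
  fixes u f :: "real ^ 'n::finite \<Rightarrow> complex" and \<alpha> N :: real
  assumes n: "CARD('n) \<ge> 2" and \<alpha>: "0 < \<alpha>" "\<alpha> < 1" and N: "N = CARD('n) + 2 * \<alpha>"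
    and [measurable]: "A \<in> borel_measurable borel" "f \<in> borel_measurable borel"
    and A: "AE z in lborel. cmod (A z) \<le> \<Lambda>" and f: "l2sq f < \<infinity>" and u: "sobolev_borel N u"
    and test: "\<And>\<phi>. \<phi> \<in> test_functions \<Longrightarrow> weak_eq N A f u \<phi>"
  shows "weak_on_sobolev N A f u"
proof -
  have cpt: "weak_eq N A f u w" if w: "sobolev_borel N w" and supp: "\<And>x. norm x > R \<Longrightarrow> w x = 0" for w R
  proof -
    obtain \<phi> where \<phi>: "\<And>k::nat. \<phi> k \<in> test_functions" "\<And>k. sobolev_borel N (\<phi> k)"
      "(\<lambda>k. l2sq (\<lambda>x. w x - \<phi> k x)) \<longlonglongrightarrow> 0" "(\<lambda>k. gagliardo N (\<lambda>x. w x - \<phi> k x)) \<longlonglongrightarrow> 0"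
      using mollification_approx[OF \<alpha>(1) N w supp] by blast
    show ?thesis
      by (rule weak_eq_limit[OF _ _ A f u w \<phi>(2) test[OF \<phi>(1)] \<phi>(3,4)]) auto
  qed
  have "weak_eq N A f u v" if v: "sobolev_borel N v" for v
  proof -
    have n': "DIM(real ^ 'n) \<ge> 2" and N': "N = DIM(real ^ 'n) + 2 * \<alpha>" using n N by auto
    obtain \<phi> where \<phi>: "\<And>k::nat. sobolev_borel N (\<phi> k)" "\<And>k x. norm x > 2 * real (Suc k) \<Longrightarrow> \<phi> k x = 0"
      "(\<lambda>k. l2sq (\<lambda>x. v x - \<phi> k x)) \<longlonglongrightarrow> 0" "(\<lambda>k. gagliardo N (\<lambda>x. v x - \<phi> k x)) \<longlonglongrightarrow> 0"
      using cutoff_approx[OF n' \<alpha> N' v] by blast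
    have "weak_eq N A f u (\<phi> k)" for k by (rule cpt[OF \<phi>(1) \<phi>(2)])
    then show ?thesis
      by (rule weak_eq_limit[OF _ _ A f u v \<phi>(1) _ \<phi>(3,4), rotated 2]) auto
  qed
  then show ?thesis unfolding weak_on_sobolev_def weak_eq_def sobolev_borel_def by blast
qed

section \<open>From Lebesgue to Borel measurable functions\<close>

lemma lebesgue_ex_borel:
  fixes f :: "'a::euclidean_space \<Rightarrow> complex"
  assumes f: "f \<in> borel_measurable lebesgue"
  shows "\<exists>g\<in>borel_measurable borel. AE x in lborel. f x = g x"
proof -
  have "(\<lambda>x. Re (f x)) \<in> borel_measurable lebesgue" by (rule measurable_compose[OF f borel_measurable_Re])
  from completion_ex_borel_measurable_real[OF this] obtain a
    where a: "a \<in> borel_measurable lborel" "AE x in lborel. Re (f x) = a x" by (elim bexE)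
  have "(\<lambda>x. Im (f x)) \<in> borel_measurable lebesgue" by (rule measurable_compose[OF f borel_measurable_Im])
  from completion_ex_borel_measurable_real[OF this] obtain b
    where b: "b \<in> borel_measurable lborel" "AE x in lborel. Im (f x) = b x" by (elim bexE)
  have [measurable]: "a \<in> borel_measurable borel" "b \<in> borel_measurable borel" using a(1) b(1) by simp_all
  have "(\<lambda>x. of_real (a x) + \<i> * of_real (b x)) \<in> borel_measurable borel" by measurable
  moreover have "AE x in lborel. f x = of_real (a x) + \<i> * of_real (b x)"
    using a(2) b(2) by eventually_elim (auto intro: complex_eqI)
  ultimately show ?thesis by (intro bexI[of _ "\<lambda>x. of_real (a x) + \<i> * of_real (b x)"])
qed

text \<open>\<open>g\<close> need not be known to be measurable: in a complete measure space it
  inherits measurability from \<open>f\<close>. This handles the integrand of the weak formulation,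
  built from Lebesgue measurable functions of one variable on the product space.\<close>

lemma integral_completion_cong_AE:
  fixes f g :: "'a \<Rightarrow> complex"
  assumes f: "f \<in> borel_measurable M" and eq: "AE x in M. g x = f x"
  shows "(\<integral>x. g x \<partial>completion M) = (\<integral>x. f x \<partial>M)"
proof -
  have f': "f \<in> borel_measurable (completion M)" using f by (rule measurable_completion)
  have eq': "AE x in completion M. g x = f x" using eq by (rule AE_completion)
  have "g \<in> borel_measurable (completion M)"
  proof (rule measurableI)
    fix B :: "complex set" assume B: "B \<in> sets borel"
    show "g -` B \<inter> space (completion M) \<in> sets (completion M)"
    proof (rule completion.in_sets_AE)
      show "f -` B \<inter> space (completion M) \<in> sets (completion M)" using f' B by (rule measurable_sets)
      show "AE x in completion M. (x \<in> f -` B \<inter> space (completion M)) = (x \<in> g -` B \<inter> space (completion M))"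
        using eq' by eventually_elim auto
    qed auto
  qed auto
  then have "(\<integral>x. g x \<partial>completion M) = (\<integral>x. f x \<partial>completion M)" using f' eq' by (intro integral_cong_AE)
  then show ?thesis using f by (simp add: integral_completion)
qed

text \<open>If \<open>P\<close> fails only on the null set \<open>S\<close>, the pairs with a bad
  coordinate lie in \<open>S \<times> UNIV \<union> UNIV \<times> S\<close>, again a null set. Thus
  representatives may be exchanged inside integrals over pairs.\<close>

lemma AE_lborel_fst_snd:
  fixes P :: "'a::euclidean_space \<Rightarrow> bool"
  assumes "AE x in lborel. P x"
  shows "AE z in (lborel :: ('a \<times> 'a) measure). P (fst z) \<and> P (snd z)"
proof -
  obtain S where S: "{x. \<not> P x} \<subseteq> S" "S \<in> null_sets (lborel :: 'a measure)"
    using assms unfolding eventually_ae_filter by auto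
  then have [measurable]: "S \<in> sets lborel" and S0: "emeasure lborel S = 0" by auto
  have "S \<times> UNIV \<in> null_sets (lborel \<Otimes>\<^sub>M (lborel :: 'a measure))" "UNIV \<times> S \<in> null_sets ((lborel :: 'a measure) \<Otimes>\<^sub>M lborel)"
    using S0 \<open>S \<in> sets lborel\<close>
    by (simp_all add: null_sets_def lborel.emeasure_pair_measure_Times pair_measureI del: sets_lborel)
  then have "S \<times> UNIV \<union> UNIV \<times> S \<in> null_sets (lborel :: ('a \<times> 'a) measure)"
    unfolding lborel_prod by (rule null_sets.Un)
  then show ?thesis by (rule AE_I') (use S in auto)
qed

section \<open>Powers of extended reals and exchange of representatives\<close>

lemma ennpowr_2: "0 \<le> r \<Longrightarrow> ennpowr (ennreal r) 2 = ennreal (r\<^sup>2)"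
  by (simp add: ennpowr_def)

lemma ennpowr_ennpowr: "ennpowr (ennpowr x a) b = ennpowr x (a * b)"
  by (cases x) (auto simp: ennpowr_def powr_powr)

lemma ennpowr_finiteD: "ennpowr x r < \<infinity> \<Longrightarrow> x < \<infinity>"
  by (cases x) (auto simp: ennpowr_def)

lemma ennpowr_mono:
  assumes "x \<le> y" "0 < r" shows "ennpowr x r \<le> ennpowr y r"
proof (cases "y = \<infinity>")
  case False
  then obtain b where b: "y = ennreal b" "0 \<le> b" by (cases y) auto
  then obtain a where a: "x = ennreal a" "0 \<le> a" using assms by (cases x) (auto simp: top_unique)
  show ?thesis using a b assms by (auto simp: ennpowr_def intro!: ennreal_leI powr_mono2)
qed (simp add: ennpowr_def)

lemma ennpowr_square_half: "(ennpowr x (1 / 2))\<^sup>2 = x"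
  by (cases x) (auto simp: ennpowr_def ennreal_power powr_half_sqrt)

lemma Lp_norm_2_eq:
  assumes "AE x in lborel. u x = v x"
  shows "Lp_norm_complex 2 u = ennpowr (l2sq v) (1 / 2)"
proof -
  have "(\<integral>\<^sup>+x. ennpowr (ennreal (cmod (u x))) 2 \<partial>lborel) = l2sq v"
    unfolding l2sq_def using assms by (intro nn_integral_cong_AE) (auto simp: ennpowr_2)
  then show ?thesis by (simp add: Lp_norm_def nn_integral_completion)
qed

text \<open>Valid on the diagonal too, where \<open>0 powr (-N)\<close> and division by zero both
  give 0.\<close>

lemma divide_frac_denom:
  assumes "N = real CARD('n) + 2 * \<alpha>"
  shows "a / frac_denom \<alpha> x y = dist x (y :: real ^ 'n::finite) powr (-N) * a"
    and "c / complex_of_real (frac_denom \<alpha> x y) = of_real (dist x y powr (-N)) * c"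
  unfolding frac_denom_def assms dist_norm powr_minus_divide by simp_all

lemma gamma_Lp_norm_eq:
  fixes u v :: "real ^ 'n::finite \<Rightarrow> complex"
  assumes eq: "AE x in lborel. u x = v x" and N: "N = real CARD('n) + 2 * \<alpha>"
  shows "Lp_norm p (Gamma_fun \<alpha> u)
    = ennpowr (\<integral>\<^sup>+x. ennpowr (gamma_sq N v x) (p / 2) \<partial>lborel) (1 / p)"
proof -
  have "AE x in lborel. ennpowr (Gamma_fun \<alpha> u x) p = ennpowr (gamma_sq N v x) (p / 2)"
    using eq
  proof eventually_elim
    fix x assume x: "u x = v x"
    have "(\<integral>\<^sup>+y. ennreal ((cmod (u x - u y))\<^sup>2 / frac_denom \<alpha> x y) \<partial>lborel) = (gamma_sq N v x)"
      unfolding x divide_frac_denom(1)[OF N] by (rule nn_integral_cong_AE, use eq in eventually_elim) simp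
    then show "ennpowr (Gamma_fun \<alpha> u x) p = ennpowr (gamma_sq N v x) (p / 2)"
      by (simp add: Gamma_fun_def nn_integral_completion ennpowr_ennpowr)
  qed
  then have "(\<integral>\<^sup>+x. ennpowr (Gamma_fun \<alpha> u x) p \<partial>lborel) = (\<integral>\<^sup>+x. ennpowr (gamma_sq N v x) (p / 2) \<partial>lborel)"
    by (rule nn_integral_cong_AE)
  then show ?thesis by (simp add: Lp_norm_def nn_integral_completion)
qed

lemma frac_sobolev_borel:
  fixes u v :: "real ^ 'n::finite \<Rightarrow> complex"
  assumes u: "u \<in> frac_sobolev \<alpha>" and v: "v \<in> borel_measurable borel"
    and eq: "AE x in lborel. u x = v x" and N: "N = real CARD('n) + 2 * \<alpha>"
  shows "sobolev_borel N v"
proof -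
  have "ennpowr (l2sq v) (1 / 2) < \<infinity>"
    using u Lp_norm_2_eq[OF eq] by (simp add: frac_sobolev_def L2_functions_def)
  then have l2: "l2sq v < \<infinity>" by (rule ennpowr_finiteD)
  have "(\<integral>\<^sup>+(x, y). ennreal ((cmod (u x - u y))\<^sup>2 / frac_denom \<alpha> x y) \<partial>lborel) = gagliardo N v"
  proof -
    have "(\<integral>\<^sup>+(x, y). ennreal ((cmod (u x - u y))\<^sup>2 / frac_denom \<alpha> x y) \<partial>lborel)
      = (\<integral>\<^sup>+z. ennreal (dist (fst z) (snd z) powr (-N) * (cmod (v (fst z) - v (snd z)))\<^sup>2) \<partial>lborel)"
      unfolding divide_frac_denom(1)[OF N] case_prod_beta
      by (rule nn_integral_cong_AE, use AE_lborel_fst_snd[OF eq] in eventually_elim) simp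
    also have "\<dots> = gagliardo N v" by (rule energy_eq_prod[OF _ v, symmetric]) measurable
    finally show ?thesis .
  qed
  then have "gagliardo N v < \<infinity>"
    using u by (simp add: frac_sobolev_def nn_integral_completion)
  then show ?thesis using l2 v by (simp add: sobolev_borel_def)
qed

lemma weak_solution_borel:
  fixes u v f g :: "real ^ 'n::finite \<Rightarrow> complex"
  assumes ws: "weak_solution \<alpha> A f u" and [measurable]: "B \<in> borel_measurable borel" "v \<in> borel_measurable borel" "g \<in> borel_measurable borel"
    and eq: "AE z in lborel. A z = B z" "AE x in lborel. u x = v x" "AE x in lborel. f x = g x"
    and N: "N = real CARD('n) + 2 * \<alpha>" and \<phi>: "\<phi> \<in> test_functions"
  shows "weak_eq N B g v \<phi>"
proof -
  have "Ck_function 0 \<phi>" using \<phi> unfolding test_functions_def by blast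
  then have [measurable]: "\<phi> \<in> borel_measurable borel" by (intro borel_measurable_continuous_onI) simp
  have "(LINT (x, y) | lebesgue. A (x, y) * ((u x - u y) * cnj (\<phi> x - \<phi> y)) / of_real (frac_denom \<alpha> x y)) = (\<integral>z. form_density N B v \<phi> z \<partial>lborel)"
  proof (rule integral_completion_cong_AE)
    show "form_density N B v \<phi> \<in> borel_measurable lborel" by measurable
    show "AE z in lborel. (case z of (x, y) \<Rightarrow> A (x, y) * ((u x - u y) * cnj (\<phi> x - \<phi> y)) / of_real (frac_denom \<alpha> x y)) = form_density N B v \<phi> z"
      unfolding divide_frac_denom(2)[OF N] case_prod_beta form_density_def
      using eq(1) AE_lborel_fst_snd[OF eq(2)] by eventually_elim simp
  qed
  moreover have "(LINT x | lebesgue. f x * cnj (\<phi> x)) = (\<integral>x. g x * cnj (\<phi> x) \<partial>lborel)"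
    by (rule integral_completion_cong_AE) (use eq(3) in \<open>auto elim: eventually_mono\<close>)
  ultimately show ?thesis using ws \<phi> by (simp add: weak_solution_def weak_eq_def)
qed

theorem corollary4p9:
  fixes \<alpha> lam :: real
  assumes "CARD('n::finite) \<ge> 2"
    and "0 < \<alpha>" and "\<alpha> < 1"
    and "0 < lam"
  shows "\<exists>p c :: real. 2 < p \<and> 0 < c \<and>
    (\<forall>(A :: (real ^ 'n) \<times> (real ^ 'n) \<Rightarrow> complex)
      (f :: real ^ 'n \<Rightarrow> complex) (u :: real ^ 'n \<Rightarrow> complex).
       A \<in> borel_measurable lebesgue \<longrightarrow>
       (AE z in lebesgue. lam \<le> Re (A z) \<and> Re (A z) \<le> cmod (A z) \<and> cmod (A z) \<le> 1 / lam) \<longrightarrow>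
       f \<in> L2_functions \<longrightarrow>
       u \<in> frac_sobolev \<alpha> \<longrightarrow>
       weak_solution \<alpha> A f u \<longrightarrow>
       Lp_norm p (Gamma_fun \<alpha> u) \<le>
         ennreal c * (Lp_norm_complex 2 u + Lp_norm_complex 2 f))"
proof -
  define N where "N = real CARD('n) + 2 * \<alpha>"
  have n': "DIM(real ^ 'n) \<ge> 2" and N': "N = DIM(real ^ 'n) + 2 * \<alpha>" using assms(1) by (auto simp: N_def)
  obtain p c where p: "2 < p" and c: "0 < c" and main: "\<And>A (u :: real ^ 'n \<Rightarrow> complex) f K. A \<in> borel_measurable borel \<Longrightarrow> u \<in> borel_measurable borel \<Longrightarrow> f \<in> borel_measurable borel \<Longrightarrow>
    (AE z in lborel. lam \<le> Re (A z) \<and> cmod (A z) \<le> 1 / lam) \<Longrightarrow>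
    gagliardo N u < \<infinity> \<Longrightarrow> weak_on_sobolev N A f u \<Longrightarrow>
    0 < K \<Longrightarrow> l2sq u \<le> ennreal (K\<^sup>2) \<Longrightarrow> l2sq f \<le> ennreal (K\<^sup>2) \<Longrightarrow>
    (\<integral>\<^sup>+x. ennpowr (gamma_sq N u x) (p / 2) \<partial>lborel) \<le> ennreal (c * K powr p)"
    using gamma_Lp_bound[OF n' assms(2,3) N' assms(4)] by blast
  define c' where "c' = c powr (1 / p)"
  have c': "0 < c'" using c by (simp add: c'_def)
  have *: "Lp_norm p (Gamma_fun \<alpha> u) \<le> ennreal c' * (Lp_norm_complex 2 u + Lp_norm_complex 2 f)"
    if A: "A \<in> borel_measurable lebesgue" and ell: "AE z in lebesgue. lam \<le> Re (A z) \<and> Re (A z) \<le> cmod (A z) \<and> cmod (A z) \<le> 1 / lam"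
      and f: "f \<in> L2_functions" and u: "u \<in> frac_sobolev \<alpha>" and ws: "weak_solution \<alpha> A f u"
    for A and f u :: "real ^ 'n \<Rightarrow> complex"
  proof -
    obtain B where B[measurable]: "B \<in> borel_measurable borel" and AB: "AE z in lborel. A z = B z"
      using lebesgue_ex_borel[OF A] by (elim bexE)
    obtain g where g[measurable]: "g \<in> borel_measurable borel" and fg: "AE x in lborel. f x = g x"
    proof -
      have "f \<in> borel_measurable lebesgue" using f by (simp add: L2_functions_def)
      from lebesgue_ex_borel[OF this] show thesis by (elim bexE) (rule that)
    qed
    obtain v where v[measurable]: "v \<in> borel_measurable borel" and uv: "AE x in lborel. u x = v x"
    proof -
      have "u \<in> borel_measurable lebesgue" using u by (simp add: frac_sobolev_def L2_functions_def)
      from lebesgue_ex_borel[OF this] show thesis by (elim bexE) (rule that)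
    qed
    have vs: "sobolev_borel N v" by (rule frac_sobolev_borel[OF u v uv N_def])
    have g2: "l2sq g < \<infinity>"
      by (rule ennpowr_finiteD[of _ "1 / 2"]) (use f Lp_norm_2_eq[OF fg] in \<open>simp add: L2_functions_def\<close>)
    have ell': "AE z in lborel. lam \<le> Re (B z) \<and> cmod (B z) \<le> 1 / lam"
      using ell[unfolded AE_completion_iff] AB by eventually_elim auto
    have ell'': "AE z in lborel. cmod (B z) \<le> 1 / lam" using ell' by eventually_elim auto
    have w: "weak_on_sobolev N B g v"
      by (rule weak_on_sobolev_of_test_functions[OF assms(1-3) N_def B g ell'' g2 vs])
        (rule weak_solution_borel[OF ws B v g AB uv fg N_def])
    define X where "X = Lp_norm_complex 2 u + Lp_norm_complex 2 f"
    have Xu: "l2sq v \<le> X\<^sup>2" and Xf: "l2sq g \<le> X\<^sup>2"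
    proof -
      have "(ennpowr (l2sq v) (1 / 2))\<^sup>2 \<le> X\<^sup>2" "(ennpowr (l2sq g) (1 / 2))\<^sup>2 \<le> X\<^sup>2"
        unfolding X_def Lp_norm_2_eq[OF uv] Lp_norm_2_eq[OF fg] by (rule power_mono; simp)+
      then show "l2sq v \<le> X\<^sup>2" "l2sq g \<le> X\<^sup>2" by (simp_all only: ennpowr_square_half)
    qed
    have "X < \<infinity>" using f u unfolding X_def by (simp add: frac_sobolev_def L2_functions_def)
    then obtain x where x: "X = ennreal x" "0 \<le> x" by (cases X) auto
    \<comment> \<open>\<open>main\<close> requires a positive \<open>K\<close>, but both norms may
      vanish. \<open>K = x + d / c'\<close> is positive and costs exactly \<open>d\<close> in the
      final bound; letting \<open>d\<close> tend to 0 removes it.\<close>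
    have "Lp_norm p (Gamma_fun \<alpha> u) \<le> ennreal c' * X + ennreal d" if d: "0 < d" for d
    proof -
      define K where "K = x + d / c'"
      have K: "0 < K" "x \<le> K" using x d c' by (auto simp: K_def add_nonneg_pos)
      have "x\<^sup>2 \<le> K\<^sup>2" using x(2) K(2) by (intro power_mono)
      then have "X\<^sup>2 \<le> ennreal (K\<^sup>2)" unfolding x(1) ennreal_power[OF x(2)] by (rule ennreal_leI)
      then have vK: "l2sq v \<le> ennreal (K\<^sup>2)" and gK: "l2sq g \<le> ennreal (K\<^sup>2)"
        using order_trans[OF Xu] order_trans[OF Xf] by simp_all
      have "gagliardo N v < \<infinity>" using vs by (simp add: sobolev_borel_def)
      from main[OF B v g ell' this w K(1) vK gK]
      have "Lp_norm p (Gamma_fun \<alpha> u) \<le> ennpowr (ennreal (c * K powr p)) (1 / p)"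
        unfolding gamma_Lp_norm_eq[OF uv N_def] by (rule ennpowr_mono) (use p in simp)
      also have "\<dots> = ennreal (c' * K)"
        using c p K by (simp add: ennpowr_def powr_mult powr_powr c'_def)
      also have "c' * K = c' * x + d" using c' by (simp add: K_def distrib_left)
      also have "ennreal (c' * x + d) = ennreal c' * X + ennreal d"
        unfolding x(1) using x(2) c' d by (simp add: ennreal_mult)
      finally show ?thesis .
    qed
    then show ?thesis unfolding X_def[symmetric]
      by (rule ennreal_le_epsilon)
  qed
  show ?thesis
    by (intro exI[of _ p] exI[of _ c'] conjI allI impI p c') (rule *)
qed

end
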